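(* Let $d\ge 7$ and $g\ge 1$ be integers and let $G$ be a $d$-regular graph of girth at least $4g+1$. Then for every integer $1\le r\le g$, \[\mathrm{col}_r(G)\ \ge\ \frac{d}{2}\left(\frac{d-2}{4}\right)^{2^{\lfloor \log_2 r\rfloor}-1}.\]
   Context: All graphs are finite and simple. A linear order on $V(G)$ is an injective map $L\colon V(G)\to\mathbb{N}$; $\Pi(G)$ is the set of all such orders. The length of a path is its number of edges. A vertex $u$ is strongly $r$-reachable from $v$ with respect to $L$ if there is a path $P$ of length $0\le\ell\le r$ from $v$ to $u$ with $L(u)\le L(w)$ for all $w\in V(P)$ and $L(v)<L(w)$ for all inner vertices $w$ of $P$; $\mathrm{SReach}_r[G,L,v]$ is the set of such $u$. The $r$-colouring number is $\mathrm{col}_r(G)=\min_{L\in\Pi(G)}\max_{v\in V(G)}|\mathrm{SReach}_r[G,L,v]|$. *)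

theory Defs
  imports Complex_Main "HOL-Library.Extended_Nat" "Graph_Theory.Graph_Theory"
begin

text \<open>
  A finite simple graph is a digraph satisfying the locale \<open>graph\<close>: finite, symmetric, without
  loops and without parallel arcs, so each undirected edge is a pair of opposite arcs.  Hence the
  out-degree of a vertex is its number of neighbours.
\<close>

definition regular_graph :: "('a, 'b) pre_digraph \<Rightarrow> nat \<Rightarrow> bool" where
  "regular_graph G d \<longleftrightarrow> (\<forall>v \<in> verts G. out_degree G v = d)"

text \<open>
  The constant \<open>pre_digraph.cycle\<close> also counts the closed walks \<open>u, v, u\<close> that run back and forth
  along one edge; these are not cycles of the undirected graph and are excluded by the bound 3.
  An acyclic graph has girth \<open>\<infinity>\<close>.
\<close>

definition girth :: "('a, 'b) pre_digraph \<Rightarrow> enat" where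
  "girth G = (INF p \<in> {p. pre_digraph.cycle G p \<and> 3 \<le> length p}. enat (length p))"

definition linear_orders :: "('a, 'b) pre_digraph \<Rightarrow> ('a \<Rightarrow> nat) set" where
  "linear_orders G = {L. inj_on L (verts G)}"

definition SReach :: "nat \<Rightarrow> ('a, 'b) pre_digraph \<Rightarrow> ('a \<Rightarrow> nat) \<Rightarrow> 'a \<Rightarrow> 'a set" where
  "SReach r G L v = {u. \<exists>p. vpath p G \<and> hd p = v \<and> last p = u \<and> vwalk_length p \<le> r \<and>
     (\<forall>w \<in> set p. L u \<le> L w) \<and> (\<forall>w \<in> set p - {v, u}. L v < L w)}"

definition max_SReach :: "nat \<Rightarrow> ('a, 'b) pre_digraph \<Rightarrow> ('a \<Rightarrow> nat) \<Rightarrow> nat" where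
  "max_SReach r G L = (MAX v \<in> verts G. card (SReach r G L v))"

text \<open>
  The infimum is taken in the natural numbers, so it is a minimum; see \<open>col_attained\<close>.
\<close>

definition col :: "nat \<Rightarrow> ('a, 'b) pre_digraph \<Rightarrow> nat" where
  "col r G = (INF L \<in> linear_orders G. max_SReach r G L)"

lemma linear_orders_nonempty:
  assumes "finite (verts G)"
  shows "linear_orders G \<noteq> {}"
  using finite_imp_inj_to_nat_seg[OF assms] by (auto simp: linear_orders_def)

lemma col_le: "L \<in> linear_orders G \<Longrightarrow> col r G \<le> max_SReach r G L"
  unfolding col_def by (rule cINF_lower) auto

lemma col_attained:
  assumes "finite (verts G)"
  obtains L where "L \<in> linear_orders G" "col r G = max_SReach r G L"
  using Inf_nat_def1[of "max_SReach r G ` linear_orders G"] linear_orders_nonempty[OF assms]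
  unfolding col_def by auto

lemma SReach_subset: "SReach r G L v \<subseteq> verts G"
  by (auto simp: SReach_def vpath_def vwalk_def)

end

theory Submission
  imports Defs
begin

text \<open>
  Put \<open>D = d - 1\<close>. As the girth exceeds \<open>4 * g\<close>, a non-backtracking walk with at most \<open>4 * g\<close> edges is a
  path, and a walk can be prolonged in exactly \<open>D\<close> ways. A fall from \<open>u\<close> is such a path whose inner
  vertices lie above \<open>u\<close> and whose end lies below \<open>u\<close>. Different falls with at most \<open>r\<close> edges have
  different ends, and these are strongly reachable from \<open>u\<close>, so it suffices to show that there are many
  falls on average. Reversing it if necessary, a good path, whose inner vertices lie above both ends, is
  a fall. Two falls from \<open>u\<close> with different first edges glue to a good path.

  Let \<open>\<xi> n\<close> be the average over \<open>u\<close> of the proportion of the walks of length \<open>n\<close> from \<open>u\<close> that are falls. Splitting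
  good paths at their minimal inner vertex gives a quadratic recursion for \<open>\<xi>\<close>. Its error terms
  come from pairs of falls with a common first edge; they are controlled by gluing the pairs at the
  vertex where they branch. The induction that doubles \<open>r\<close> directly loses too much through this error.
  Instead, for \<open>r \<le> 16\<close> the claim follows from the recursion by weighing it with a generating
  function. For \<open>r = 8 * K \<ge> 32\<close> consider walks of length \<open>m = 5 * K\<close> that end in their strict minimum:
  they have density at least \<open>1 / (2 * m + 1)\<close>, because a walk of length \<open>2 * m\<close> has a minimum. Gluing
  pairs of these yields an \<open>n > 4 * K\<close> for which \<open>\<xi> n\<close> is only polynomially small in \<open>K\<close>, and gluing pairs of
  falls of length \<open>n\<close> then yields good paths of length at most \<open>r\<close> with a loss that \<open>4 ^ (r - 1)\<close> absorbs.
\<close>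

section \<open>Non-backtracking walks\<close>

text \<open>For every power of two r the target is \<open>weight r\<close> \<ge> ((D - 1) / 4) ^ (r
  - 1), where (D + 1) / 2 * \<open>weight r\<close> is the average number of falls of length at most
  r. The recursion produces products \<open>q a u * q b u\<close> at a single vertex, which cannot
  be replaced by products of averages. This is why second moments of \<open>q a\<close> occur
  throughout. Gluing pairs bounds the second moment of \<open>q a\<close>, for every a \<ge> m, by
  the densities at even lengths up to 2 * m, so smallness near 2 * m is inherited by all longer
  lengths. For r = 8 and r = 16 the negated claim serves as a budget: it bounds every \<xi> n with n
  \<le> r, and by inheritance also the products of total length above the range of the recursion.
  For r = 8 * K the same second moment bound turns one density x = \<xi> n with n > 4 * K into
  \<open>weight r\<close> \<ge> x ^ 3 / 4 * D ^ (r - 1). A value x \<ge> 1 / 4 ^ (2 * K + 2) is then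
  enough, and a polynomially small x is far above that once K is large.\<close>

definition nbw :: "'a set \<Rightarrow> ('a \<Rightarrow> 'a set) \<Rightarrow> 'a list \<Rightarrow> bool" where
  "nbw V nbr p \<longleftrightarrow> p \<noteq> [] \<and> set p \<subseteq> V \<and> (\<forall>i. Suc i < length p \<longrightarrow> p ! Suc i \<in> nbr (p ! i))
     \<and> (\<forall>i. Suc (Suc i) < length p \<longrightarrow> p ! Suc (Suc i) \<noteq> p ! i)"

text \<open>The walks share their first vertex. It is dropped from \<open>p\<close>, so that it
  occurs once, at position \<open>length p - 1\<close>.\<close>

definition glue :: "'a list \<Rightarrow> 'a list \<Rightarrow> 'a list" where
  "glue p q = rev (tl p) @ q"

lemma length_glue [simp]: "length (glue p q) = length p - 1 + length q"
  by (simp add: glue_def)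

lemma glue_nth_right: "glue p q ! (length p - 1 + j) = q ! j"
  by (simp add: glue_def nth_append)

lemma glue_nth_left:
  assumes "i < length p" "p ! 0 = q ! 0" "q \<noteq> []"
  shows "glue p q ! i = p ! (length p - 1 - i)"
proof (cases "i < length p - 1")
  case True
  then show ?thesis by (simp add: glue_def nth_append rev_nth nth_tl Suc_diff_Suc)
next
  case False
  then have "i = length p - 1 + 0" using assms by simp
  then show ?thesis using glue_nth_right[of p q 0] assms by simp
qed

text \<open>\<open>D\<close> is the degree minus one, and \<open>len\<close> is the number of edges
  up to which the girth turns non-backtracking walks into paths. The order \<open>L\<close> is fixed
  and arbitrary.\<close>

locale nb_graph =
  fixes V :: "'a set" and nbr :: "'a \<Rightarrow> 'a set" and D :: nat and L :: "'a \<Rightarrow> nat" and len :: nat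
  assumes finite_V: "finite V" and V_nonempty: "V \<noteq> {}"
    and nbr_subset: "x \<in> V \<Longrightarrow> nbr x \<subseteq> V"
    and nbr_sym: "x \<in> V \<Longrightarrow> y \<in> nbr x \<Longrightarrow> x \<in> nbr y"
    and card_nbr: "x \<in> V \<Longrightarrow> card (nbr x) = Suc D"
    and inj_L: "inj_on L V"
    and nbw_distinct: "nbw V nbr p \<Longrightarrow> length p \<le> Suc len \<Longrightarrow> distinct p"
    and D_ge: "6 \<le> D"
begin

abbreviation nb :: "'a list \<Rightarrow> bool" where "nb \<equiv> nbw V nbr"

lemma finite_nbr: "x \<in> V \<Longrightarrow> finite (nbr x)"
  using card_nbr card.infinite by fastforce

lemma nb_nth_V: "nb p \<Longrightarrow> i < length p \<Longrightarrow> p ! i \<in> V"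
  unfolding nbw_def by (meson nth_mem subsetD)

lemma nb_nonempty: "nb p \<Longrightarrow> p \<noteq> []" by (simp add: nbw_def)

lemma nb_step: "nb p \<Longrightarrow> Suc i < length p \<Longrightarrow> p ! Suc i \<in> nbr (p ! i)"
  by (simp add: nbw_def)

lemma nb_step_back: "nb p \<Longrightarrow> Suc i < length p \<Longrightarrow> p ! i \<in> nbr (p ! Suc i)"
  using nb_step nbr_sym nb_nth_V Suc_lessD by metis

lemma nb_turn: "nb p \<Longrightarrow> Suc (Suc i) < length p \<Longrightarrow> p ! Suc (Suc i) \<noteq> p ! i"
  by (simp add: nbw_def)

lemma nbI:
  assumes "p \<noteq> []" "\<And>i. i < length p \<Longrightarrow> p ! i \<in> V"
    "\<And>i. Suc i < length p \<Longrightarrow> p ! Suc i \<in> nbr (p ! i)"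
    "\<And>i. Suc (Suc i) < length p \<Longrightarrow> p ! Suc (Suc i) \<noteq> p ! i"
  shows "nb p"
  using assms unfolding nbw_def by (auto simp: in_set_conv_nth)

lemma nb_take: "nb p \<Longrightarrow> 0 < k \<Longrightarrow> nb (take k p)"
  unfolding nbw_def using set_take_subset by (fastforce dest: in_set_takeD)

lemma nb_drop: "nb p \<Longrightarrow> k < length p \<Longrightarrow> nb (drop k p)"
  unfolding nbw_def by (auto dest: in_set_dropD)

lemma nb_rev:
  assumes "nb p" shows "nb (rev p)"
proof (rule nbI)
  show "rev p \<noteq> []" using assms by (simp add: nbw_def)
next
  fix i assume "i < length (rev p)"
  then show "rev p ! i \<in> V" using assms by (simp add: rev_nth nb_nth_V)
next
  fix i assume i: "Suc i < length (rev p)"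
  define j where "j = length p - Suc (Suc i)"
  have "rev p ! i = p ! Suc j" "rev p ! Suc i = p ! j" "Suc j < length p"
    using i by (auto simp: rev_nth j_def Suc_diff_Suc)
  then show "rev p ! Suc i \<in> nbr (rev p ! i)" using assms nb_step_back by simp
next
  fix i assume i: "Suc (Suc i) < length (rev p)"
  define j where "j = length p - Suc (Suc (Suc i))"
  have "rev p ! i = p ! Suc (Suc j)" "rev p ! Suc (Suc i) = p ! j" "Suc (Suc j) < length p"
    using i by (auto simp: rev_nth j_def Suc_diff_Suc)
  then show "rev p ! Suc (Suc i) \<noteq> rev p ! i" using assms nb_turn by metis
qed

lemma nb_snoc:
  assumes "nb p" "y \<in> nbr (last p)" "\<And>i. length p = Suc (Suc i) \<Longrightarrow> y \<noteq> p ! i"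
  shows "nb (p @ [y])"
proof (rule nbI)
  have l: "last p = p ! (length p - 1)" "p \<noteq> []"
    using assms nb_nonempty last_conv_nth by auto
  have y: "y \<in> V"
    using assms nbr_subset[OF nb_nth_V[of p "length p - 1"]] l by auto
  show "p @ [y] \<noteq> []" by simp
  show "(p @ [y]) ! i \<in> V" if "i < length (p @ [y])" for i
    using that y nb_nth_V[OF assms(1)] by (auto simp: nth_append)
  show "(p @ [y]) ! Suc i \<in> nbr ((p @ [y]) ! i)" if "Suc i < length (p @ [y])" for i
  proof (cases "Suc i < length p")
    case True then show ?thesis using nb_step[OF assms(1)] by (simp add: nth_append)
  next
    case False
    then have "i = length p - 1" "Suc i = length p" using that by auto
    then show ?thesis using assms l by (simp add: nth_append)
  qed
  show "(p @ [y]) ! Suc (Suc i) \<noteq> (p @ [y]) ! i" if "Suc (Suc i) < length (p @ [y])" for i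
  proof (cases "Suc (Suc i) < length p")
    case True then show ?thesis using nb_turn[OF assms(1)] by (simp add: nth_append)
  next
    case False
    then have "length p = Suc (Suc i)" using that by auto
    then show ?thesis using assms(3) by (simp add: nth_append)
  qed
qed

lemma nb_glue:
  assumes p: "nb p" and q: "nb q" and 0: "p ! 0 = q ! 0"
    and 1: "1 < length p \<Longrightarrow> 1 < length q \<Longrightarrow> p ! 1 \<noteq> q ! 1"
  shows "nb (glue p q)"
proof (rule nbI)
  define k where "k = length p - 1"
  have ne: "p \<noteq> []" "q \<noteq> []" using p q nb_nonempty by auto
  have lp: "length p = Suc k" using ne by (simp add: k_def)
  have left: "glue p q ! i = p ! (k - i)" if "i \<le> k" for i
    using glue_nth_left[of i p q] that 0 ne lp by simp
  have right: "glue p q ! (k + j) = q ! j" for j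
    using glue_nth_right[of p q j] by (simp add: k_def)
  have lg: "length (glue p q) = k + length q" by (simp add: k_def)
  show "glue p q \<noteq> []" using ne by (simp add: glue_def)
  show "glue p q ! i \<in> V" if i: "i < length (glue p q)" for i
  proof (cases "i \<le> k")
    case True then show ?thesis using left nb_nth_V[OF p] lp by simp
  next
    case False
    then obtain j where "i = k + j" using le_Suc_ex by (metis nat_le_linear)
    then show ?thesis using right i lg nb_nth_V[OF q] by simp
  qed
  show "glue p q ! Suc i \<in> nbr (glue p q ! i)" if i: "Suc i < length (glue p q)" for i
  proof (cases "Suc i \<le> k")
    case True
    then obtain j where j: "k = Suc i + j" using le_Suc_ex by blast
    have "glue p q ! i = p ! Suc j" "glue p q ! Suc i = p ! j" using left[of i] left[of "Suc i"] j by auto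
    then show ?thesis using nb_step_back[OF p, of j] lp j by simp
  next
    case False
    then have "k \<le> i" by simp
    then obtain j where "i = k + j" using le_Suc_ex by blast
    then show ?thesis using right[of j] right[of "Suc j"] i lg nb_step[OF q, of j] by simp
  qed
  show "glue p q ! Suc (Suc i) \<noteq> glue p q ! i" if i: "Suc (Suc i) < length (glue p q)" for i
  proof (cases "Suc (Suc i) \<le> k")
    case True
    then obtain j where j: "k = Suc (Suc i) + j" using le_Suc_ex by blast
    have "glue p q ! i = p ! Suc (Suc j)" "glue p q ! Suc (Suc i) = p ! j"
      using left[of i] left[of "Suc (Suc i)"] j by auto
    then show ?thesis using nb_turn[OF p, of j] lp j by simp
  next
    case False
    show ?thesis
    proof (cases "Suc i = k")
      case True
      then have "glue p q ! i = p ! 1" "glue p q ! Suc (Suc i) = q ! 1"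
        using left[of i] right[of 1] by auto
      then show ?thesis using 1 lp lg i True by auto
    next
      case False
      then have "k \<le> i" using \<open>\<not> Suc (Suc i) \<le> k\<close> by simp
      then obtain j where "i = k + j" using le_Suc_ex by blast
      then show ?thesis using right[of j] right[of "Suc (Suc j)"] i lg nb_turn[OF q, of j] by simp
    qed
  qed
qed

definition exts :: "'a list \<Rightarrow> nat \<Rightarrow> 'a list set" where
  "exts p k = {q. nb q \<and> length q = length p + k \<and> take (length p) q = p}"

lemma exts_Suc:
  assumes "nb p" "2 \<le> length p"
  shows "exts p (Suc k) = (\<lambda>(q, y). q @ [y]) ` (SIGMA q : exts p k. nbr (last q) - {q ! (length q - 2)})"
    (is "?l = ?r")
proof (intro set_eqI iffI)
  fix q assume q: "q \<in> ?l"
  define r y where "r = butlast q" and "y = last q"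
  have ne: "q \<noteq> []" "length q = Suc (length p + k)" using q by (auto simp: exts_def nbw_def)
  have qe: "q = r @ [y]" using ne by (simp add: r_def y_def)
  have lr: "length r = length p + k" using ne by (simp add: r_def)
  have "0 < length r" using lr assms by linarith
  then have nr: "nb r" using nb_take[of q "length r"] q qe by (auto simp: exts_def)
  have tr: "take (length p) r = p" using q qe lr by (simp add: exts_def)
  define j where "j = length r - 2"
  have j: "length r = Suc (Suc j)" using lr assms(2) by (simp add: j_def)
  have lq: "length q = Suc (Suc (Suc j))" "nb q" using q qe j by (auto simp: exts_def)
  have nth: "q ! Suc (Suc j) = y" "q ! Suc j = r ! Suc j" "q ! j = r ! j"
    using qe j by (simp_all add: nth_append)
  have "last r = r ! Suc j" using nb_nonempty[OF nr] j by (simp add: last_conv_nth)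
  then have a: "y \<in> nbr (last r)" using nb_step[OF lq(2), of "Suc j"] lq nth by simp
  have b: "y \<noteq> r ! (length r - 2)" using nb_turn[OF lq(2), of j] lq nth j by simp
  show "q \<in> ?r" using qe lr nr tr a b by (auto simp: exts_def image_iff)
next
  fix q assume "q \<in> ?r"
  then obtain r y where q: "q = r @ [y]" and r: "r \<in> exts p k" and y: "y \<in> nbr (last r)" "y \<noteq> r ! (length r - 2)"
    by auto
  have "nb (r @ [y])"
  proof (rule nb_snoc)
    show "nb r" using r by (simp add: exts_def)
    show "y \<in> nbr (last r)" by fact
    show "y \<noteq> r ! i" if "length r = Suc (Suc i)" for i using y(2) that by simp
  qed
  then show "q \<in> ?l" using q r by (auto simp: exts_def)
qed

text \<open>The last edge of \<open>p\<close> excludes one neighbour of the endpoint, so every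
  further step has exactly \<open>D\<close> choices. From a single vertex the first step would have
  \<open>Suc D\<close>.\<close>

lemma exts_card:
  assumes "nb p" "2 \<le> length p"
  shows "finite (exts p k) \<and> card (exts p k) = D ^ k"
proof (induction k)
  case 0
  have "exts p 0 = {p}" using assms by (auto simp: exts_def)
  then show ?case by simp
next
  case (Suc k)
  let ?A = "\<lambda>q. nbr (last q) - {q ! (length q - 2)}"
  have A: "finite (?A q) \<and> card (?A q) = D" if "q \<in> exts p k" for q
  proof -
    have nq: "nb q" and lq: "2 \<le> length q" using that assms by (auto simp: exts_def)
    have l: "last q = q ! Suc (length q - 2)" using nq lq nb_nonempty[OF nq]
      by (simp add: last_conv_nth numeral_2_eq_2 Suc_diff_Suc)
    have "Suc (length q - 2) < length q" using lq by simp
    then have "q ! (length q - 2) \<in> nbr (last q)" "last q \<in> V"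
      using nb_step_back[OF nq] l nb_nth_V[OF nq] by auto
    then show ?thesis using card_nbr finite_nbr by (simp add: card_Diff_singleton)
  qed
  have inj: "inj_on (\<lambda>(q, y). q @ [y]) X" for X :: "('a list \<times> 'a) set" by (auto simp: inj_on_def)
  have "card (exts p (Suc k)) = card (SIGMA q : exts p k. ?A q)"
    unfolding exts_Suc[OF assms] by (rule card_image[OF inj])
  also have "\<dots> = (\<Sum>q\<in>exts p k. card (?A q))"
    using Suc A by (intro card_SigmaI) auto
  also have "\<dots> = (\<Sum>q\<in>exts p k. D)" using A by (intro sum.cong) auto
  finally have "card (exts p (Suc k)) = D ^ Suc k" using Suc by simp
  moreover have "finite (exts p (Suc k))"
    unfolding exts_Suc[OF assms] using Suc A by (intro finite_imageI finite_SigmaI) auto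
  ultimately show ?case by simp
qed

definition walks :: "nat \<Rightarrow> 'a \<Rightarrow> 'a list set" where
  "walks n x = {q. nb q \<and> length q = Suc n \<and> q ! 0 = x}"

lemma nb_pair: "x \<in> V \<Longrightarrow> y \<in> nbr x \<Longrightarrow> nb [x, y]"
  using nbr_subset by (intro nbI) (auto simp: nth_Cons' split: if_splits)

lemma walks_eq_exts: "x \<in> V \<Longrightarrow> walks (Suc n) x = (\<Union>y\<in>nbr x. exts [x, y] n)"
proof (intro set_eqI iffI)
  fix q assume q: "q \<in> walks (Suc n) x"
  then have "q = q ! 0 # q ! 1 # drop 2 q"
    by (auto simp: walks_def length_Suc_conv)
  moreover have "q ! 1 \<in> nbr x" using q nb_step[of q 0] by (auto simp: walks_def)
  ultimately show "q \<in> (\<Union>y\<in>nbr x. exts [x, y] n)" using q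
    by (auto simp: walks_def exts_def length_Suc_conv)
next
  fix q assume "x \<in> V" "q \<in> (\<Union>y\<in>nbr x. exts [x, y] n)"
  then show "q \<in> walks (Suc n) x"
    by (auto simp: walks_def exts_def) (metis nth_Cons_0 nth_take zero_less_Suc)
qed

lemma walks_card:
  assumes "x \<in> V"
  shows "finite (walks (Suc n) x) \<and> card (walks (Suc n) x) = Suc D * D ^ n"
proof -
  have e: "finite (exts [x, y] n) \<and> card (exts [x, y] n) = D ^ n" if "y \<in> nbr x" for y
    using exts_card[OF nb_pair[OF assms that]] by simp
  have "card (\<Union>y\<in>nbr x. exts [x, y] n) = (\<Sum>y\<in>nbr x. card (exts [x, y] n))"
    using e finite_nbr[OF assms] by (intro card_UN_disjoint) (auto simp: exts_def)
  then show ?thesis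
    using e finite_nbr[OF assms] card_nbr[OF assms] walks_eq_exts[OF assms] by auto
qed

lemma finite_walks: "finite (walks n x)"
proof -
  have "walks n x \<subseteq> {q. set q \<subseteq> V \<and> length q = Suc n}" by (auto simp: walks_def nbw_def)
  then show ?thesis using finite_lists_length_eq[OF finite_V] finite_subset by blast
qed


section \<open>Falls and good paths\<close>

definition Fall :: "nat \<Rightarrow> 'a \<Rightarrow> 'a list set" where
  "Fall a u = {p \<in> walks a u. (\<forall>i. 0 < i \<and> i < a \<longrightarrow> L u < L (p ! i)) \<and> L (p ! a) < L u}"

definition Good :: "nat \<Rightarrow> 'a list set" where
  "Good n = {p. nb p \<and> length p = Suc n \<and>
     (\<forall>i. 0 < i \<and> i < n \<longrightarrow> L (p ! 0) < L (p ! i) \<and> L (p ! n) < L (p ! i))}"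

lemma finite_nb: "finite {p. nb p \<and> length p = n}"
proof -
  have "{p. nb p \<and> length p = n} \<subseteq> {p. set p \<subseteq> V \<and> length p = n}" by (auto simp: nbw_def)
  then show ?thesis using finite_lists_length_eq[OF finite_V] finite_subset by blast
qed

lemma finite_Good: "finite (Good n)"
  by (rule finite_subset[OF _ finite_nb[of "Suc n"]]) (auto simp: Good_def)

lemma finite_Fall: "finite (Fall a u)"
  by (rule finite_subset[OF _ finite_walks[of a u]]) (auto simp: Fall_def)

lemma L_neq_ends:
  assumes "nb p" "length p = Suc n" "0 < n" "n \<le> len"
  shows "L (p ! 0) \<noteq> L (p ! n)"
proof -
  have "p ! 0 \<noteq> p ! n" using nbw_distinct[OF assms(1)] assms by (simp add: nth_eq_iff_index_eq)
  then show ?thesis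
    using inj_onD[OF inj_L, of "p ! 0" "p ! n"] nb_nth_V[OF assms(1)] assms by auto
qed

lemma Good_rev: "p \<in> Good n \<Longrightarrow> rev p \<in> Good n"
  by (auto simp: Good_def nb_rev rev_nth)

definition X :: "nat \<Rightarrow> nat" where "X n = (\<Sum>u\<in>V. card (Fall n u))"

text \<open>The inner vertices of a fall lie above its start and the start lies above its end, so a
  fall is the same as a good path traversed towards its lower end.\<close>

lemma X_card:
  assumes "0 < n"
  shows "X n = card {p \<in> Good n. L (p ! n) < L (p ! 0)}"
proof -
  have "{p \<in> Good n. L (p ! n) < L (p ! 0)} = (\<Union>u\<in>V. Fall n u)"
  proof (intro set_eqI iffI)
    fix p assume p: "p \<in> {p \<in> Good n. L (p ! n) < L (p ! 0)}"
    then have "p ! 0 \<in> V" using nb_nth_V[of p 0] by (simp add: Good_def)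
    then show "p \<in> (\<Union>u\<in>V. Fall n u)" using p by (simp add: Good_def Fall_def walks_def)
  next
    fix p assume "p \<in> (\<Union>u\<in>V. Fall n u)"
    then have p: "nb p" "length p = Suc n" "L (p ! n) < L (p ! 0)"
      "\<And>i. 0 < i \<Longrightarrow> i < n \<Longrightarrow> L (p ! 0) < L (p ! i)"
      by (auto simp: Fall_def walks_def)
    then have "L (p ! n) < L (p ! i)" if "0 < i" "i < n" for i
      using that less_trans by blast
    then show "p \<in> {p \<in> Good n. L (p ! n) < L (p ! 0)}" using p by (simp add: Good_def)
  qed
  moreover have "card (\<Union>u\<in>V. Fall n u) = (\<Sum>u\<in>V. card (Fall n u))"
    using finite_V finite_Fall by (intro card_UN_disjoint) (auto simp: Fall_def walks_def)
  ultimately show ?thesis by (simp add: X_def)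
qed

lemma card_Good:
  assumes "0 < n" "n \<le> len"
  shows "card (Good n) = 2 * X n"
proof -
  let ?A = "{p \<in> Good n. L (p ! n) < L (p ! 0)}" and ?B = "{p \<in> Good n. L (p ! 0) < L (p ! n)}"
  have "L (p ! 0) \<noteq> L (p ! n)" if "p \<in> Good n" for p
    using L_neq_ends[of p n] that assms by (simp add: Good_def)
  then have U: "Good n = ?A \<union> ?B" using nat_neq_iff by blast
  have f: "finite ?A" "finite ?B" using finite_Good by auto
  have "card (Good n) = card ?A + card ?B"
    by (subst U, rule card_Un_disjoint) (use f in auto)
  moreover have "bij_betw rev ?A ?B"
  proof (rule bij_betw_byWitness[where f' = rev])
    have r: "rev p ! 0 = p ! n" "rev p ! n = p ! 0" if "p \<in> Good n" for p
      using that by (simp_all add: Good_def rev_nth)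
    show "rev ` ?A \<subseteq> ?B" "rev ` ?B \<subseteq> ?A" using Good_rev r by auto
  qed auto
  ultimately show ?thesis using bij_betw_same_card X_card[OF assms(1)] by fastforce
qed

definition fall1 :: "nat \<Rightarrow> 'a \<Rightarrow> 'a \<Rightarrow> nat" where
  "fall1 a u x = card {p \<in> Fall a u. p ! 1 = x}"

lemma Fall_step: "p \<in> Fall a u \<Longrightarrow> 0 < a \<Longrightarrow> p ! 1 \<in> nbr u"
  using nb_step[of p 0] by (auto simp: Fall_def walks_def)

lemma card_Fall_eq_sum:
  assumes "u \<in> V" "0 < a"
  shows "card (Fall a u) = (\<Sum>x\<in>nbr u. fall1 a u x)"
proof -
  have "Fall a u = (\<Union>x\<in>nbr u. {p \<in> Fall a u. p ! 1 = x})" using Fall_step assms by auto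
  moreover have "card (\<Union>x\<in>nbr u. {p \<in> Fall a u. p ! 1 = x}) = (\<Sum>x\<in>nbr u. card {p \<in> Fall a u. p ! 1 = x})"
    using finite_nbr[OF assms(1)] finite_Fall by (intro card_UN_disjoint) auto
  ultimately show ?thesis by (simp add: fall1_def)
qed

text \<open>Kraft's inequality: a fall stops at its first vertex below \<open>u\<close>, so no fall
  is a proper prefix of another. Hence the extensions of all falls through \<open>x\<close> to
  length \<open>M\<close> are disjoint sets of walks that begin with the edge from \<open>u\<close>
  to \<open>x\<close>.\<close>

lemma fall1_le:
  assumes "u \<in> V" "x \<in> nbr u"
  shows "(\<Sum>a = 1..M. fall1 a u x * D ^ (M - a)) \<le> D ^ (M - 1)"
proof (cases "M = 0")
  case False
  let ?F = "\<lambda>a. {p \<in> Fall a u. p ! 1 = x}"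
  let ?E = "\<lambda>a. \<Union>p\<in>?F a. exts p (M - a)"
  have c: "card (?E a) = fall1 a u x * D ^ (M - a) \<and> finite (?E a)" if a: "a \<in> {1..M}" for a
  proof -
    have e: "finite (exts p (M - a)) \<and> card (exts p (M - a)) = D ^ (M - a)" if "p \<in> ?F a" for p
      using exts_card[of p] that a by (auto simp: Fall_def walks_def)
    have f: "finite (?F a)" using finite_Fall[of a u] by simp
    have "card (?E a) = (\<Sum>p\<in>?F a. card (exts p (M - a)))"
    proof (rule card_UN_disjoint[OF f])
      show "\<forall>p\<in>?F a. finite (exts p (M - a))" using e by blast
      show "\<forall>p\<in>?F a. \<forall>p'\<in>?F a. p \<noteq> p' \<longrightarrow> exts p (M - a) \<inter> exts p' (M - a) = {}"
        by (auto simp: exts_def Fall_def walks_def)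
    qed
    also have "\<dots> = (\<Sum>p\<in>?F a. D ^ (M - a))" using e by (intro sum.cong) auto
    finally show ?thesis using e finite_Fall[of a u] by (auto simp: fall1_def)
  qed
  have sub: "?E a \<subseteq> exts [u, x] (M - 1)" if a: "a \<in> {1..M}" for a
  proof
    fix q assume "q \<in> ?E a"
    then obtain p where p: "p \<in> ?F a" "q \<in> exts p (M - a)" by auto
    have lp: "length p = Suc a" "p ! 0 = u" "p ! 1 = x" using p by (auto simp: Fall_def walks_def)
    have q: "nb q" "length q = Suc M" "take (Suc a) q = p" using p(2) lp a by (auto simp: exts_def)
    have "q ! 0 = u" "q ! 1 = x"
      using lp a nth_take[of 0 "Suc a" q] nth_take[of 1 "Suc a" q] q(3) by auto
    then have "take 2 q = [u, x]" using q(2) False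
      by (cases q; cases "tl q") (auto simp: numeral_2_eq_2)
    then show "q \<in> exts [u, x] (M - 1)" using q False by (auto simp: exts_def numeral_2_eq_2)
  qed
  have disj: "?E a \<inter> ?E b = {}" if "a \<in> {1..M}" "b \<in> {1..M}" "a < b" for a b
  proof (rule ccontr)
    assume "?E a \<inter> ?E b \<noteq> {}"
    then obtain q p r where p: "p \<in> ?F a" "q \<in> exts p (M - a)" and r: "r \<in> ?F b" "q \<in> exts r (M - b)"
      by blast
    have "take (Suc a) q = p" "take (Suc b) q = r"
      using p r by (auto simp: exts_def Fall_def walks_def)
    then have "p ! a = q ! a" "r ! a = q ! a" using that by auto
    moreover have "L (p ! a) < L u" using p(1) by (simp add: Fall_def)
    moreover have "L u < L (r ! a)" using r(1) that by (simp add: Fall_def)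
    ultimately show False by simp
  qed
  have "(\<Sum>a = 1..M. fall1 a u x * D ^ (M - a)) = (\<Sum>a = 1..M. card (?E a))"
    using c by (intro sum.cong) auto
  also have "\<dots> = card (\<Union>a\<in>{1..M}. ?E a)"
  proof (rule card_UN_disjoint[symmetric])
    show "\<forall>a\<in>{1..M}. \<forall>b\<in>{1..M}. a \<noteq> b \<longrightarrow> ?E a \<inter> ?E b = {}"
    proof (intro ballI impI)
      fix a b assume "a \<in> {1..M}" "b \<in> {1..M}" "a \<noteq> b"
      then show "?E a \<inter> ?E b = {}"
        using disj[of a b] disj[of b a] by (cases "a < b") (simp, simp add: Int_commute)
    qed
  qed (use c in auto)
  also have "\<dots> \<le> card (exts [u, x] (M - 1))"
  proof (rule card_mono)
    show "(\<Union>a\<in>{1..M}. ?E a) \<subseteq> exts [u, x] (M - 1)" using sub by blast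
  qed (use exts_card[OF nb_pair[OF assms]] in simp)
  also have "\<dots> = D ^ (M - 1)" using exts_card[OF nb_pair[OF assms]] by simp
  finally show ?thesis .
qed simp

text \<open>A threshold \<open>m\<close> separates the inner vertices from both ends, so no
  comparison across the two walks is required. For pairs of falls it is the level of the start; for
  walks ending in their minimum it is the minimum of one of them without its end.\<close>

lemma glue_Good:
  assumes p: "nb p" "length p = Suc a" and q: "nb q" "length q = Suc b" and 0: "p ! 0 = q ! 0"
    and ab: "0 < a" "0 < b" and ne: "p ! 1 \<noteq> q ! 1"
    and pin: "\<And>i. i < a \<Longrightarrow> m \<le> L (p ! i)" and pend: "L (p ! a) < m"
    and qin: "\<And>i. i < b \<Longrightarrow> m \<le> L (q ! i)" and qend: "L (q ! b) < m"
  shows "glue p q \<in> Good (a + b)"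
proof -
  have left: "glue p q ! i = p ! (a - i)" if "i \<le> a" for i
    using glue_nth_left[of i p q] that 0 p q by (cases q) auto
  have right: "glue p q ! (a + j) = q ! j" for j
    using glue_nth_right[of p q j] p by simp
  have inner: "m \<le> L (glue p q ! i)" if i: "0 < i" "i < a + b" for i
  proof (cases "i \<le> a")
    case True then show ?thesis using left pin i by simp
  next
    case False
    then obtain j where "i = a + j" by (metis le_Suc_ex nat_le_linear)
    then show ?thesis using right qin i by simp
  qed
  have "nb (glue p q)" using nb_glue[OF p(1) q(1) 0] ne by simp
  then show ?thesis
    using inner left[of 0] right[of b] pend qend p q
    by (auto simp: Good_def intro: less_le_trans)
qed


lemma Fall_props:
  assumes "p \<in> Fall a u"
  shows "nb p" "length p = Suc a" "p ! 0 = u" "L (p ! a) < L u"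
    and "\<And>i. i < a \<Longrightarrow> L u \<le> L (p ! i)" "\<And>i. 0 < i \<Longrightarrow> i < a \<Longrightarrow> L u < L (p ! i)"
proof -
  show "nb p" "length p = Suc a" "p ! 0 = u" "L (p ! a) < L u"
    "\<And>i. 0 < i \<Longrightarrow> i < a \<Longrightarrow> L u < L (p ! i)"
    using assms by (auto simp: Fall_def walks_def)
  then show "\<And>i. i < a \<Longrightarrow> L u \<le> L (p ! i)"
    by (metis less_imp_le order_refl gr0I)
qed

lemma glue_inj:
  assumes "glue p q = glue p' q'" "length p = length p'" "p \<noteq> []" "p' \<noteq> []" 
    "p ! 0 = q ! 0" "p' ! 0 = q' ! 0"
  shows "p = p' \<and> q = q'"
proof -
  have "tl p = tl p'" "q = q'"
    using assms by (auto simp: glue_def)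
  moreover from this have "hd p = hd p'" using assms by (simp add: hd_conv_nth)
  ultimately show ?thesis using assms by (metis list.collapse)
qed

text \<open>The common start \<open>u\<close> is the unique lowest inner vertex of the glued walk.
  The walk therefore determines \<open>u\<close>, the position \<open>a\<close> and both falls, and
  gluing is injective.\<close>

lemma Good_ge_splits:
  assumes n: "n \<le> len"
  shows "(\<Sum>u\<in>V. \<Sum>x\<in>nbr u. \<Sum>x'\<in>nbr u - {x}. \<Sum>a = 1..<n. fall1 a u x * fall1 (n - a) u x')
    \<le> card (Good n)"
proof -
  let ?F = "\<lambda>a u x. {p \<in> Fall a u. p ! 1 = x}"
  let ?I = "SIGMA u:V. SIGMA x:nbr u. SIGMA x':nbr u - {x}. SIGMA a:{1..<n}. ?F a u x \<times> ?F (n - a) u x'"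
  let ?f = "\<lambda>(u, x, x', a, p, q). glue p q"
  have fin: "finite (nbr u)" if "u \<in> V" for u using finite_nbr that .
  have fF: "finite (?F a u x)" for a u x using finite_Fall by simp
  have "(\<Sum>u\<in>V. \<Sum>x\<in>nbr u. \<Sum>x'\<in>nbr u - {x}. \<Sum>a = 1..<n. fall1 a u x * fall1 (n - a) u x') = card ?I"
  proof -
    define S3 where "S3 u x x' = (SIGMA a:{1..<n}. ?F a u x \<times> ?F (n - a) u x')" for u x x'
    define S2 where "S2 u x = (SIGMA x':nbr u - {x}. S3 u x x')" for u x
    have 3: "finite (S3 u x x') \<and> card (S3 u x x') = (\<Sum>a = 1..<n. fall1 a u x * fall1 (n - a) u x')" for u x x'
    proof -
      have "card (S3 u x x') = (\<Sum>a = 1..<n. card (?F a u x \<times> ?F (n - a) u x'))"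
        unfolding S3_def using fF by (intro card_SigmaI) blast+
      moreover have "finite (S3 u x x')" unfolding S3_def using fF by (intro finite_SigmaI) blast+
      ultimately show ?thesis by (simp only: fall1_def card_cartesian_product)
    qed
    have 2: "finite (S2 u x) \<and> card (S2 u x) = (\<Sum>x'\<in>nbr u - {x}. \<Sum>a = 1..<n. fall1 a u x * fall1 (n - a) u x')"
      if "u \<in> V" for u x
      unfolding S2_def using 3 fin[OF that] by (simp del: sum_constant)
    have 1: "finite (Sigma (nbr u) (S2 u)) \<and> card (Sigma (nbr u) (S2 u)) =
        (\<Sum>x\<in>nbr u. \<Sum>x'\<in>nbr u - {x}. \<Sum>a = 1..<n. fall1 a u x * fall1 (n - a) u x')" if "u \<in> V" for u
      using 2[OF that] fin[OF that] by simp
    have "card (SIGMA u:V. Sigma (nbr u) (S2 u)) = (\<Sum>u\<in>V. card (Sigma (nbr u) (S2 u)))"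
      using finite_V 1 by simp
    also have "\<dots> = (\<Sum>u\<in>V. \<Sum>x\<in>nbr u. \<Sum>x'\<in>nbr u - {x}. \<Sum>a = 1..<n. fall1 a u x * fall1 (n - a) u x')"
      using 1 by (intro sum.cong) auto
    finally show ?thesis unfolding S2_def S3_def by (rule sym)
  qed
  also have "card ?I \<le> card (Good n)"
  proof (rule card_inj_on_le[OF _ _ finite_Good])
    have key: "glue p q \<in> Good n \<and> length p = Suc a \<and> p \<noteq> [] \<and> p ! 0 = u \<and> q ! 0 = u \<and> p ! 1 = x \<and> q ! 1 = x'
        \<and> glue p q ! a = u \<and> (\<forall>i. 0 < i \<and> i < n \<and> i \<noteq> a \<longrightarrow> L u < L (glue p q ! i))"
      if "(u, x, x', a, p, q) \<in> ?I" for u x x' a p q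
    proof -
      have p: "p \<in> Fall a u" "p ! 1 = x" and q: "q \<in> Fall (n - a) u" "q ! 1 = x'" and ne: "x' \<noteq> x"
        and a: "0 < a" "a < n" using that by auto
      note P = Fall_props[OF p(1)] and Q = Fall_props[OF q(1)]
      have "glue p q \<in> Good (a + (n - a))"
        by (rule glue_Good[where m = "L u"]) (use P Q p q ne a in auto)
      moreover have left: "glue p q ! i = p ! (a - i)" if "i \<le> a" for i
        using glue_nth_left[of i p q] that P Q by (cases q) auto
      moreover have right: "glue p q ! (a + j) = q ! j" for j
        using glue_nth_right[of p q j] P by simp
      moreover have "L u < L (glue p q ! i)" if "0 < i" "i < n" "i \<noteq> a" for i
      proof (cases "i < a")
        case True then show ?thesis using left[of i] P(6)[of "a - i"] that by simp
      next
        case False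
        define j where "j = i - a"
        have j: "i = a + j" "0 < j" using False that by (auto simp: j_def)
        have "L u < L (q ! j)" by (rule Q(6)) (use j that in linarith)+
        then show ?thesis unfolding j(1) right .
      qed
      moreover have "glue p q ! a = u" using right[of 0] Q by simp
      ultimately show ?thesis using P Q p q a by auto
    qed
    show "?f ` ?I \<subseteq> Good n"
    proof (rule image_subsetI)
      fix s assume "s \<in> ?I"
      moreover obtain u x x' a p q where "s = (u, x, x', a, p, q)" by (metis prod_cases6)
      ultimately show "?f s \<in> Good n" using key[of u x x' a p q] by simp
    qed
    show "inj_on ?f ?I"
    proof (rule inj_onI)
      fix s t assume s: "s \<in> ?I" and t: "t \<in> ?I" and st: "?f s = ?f t"
      obtain u x x' a p q where s': "s = (u, x, x', a, p, q)" by (metis prod_cases6)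
      obtain v y y' b r w where t': "t = (v, y, y', b, r, w)" by (metis prod_cases6)
      note ks = key[OF s[unfolded s']] and kt = key[OF t[unfolded t']]
      have g: "glue p q = glue r w" using st s' t' by simp
      have ab: "0 < a" "a < n" "0 < b" "b < n" using s t s' t' by auto
      have "a = b"
      proof (rule ccontr)
        assume "a \<noteq> b"
        then have "L u < L v" "L v < L u" using ks kt g ab by metis+
        then show False by simp
      qed
      then have "p = r \<and> q = w" using glue_inj[OF g] ks kt by auto
      then show "s = t" using s' t' ks kt \<open>a = b\<close> by auto
    qed
  qed
  finally show ?thesis .
qed

end

section \<open>Pairs of walks, sorted by the position where they branch\<close>

lemma sum_square_le_card:
  fixes f :: "'b \<Rightarrow> nat"
  shows "(\<Sum>i\<in>I. f i)\<^sup>2 \<le> card I * (\<Sum>i\<in>I. (f i)\<^sup>2)"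
proof -
  have am: "2 * (f i * f j) \<le> (f i)\<^sup>2 + (f j)\<^sup>2" for i j
  proof -
    have "0 \<le> (int (f i) - int (f j))\<^sup>2" by simp
    then have "int (2 * (f i * f j)) \<le> int ((f i)\<^sup>2 + (f j)\<^sup>2)"
      by (simp add: power2_eq_square algebra_simps)
    then show ?thesis by linarith
  qed
  have "2 * (\<Sum>i\<in>I. f i)\<^sup>2 = (\<Sum>i\<in>I. \<Sum>j\<in>I. 2 * (f i * f j))"
    by (simp only: power2_eq_square sum_product) (simp only: sum_distrib_left)
  also have "\<dots> \<le> (\<Sum>i\<in>I. \<Sum>j\<in>I. (f i)\<^sup>2 + (f j)\<^sup>2)" by (intro sum_mono am)
  also have "\<dots> = 2 * (card I * (\<Sum>i\<in>I. (f i)\<^sup>2))"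
    by (simp add: sum.distrib sum_distrib_left[symmetric])
  finally show ?thesis by simp
qed

definition fork :: "'a list set \<Rightarrow> nat \<Rightarrow> ('a list \<times> 'a list) set" where
  "fork F i = {(p, p') \<in> F \<times> F. take (Suc i) p = take (Suc i) p' \<and> p ! Suc i \<noteq> p' ! Suc i}"

text \<open>Pairs are counted by the length of their common prefix.\<close>

lemma card_square_le_fork:
  assumes F: "finite F" and len: "\<And>p. p \<in> F \<Longrightarrow> length p = Suc a"
    and fib: "\<And>c. card {p \<in> F. take (Suc i1) p = c} \<le> B"
    and pre: "card (take (Suc i0) ` F) \<le> M" and i: "i0 \<le> i1" "i1 \<le> a"
  shows "(card F)\<^sup>2 \<le> M * ((\<Sum>i = i0..<i1. card (fork F i)) + card F * B)"
proof -
  define P where "P j = {(p, p') \<in> F \<times> F. take (Suc j) p = take (Suc j) p'}" for j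
  have finP: "finite (P j)" for j
    by (rule finite_subset[of _ "F \<times> F"]) (auto simp: P_def F)
  have split: "card (P j) = card (fork F j) + card (P (Suc j))" if "j < a" for j
  proof -
    have iff: "take (Suc (Suc j)) p = take (Suc (Suc j)) p' \<longleftrightarrow>
        take (Suc j) p = take (Suc j) p' \<and> p ! Suc j = p' ! Suc j" if "p \<in> F" "p' \<in> F" for p p'
      using len[OF that(1)] len[OF that(2)] \<open>j < a\<close> by (simp add: take_Suc_conv_app_nth)
    have "P j = fork F j \<union> P (Suc j)" "fork F j \<inter> P (Suc j) = {}"
      unfolding P_def fork_def using iff by (auto simp del: take_Suc)
    moreover have "finite (fork F j)"
      by (rule finite_subset[OF _ finP[of j]]) (auto simp: P_def fork_def)
    ultimately show ?thesis using card_Un_disjoint finP by metis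
  qed
  have sum: "card (P i0) = (\<Sum>i = i0..<i1. card (fork F i)) + card (P i1)"
    using i
  proof (induction i1 rule: dec_induct)
    case (step n)
    then show ?case using split[of n] by simp
  qed simp
  have last: "card (P i1) \<le> card F * B"
  proof -
    have "P i1 = (SIGMA p:F. {p' \<in> F. take (Suc i1) p' = take (Suc i1) p})"
      by (auto simp: P_def)
    then have "card (P i1) = (\<Sum>p\<in>F. card {p' \<in> F. take (Suc i1) p' = take (Suc i1) p})"
      using F by simp
    also have "\<dots> \<le> (\<Sum>p\<in>F. B)" by (intro sum_mono fib)
    finally show ?thesis by simp
  qed
  have "(card F)\<^sup>2 \<le> M * card (P i0)"
  proof -
    let ?C = "take (Suc i0) ` F" and ?f = "\<lambda>c. {p \<in> F. take (Suc i0) p = c}"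
    have "card F = card (\<Union>c\<in>?C. ?f c)" by (rule arg_cong[where f = card]) auto
    also have "\<dots> = (\<Sum>c\<in>?C. card (?f c))" using F by (intro card_UN_disjoint) auto
    finally have c: "card F = (\<Sum>c\<in>?C. card (?f c))" .
    have "P i0 = (\<Union>c\<in>?C. ?f c \<times> ?f c)" by (auto simp: P_def)
    moreover have "card (\<Union>c\<in>?C. ?f c \<times> ?f c) = (\<Sum>c\<in>?C. card (?f c \<times> ?f c))"
      using F by (intro card_UN_disjoint) auto
    ultimately have "card (P i0) = (\<Sum>c\<in>?C. (card (?f c))\<^sup>2)"
      by (simp add: card_cartesian_product power2_eq_square)
    then have "(card F)\<^sup>2 \<le> card ?C * card (P i0)"
      using sum_square_le_card[of "\<lambda>c. card (?f c)" ?C] c by presburger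
    also have "\<dots> \<le> M * card (P i0)" using pre by (rule mult_le_mono1)
    finally show ?thesis .
  qed
  also have "\<dots> \<le> M * ((\<Sum>i = i0..<i1. card (fork F i)) + card F * B)"
    unfolding sum using last by simp
  finally show ?thesis .
qed

context nb_graph begin

lemma card_walks_fibre:
  assumes F: "F \<subseteq> walks a u" and i: "1 \<le> i" "i \<le> a"
  shows "card {p \<in> F. take (Suc i) p = c} \<le> D ^ (a - i)"
proof (cases "{p \<in> F. take (Suc i) p = c} = {}")
  case False
  then obtain p where p: "p \<in> walks a u" "take (Suc i) p = c" using F by auto
  then have c: "nb c" "length c = Suc i" using nb_take i by (auto simp: walks_def)
  have "{p \<in> F. take (Suc i) p = c} \<subseteq> exts c (a - i)"
    using F i c(2) by (auto simp: walks_def exts_def)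
  then have "card {p \<in> F. take (Suc i) p = c} \<le> card (exts c (a - i))"
    using exts_card[OF c(1), of "a - i"] c(2) i by (intro card_mono) auto
  also have "\<dots> = D ^ (a - i)" using exts_card[OF c(1)] c(2) i by simp
  finally show ?thesis .
next
  case True then show ?thesis by (simp only: card.empty)
qed

text \<open>The factor \<open>D\<close> unites the case \<open>i = 0\<close>, with one prefix, and
  the case of positive \<open>i\<close>, with at most \<open>Suc D * D ^ (i - 1)\<close>
  prefixes.\<close>

lemma card_walks_prefix:
  assumes "u \<in> V" "F \<subseteq> walks a u" "i \<le> a"
  shows "card (take (Suc i) ` F) * D \<le> Suc D * D ^ i"
proof (cases i)
  case 0
  have "take (Suc i) ` F \<subseteq> {[u]}"
    using assms(2) 0 by (auto simp: walks_def take_Suc nbw_def hd_conv_nth)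
  then have "card (take (Suc i) ` F) \<le> 1"
    using card_mono[of "{[u]}"] by fastforce
  then have "card (take (Suc i) ` F) * D \<le> 1 * D" by (rule mult_le_mono1)
  also have "\<dots> \<le> Suc D * D ^ i" using 0 by simp
  finally show ?thesis .
next
  case (Suc j)
  have "take (Suc i) ` F \<subseteq> walks i u"
    using assms(2,3) nb_take by (fastforce simp: walks_def)
  then have "card (take (Suc i) ` F) \<le> card (walks i u)"
    using finite_walks by (intro card_mono) auto
  then have "card (take (Suc i) ` F) * D \<le> card (walks i u) * D" by (rule mult_le_mono1)
  then show ?thesis using walks_card[OF assms(1), of j] Suc by (simp add: algebra_simps)
qed

text \<open>Walks with a common nonempty prefix have the same start, so no branching pair mixes two
  starts.\<close>

lemma sum_card_fork:
  assumes F: "\<And>u. F u \<subseteq> walks a u"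
  shows "(\<Sum>u\<in>V. card (fork (F u) i)) = card (fork (\<Union>u\<in>V. F u) i)"
proof -
  have fin: "finite (F u)" for u using F finite_walks finite_subset by blast
  have hd: "p ! 0 = u" "p \<noteq> []" if "p \<in> F u" for p u
    using subsetD[OF F that] by (auto simp: walks_def)
  have same: "u = v" if "p \<in> F u" "p' \<in> F v" "take (Suc i) p = take (Suc i) p'" for u v p p'
    using hd[OF that(1)] hd[OF that(2)] that(3) by (metis nth_take zero_less_Suc)
  have "fork (\<Union>u\<in>V. F u) i = (\<Union>u\<in>V. fork (F u) i)"
    unfolding fork_def using same by blast
  moreover have "card (\<Union>u\<in>V. fork (F u) i) = (\<Sum>u\<in>V. card (fork (F u) i))"
  proof (rule card_UN_disjoint[OF finite_V])
    show "\<forall>u\<in>V. finite (fork (F u) i)"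
      using fin by (auto simp: fork_def intro: finite_subset[OF _ finite_cartesian_product])
    show "\<forall>u\<in>V. \<forall>v\<in>V. u \<noteq> v \<longrightarrow> fork (F u) i \<inter> fork (F v) i = {}"
      unfolding fork_def using hd by blast
  qed
  ultimately show ?thesis by simp
qed

lemma exts_pair_card:
  assumes "g \<in> Good n" "0 < b" "b \<le> n"
  shows "finite (exts [g ! (b - 1), g ! b] k) \<and> card (exts [g ! (b - 1), g ! b] k) = D ^ k"
proof -
  have g: "nb g" "length g = Suc n" using assms by (auto simp: Good_def)
  have "nb [g ! (b - 1), g ! b]"
    using nb_pair[OF nb_nth_V[OF g(1)] nb_step[OF g(1)], of "b - 1"] assms g(2) by simp
  then show ?thesis using exts_card by simp
qed

lemma eq_from_take_drop:
  "take i p = take i q \<Longrightarrow> drop i p = drop i q \<Longrightarrow> p = q"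
  by (metis append_take_drop_id)

lemma take_le_eq: "take n p = take n q \<Longrightarrow> m \<le> n \<Longrightarrow> take m p = take m q"
  by (metis min.absorb1 take_take)

text \<open>Gluing at the branching position \<open>k\<close> loses what precedes it. Read
  backwards, beginning with the first edge after the branch, the lost prefix extends an edge that is
  still visible in the glued walk, which leaves \<open>D ^ k\<close> possibilities.\<close>

lemma rev_take_exts:
  assumes "nb p" "length p = Suc a" "k < a" "g = glue (drop k p) q" "q ! 0 = p ! k" "q \<noteq> []"
  shows "rev (take (Suc (Suc k)) p) \<in> exts [g ! (a - k - 1), g ! (a - k)] k"
proof -
  let ?t = "rev (take (Suc (Suc k)) p)"
  have left: "g ! i = p ! (a - i)" if "i \<le> a - k" for i
    using glue_nth_left[of i "drop k p" q] that assms by simp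
  have g: "g ! (a - k) = p ! k" "g ! (a - k - 1) = p ! Suc k"
    using left[of "a - k"] left[of "a - k - 1"] assms(3) by auto
  have "?t = p ! Suc k # p ! k # rev (take k p)"
    using assms(2,3) by (simp add: take_Suc_conv_app_nth)
  moreover have "nb ?t" using nb_rev nb_take assms(1) by blast
  ultimately show ?thesis using g assms(2,3) by (simp add: exts_def)
qed

text \<open>A branching pair is encoded by its glued walk and its reversed prefix. After the branch
  each fall has \<open>a - i\<close> edges left, stays at or above the level of \<open>u\<close>
  until its end, and ends below it, so the glued walk is good.\<close>

lemma card_fork_Fall:
  assumes i: "i < a"
  shows "(\<Sum>u\<in>V. card (fork (Fall a u) i)) \<le> card (Good (2 * (a - i))) * D ^ i"
proof -
  define b where "b = a - i"
  have b: "0 < b" using i by (simp add: b_def)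
  let ?U = "\<Union>u\<in>V. Fall a u"
  let ?C = "SIGMA g:Good (2 * b). exts [g ! (b - 1), g ! b] i"
  let ?f = "\<lambda>(p, p'). (glue (drop i p) (drop i p'), rev (take (Suc (Suc i)) p))"
  have ex: "finite (exts [g ! (b - 1), g ! b] i) \<and> card (exts [g ! (b - 1), g ! b] i) = D ^ i"
    if "g \<in> Good (2 * b)" for g using exts_pair_card[OF that b] by simp
  have key: "nb p \<and> nb p' \<and> length p = Suc a \<and> length p' = Suc a \<and> p ! i = p' ! i
      \<and> take (Suc i) p = take (Suc i) p' \<and> glue (drop i p) (drop i p') \<in> Good (2 * b)"
    if "(p, p') \<in> fork ?U i" for p p'
  proof -
    obtain u v where F: "p \<in> Fall a u" "p' \<in> Fall a v" and t: "take (Suc i) p = take (Suc i) p'"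
      and ne: "p ! Suc i \<noteq> p' ! Suc i" using \<open>(p, p') \<in> fork ?U i\<close> by (auto simp: fork_def)
    note P = Fall_props[OF F(1)] and P' = Fall_props[OF F(2)]
    have nth: "p ! j = p' ! j" if "j \<le> i" for j
      using t that by (metis le_imp_less_Suc nth_take)
    have v: "v = u" using nth[of 0] P(3) P'(3) by simp
    have "glue (drop i p) (drop i p') \<in> Good (b + b)"
    proof (rule glue_Good[where m = "L u"])
      show "nb (drop i p)" "nb (drop i p')" using P P' i nb_drop by auto
    qed (use P P' v nth[of i] i b ne in \<open>auto simp: b_def\<close>)
    then show ?thesis using P P' nth[of i] t by (simp add: mult_2)
  qed
  have "card (fork ?U i) \<le> card ?C"
  proof (rule card_inj_on_le)
    show "finite ?C" using finite_Good ex by auto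
    show "?f ` fork ?U i \<subseteq> ?C"
    proof (rule image_subsetI)
      fix s assume s: "s \<in> fork ?U i"
      obtain p p' where pp: "s = (p, p')" by (cases s)
      note k = key[OF s[unfolded pp]]
      have "rev (take (Suc (Suc i)) p) \<in> exts [glue (drop i p) (drop i p') ! (b - 1), glue (drop i p) (drop i p') ! b] i"
        unfolding b_def by (rule rev_take_exts) (use k i in auto)
      then show "?f s \<in> ?C" using k pp by simp
    qed
    show "inj_on ?f (fork ?U i)"
    proof (rule inj_onI)
      fix s t assume s: "s \<in> fork ?U i" and t: "t \<in> fork ?U i" and e: "?f s = ?f t"
      obtain p p' q q' where st: "s = (p, p')" "t = (q, q')" by (cases s; cases t)
      note k = key[OF s[unfolded st]] key[OF t[unfolded st]]
      have g: "glue (drop i p) (drop i p') = glue (drop i q) (drop i q')"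
        and r: "take (Suc (Suc i)) p = take (Suc (Suc i)) q" using e st by auto
      have d: "drop i p = drop i q \<and> drop i p' = drop i q'"
        by (rule glue_inj[OF g]) (use k i in auto)
      have "take i p = take i q" using take_le_eq[OF r] by simp
      moreover have "take i p = take i p'" "take i q = take i q'"
        using take_le_eq[of "Suc i" p p' i] take_le_eq[of "Suc i" q q' i] k by auto
      ultimately show "s = t" using d eq_from_take_drop st by metis
    qed
  qed
  also have "card ?C = (\<Sum>g\<in>Good (2 * b). D ^ i)" using finite_Good ex by simp
  finally show ?thesis
    using sum_card_fork[of "\<lambda>u. Fall a u" a i] by (simp add: Fall_def b_def)
qed

text \<open>Two falls from the same vertex are glued at the vertex where they branch; the pairs whose common
  prefix is long are too few to matter.\<close>

lemma sum_card_Fall_square_le: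
  assumes "1 \<le> K" "K \<le> m" "m \<le> a" "2 * m \<le> len"
  shows "(\<Sum>u\<in>V. (card (Fall a u))\<^sup>2) * D
    \<le> Suc D * D ^ (a - m) * ((\<Sum>k<K. 2 * X (2 * (m - k)) * D ^ (a - m + k)) + X a * D ^ (m - K))"
proof -
  \<comment> \<open>Comparing only from position \<open>a - m\<close> on keeps the glued lengths
    \<open>2 * (a - i)\<close> at most \<open>2 * m\<close>, hence within \<open>len\<close>,
    however long the falls are.\<close>
  define i0 where "i0 = a - m"
  have F: "Fall a u \<subseteq> walks a u" for u by (auto simp: Fall_def)
  have "(card (Fall a u))\<^sup>2 * D \<le> Suc D * D ^ i0 *
    ((\<Sum>i = i0..<i0 + K. card (fork (Fall a u) i)) + card (Fall a u) * D ^ (m - K))" if u: "u \<in> V" for u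
  proof -
    have i: "i0 + K \<le> a" "a - (i0 + K) = m - K" "1 \<le> i0 + K" "i0 \<le> a" using assms by (auto simp: i0_def)
    have "(card (Fall a u))\<^sup>2 \<le> card (take (Suc i0) ` Fall a u) *
      ((\<Sum>i = i0..<i0 + K. card (fork (Fall a u) i)) + card (Fall a u) * D ^ (m - K))"
    proof (rule card_square_le_fork[where a = a])
      show "card {p \<in> Fall a u. take (Suc (i0 + K)) p = c} \<le> D ^ (m - K)" for c
        using card_walks_fibre[OF F i(3,1)] i(2) by simp
    qed (use i finite_Fall in \<open>auto simp: Fall_def walks_def\<close>)
    then have "(card (Fall a u))\<^sup>2 * D \<le> (card (take (Suc i0) ` Fall a u) * D) *
      ((\<Sum>i = i0..<i0 + K. card (fork (Fall a u) i)) + card (Fall a u) * D ^ (m - K))"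
      by (simp add: mult.commute mult.left_commute)
    also have "\<dots> \<le> Suc D * D ^ i0 *
      ((\<Sum>i = i0..<i0 + K. card (fork (Fall a u) i)) + card (Fall a u) * D ^ (m - K))"
      by (rule mult_le_mono1[OF card_walks_prefix[OF u F i(4)]])
    finally show ?thesis .
  qed
  then have "(\<Sum>u\<in>V. (card (Fall a u))\<^sup>2) * D \<le> (\<Sum>u\<in>V. Suc D * D ^ i0 *
    ((\<Sum>i = i0..<i0 + K. card (fork (Fall a u) i)) + card (Fall a u) * D ^ (m - K)))"
    unfolding sum_distrib_right by (rule sum_mono)
  also have "\<dots> = Suc D * D ^ i0 *
    ((\<Sum>i = i0..<i0 + K. \<Sum>u\<in>V. card (fork (Fall a u) i)) + X a * D ^ (m - K))"
    unfolding sum_distrib_left[symmetric] sum.distrib sum.swap[of _ _ V] sum_distrib_right[symmetric] X_def ..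
  also have "(\<Sum>i = i0..<i0 + K. \<Sum>u\<in>V. card (fork (Fall a u) i)) \<le> (\<Sum>i = i0..<i0 + K. card (Good (2 * (a - i))) * D ^ i)"
    by (intro sum_mono card_fork_Fall) (use assms in \<open>auto simp: i0_def\<close>)
  also have "\<dots> = (\<Sum>k<K. card (Good (2 * (a - (i0 + k)))) * D ^ (i0 + k))"
    using sum.shift_bounds_nat_ivl[of "\<lambda>i. card (Good (2 * (a - i))) * D ^ i" 0 i0 K]
    by (simp add: add.commute lessThan_atLeast0)
  also have "\<dots> = (\<Sum>k<K. 2 * X (2 * (m - k)) * D ^ (i0 + k))"
  proof (rule sum.cong[OF refl])
    fix k assume k: "k \<in> {..<K}"
    have "a - (i0 + k) = m - k" using assms by (simp add: i0_def)
    moreover have "card (Good (2 * (m - k))) = 2 * X (2 * (m - k))"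
      using k assms by (intro card_Good) auto
    ultimately show "card (Good (2 * (a - (i0 + k)))) * D ^ (i0 + k) = 2 * X (2 * (m - k)) * D ^ (i0 + k)" by simp
  qed
  finally show ?thesis by (simp add: i0_def)
qed


section \<open>Walks that end in their minimum\<close>

definition Rec :: "nat \<Rightarrow> 'a \<Rightarrow> 'a list set" where
  "Rec m y = {p \<in> walks m y. \<forall>i<m. L (p ! m) < L (p ! i)}"

lemma finite_Rec: "finite (Rec m y)"
  by (rule finite_subset[OF _ finite_walks[of m y]]) (auto simp: Rec_def)

lemma Rec_subset: "Rec m y \<subseteq> walks m y" by (auto simp: Rec_def)

lemma Union_Rec: "(\<Union>y\<in>V. Rec m y) = {p. nb p \<and> length p = Suc m \<and> (\<forall>i<m. L (p ! m) < L (p ! i))}"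
  using nb_nth_V[of _ 0] by (fastforce simp: Rec_def walks_def)

lemma sum_card_Rec: "(\<Sum>y\<in>V. card (Rec m y)) = card (\<Union>y\<in>V. Rec m y)"
  using finite_V finite_Rec by (intro card_UN_disjoint[symmetric]) (auto simp: Rec_def walks_def)

text \<open>The window is prolonged by \<open>j\<close> edges at its front and then by
  \<open>m - j\<close> edges at its end, together \<open>D ^ m\<close> choices.\<close>

lemma card_window:
  assumes S: "finite S" "\<And>p. p \<in> S \<Longrightarrow> nb p \<and> length p = Suc m" and j: "j \<le> m" and m: "1 \<le> m"
  shows "card {w. nb w \<and> length w = Suc (2 * m) \<and> take (Suc m) (drop j w) \<in> S} \<le> card S * D ^ m"
    (is "card ?W \<le> _")
proof -
  let ?C = "SIGMA p:S. SIGMA t:exts (rev p) j. exts (rev t) (m - j)"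
  let ?f = "\<lambda>w. (take (Suc m) (drop j w), rev (take (Suc m + j) w), w)"
  have 1: "finite (exts (rev p) j) \<and> card (exts (rev p) j) = D ^ j" if "p \<in> S" for p
    using exts_card[of "rev p"] nb_rev S(2)[OF that] m by simp
  have 2: "finite (exts (rev t) (m - j)) \<and> card (exts (rev t) (m - j)) = D ^ (m - j)"
    if "p \<in> S" "t \<in> exts (rev p) j" for p t
    using exts_card[of "rev t"] nb_rev S(2)[OF that(1)] that(2) m by (simp add: exts_def)
  have 3: "finite (SIGMA t:exts (rev p) j. exts (rev t) (m - j))
      \<and> card (SIGMA t:exts (rev p) j. exts (rev t) (m - j)) = D ^ m" if "p \<in> S" for p
    using 1[OF that] 2[OF that] j by (simp add: power_add[symmetric])
  have "card ?W \<le> card ?C"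
  proof (rule card_inj_on_le)
    show "inj_on ?f ?W" by (auto simp: inj_on_def)
    show "finite ?C" using S(1) 3 by auto
    show "?f ` ?W \<subseteq> ?C"
    proof (rule image_subsetI)
      fix w assume w: "w \<in> ?W"
      have nt: "nb (take (Suc m + j) w)" using w nb_take by auto
      have "take (Suc m) (rev (take (Suc m + j) w)) = rev (take (Suc m) (drop j w))"
        using w j by (simp add: take_rev drop_take)
      then have "rev (take (Suc m + j) w) \<in> exts (rev (take (Suc m) (drop j w))) j"
        using w j nb_rev[OF nt] by (simp add: exts_def)
      moreover have "w \<in> exts (take (Suc m + j) w) (m - j)" using w j by (auto simp: exts_def)
      ultimately show "?f w \<in> ?C" using w by simp
    qed
  qed
  also have "card ?C = (\<Sum>p\<in>S. D ^ m)" using S(1) 3 by simp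
  finally show ?thesis by simp
qed

lemma sum_card_walks: "1 \<le> n \<Longrightarrow> card {w. nb w \<and> length w = Suc n} = card V * (Suc D * D ^ (n - 1))"
proof -
  assume n: "1 \<le> n"
  have "{w. nb w \<and> length w = Suc n} = (\<Union>u\<in>V. walks n u)"
    using nb_nth_V[of _ 0] by (fastforce simp: walks_def)
  also have "card \<dots> = (\<Sum>u\<in>V. card (walks n u))"
    using finite_V finite_walks by (intro card_UN_disjoint) (auto simp: walks_def)
  also have "\<dots> = (\<Sum>u\<in>V. Suc D * D ^ (n - 1))"
    using walks_card[of _ "n - 1"] n by (intro sum.cong) auto
  finally show ?thesis by simp
qed

text \<open>The minimum of a walk of length \<^term>\<open>2 * m\<close> splits off a window of length \<^term>\<open>m\<close> at one
  end of which the minimum is attained.\<close>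

lemma card_Rec_ge:
  assumes m: "1 \<le> m" "2 * m \<le> len"
  shows "card V * (Suc D * D ^ (m - 1)) \<le> (2 * m + 1) * (\<Sum>y\<in>V. card (Rec m y))"
proof -
  let ?R = "\<Union>y\<in>V. Rec m y"
  let ?Q = "rev ` ?R"
  let ?W = "\<lambda>S j. {w. nb w \<and> length w = Suc (2 * m) \<and> take (Suc m) (drop j w) \<in> S}"
  have finR: "finite ?R" using finite_V finite_Rec by simp
  have R: "nb p \<and> length p = Suc m" if "p \<in> ?R" for p
    using that by (auto simp: Rec_def walks_def)
  have Q: "nb p \<and> length p = Suc m" if "p \<in> ?Q" for p
  proof -
    from that obtain q where "p = rev q" "q \<in> ?R" by (rule imageE)
    then show ?thesis using R[of q] nb_rev by simp
  qed
  \<comment> \<open>Let the minimum be at position \<open>j\<close>. If \<open>j \<le> m\<close>,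
    the window starting at \<open>j\<close> is the reverse of a walk in \<open>?R\<close>; otherwise
    the window ending at \<open>j\<close> is in \<open>?R\<close>. There are \<open>m + 1\<close>
    windows of the former kind and \<open>m\<close> of the latter, whence the factor
    \<open>2 * m + 1\<close>.\<close>
  have cover: "{w. nb w \<and> length w = Suc (2 * m)} \<subseteq> (\<Union>j\<le>m. ?W ?Q j) \<union> (\<Union>j\<in>{1..m}. ?W ?R j)"
  proof
    fix w assume "w \<in> {w. nb w \<and> length w = Suc (2 * m)}"
    then have w: "nb w" "length w = Suc (2 * m)" by auto
    obtain j where j: "j \<le> 2 * m" "\<And>i. i \<le> 2 * m \<Longrightarrow> L (w ! j) \<le> L (w ! i)"
      using ex_min_if_finite[of "(\<lambda>i. L (w ! i)) ` {..2 * m}"] by (auto simp: not_less)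
    have d: "distinct w" using nbw_distinct[OF w(1)] w(2) m by simp
    have lt: "L (w ! j) < L (w ! i)" if "i \<le> 2 * m" "i \<noteq> j" for i
    proof -
      have "w ! i \<noteq> w ! j" using d that j w(2) by (simp add: nth_eq_iff_index_eq)
      then have "L (w ! i) \<noteq> L (w ! j)"
        using inj_onD[OF inj_L] nb_nth_V[OF w(1)] that j w(2) by (metis le_imp_less_Suc)
      then show ?thesis using j(2)[OF that(1)] by simp
    qed
    show "w \<in> (\<Union>j\<le>m. ?W ?Q j) \<union> (\<Union>j\<in>{1..m}. ?W ?R j)"
    proof (cases "j \<le> m")
      case True
      let ?p = "take (Suc m) (drop j w)"
      have n: "?p ! i = w ! (j + i)" if "i \<le> m" for i using that w(2) True by simp
      have nb: "nb (rev ?p)" using nb_rev nb_take nb_drop w True by simp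
      have l: "length ?p = Suc m" using w True by simp
      have r: "rev ?p ! i = w ! (j + (m - i))" if "i \<le> m" for i
        using that n[of "m - i"] l by (simp add: rev_nth)
      have "rev ?p \<in> ?R" unfolding Union_Rec using nb r lt l True by auto
      then have "?p \<in> ?Q" by (metis imageI rev_rev_ident)
      then show ?thesis using w True by auto
    next
      case False
      define s where "s = j - m"
      have s: "1 \<le> s" "s \<le> m" "j = s + m" using False j(1) by (auto simp: s_def)
      let ?p = "take (Suc m) (drop s w)"
      have n: "?p ! i = w ! (s + i)" if "i \<le> m" for i using that w(2) s by simp
      have nb: "nb ?p" using nb_take nb_drop w s by simp
      have l: "length ?p = Suc m" using w s by simp
      have "L (?p ! m) < L (?p ! i)" if "i < m" for i
        using n[of i] n[of m] lt[of "s + i"] that s by simp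
      then have "?p \<in> ?R" unfolding Union_Rec using nb l by simp
      then show ?thesis using w s by auto
    qed
  qed
  have finW: "finite (?W S j)" for S j
    by (rule finite_subset[OF _ finite_nb[of "Suc (2 * m)"]]) auto
  have cQ: "card ?Q = card ?R" by (intro card_image inj_on_rev)
  have "card V * (Suc D * D ^ (2 * m - 1)) = card {w. nb w \<and> length w = Suc (2 * m)}"
    using sum_card_walks[of "2 * m"] m by simp
  also have "\<dots> \<le> card ((\<Union>j\<le>m. ?W ?Q j) \<union> (\<Union>j\<in>{1..m}. ?W ?R j))"
    by (rule card_mono[OF _ cover]) (use finW in blast)
  also have "\<dots> \<le> card (\<Union>j\<le>m. ?W ?Q j) + card (\<Union>j\<in>{1..m}. ?W ?R j)"
    by (rule card_Un_le)
  also have "\<dots> \<le> (\<Sum>j\<le>m. card (?W ?Q j)) + (\<Sum>j\<in>{1..m}. card (?W ?R j))"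
    by (intro add_mono card_UN_le) auto
  also have "\<dots> \<le> (\<Sum>j\<le>m. card ?R * D ^ m) + (\<Sum>j\<in>{1..m}. card ?R * D ^ m)"
  proof (intro add_mono sum_mono)
    fix j assume j: "j \<in> {..m}"
    have "card (?W ?Q j) \<le> card ?Q * D ^ m"
    proof (rule card_window)
      show "finite ?Q" using finR by (rule finite_imageI)
      show "nb p \<and> length p = Suc m" if "p \<in> ?Q" for p by (rule Q[OF that])
    qed (use j m in simp_all)
    then show "card (?W ?Q j) \<le> card ?R * D ^ m" unfolding cQ .
  next
    fix j assume j: "j \<in> {1..m}"
    show "card (?W ?R j) \<le> card ?R * D ^ m"
    proof (rule card_window)
      show "finite ?R" by (rule finR)
      show "nb p \<and> length p = Suc m" if "p \<in> ?R" for p by (rule R[OF that])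
    qed (use j m in simp_all)
  qed
  also have "\<dots> = (2 * m + 1) * card ?R * D ^ m" by (simp add: algebra_simps)
  finally have "card V * (Suc D * D ^ (2 * m - 1)) \<le> (2 * m + 1) * card ?R * D ^ m" .
  moreover have "D ^ (2 * m - 1) = D ^ (m - 1) * D ^ m"
    using m by (simp add: power_add[symmetric] mult_2)
  ultimately have "(card V * (Suc D * D ^ (m - 1))) * D ^ m \<le> ((2 * m + 1) * card ?R) * D ^ m"
    by (simp only: mult.assoc)
  moreover have "0 < D ^ m" using D_ge by simp
  ultimately show ?thesis unfolding sum_card_Rec using mult_le_cancel2 by blast
qed

text \<open>Let \<open>p\<close> and \<open>p'\<close> branch at position \<open>k\<close>. One of them ends below all inner vertices of the other,
  say \<open>p'\<close> below those of \<open>p\<close>. Cutting \<open>p'\<close> at the first such vertex makes the glued walk good.\<close>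

lemma card_fork_Rec:
  assumes k: "k < m"
  shows "(\<Sum>y\<in>V. card (fork (Rec m y) k))
    \<le> 2 * (\<Sum>s = Suc k..m. card (Good (m + s - 2 * k)) * (D ^ k * D ^ (m - s)))"
proof -
  let ?U = "\<Union>y\<in>V. Rec m y"
  define b where "b = m - k"
  have b: "0 < b" using k by (simp add: b_def)
  define A where "A = {(p, p') \<in> fork ?U k. \<forall>i<m. L (p' ! m) < L (p ! i)}"
  \<comment> \<open>The vertices of the common prefix are among those compared, which forces the cut
    to lie beyond the branching position.\<close>
  define cut where "cut p p' = (LEAST j. \<forall>i<m. L (p' ! j) < L (p ! i))" for p p' :: "'a list"
  let ?E = "\<lambda>g s. exts [g ! (b - 1), g ! b] k \<times> exts (drop b g) (m - s)"
  let ?C = "SIGMA s:{Suc k..m}. SIGMA g:Good (m + s - 2 * k). ?E g s"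
  let ?g = "\<lambda>p p'. glue (drop k p) (drop k (take (Suc (cut p p')) p'))"
  \<comment> \<open>The cut also loses the last \<open>m - s\<close> edges of \<open>p'\<close>.
    They are recovered from \<open>drop k p'\<close>, which extends the second half of the glued
    walk.\<close>
  let ?f = "\<lambda>(p, p'). (cut p p', ?g p p', rev (take (Suc (Suc k)) p), drop k p')"
  have fin: "finite (fork ?U k)"
    using finite_V finite_Rec by (auto simp: fork_def intro: finite_subset[of _ "?U \<times> ?U"])
  have finA: "finite A" by (rule finite_subset[OF _ fin]) (auto simp: A_def)
  have E: "finite (?E g s) \<and> card (?E g s) = D ^ k * D ^ (m - s)"
    if "s \<in> {Suc k..m}" "g \<in> Good (m + s - 2 * k)" for g s
  proof -
    have g: "nb g" "length g = Suc (m + s - 2 * k)" using that by (auto simp: Good_def)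
    have "b \<le> m + s - 2 * k" using that k by (auto simp: b_def)
    then have "finite (exts [g ! (b - 1), g ! b] k) \<and> card (exts [g ! (b - 1), g ! b] k) = D ^ k"
      using exts_pair_card[OF that(2) b] by simp
    moreover have "2 \<le> length (drop b g)" using g that k by (auto simp: b_def)
    moreover have "nb (drop b g)" by (rule nb_drop) (use g that k in \<open>auto simp: b_def\<close>)
    ultimately show ?thesis using exts_card[of "drop b g" "m - s"] by (simp add: card_cartesian_product)
  qed
  have U: "nb p \<and> length p = Suc m \<and> (\<forall>i<m. L (p ! m) < L (p ! i))" if "p \<in> ?U" for p
    using that unfolding Union_Rec by simp
  have key: "nb p \<and> nb p' \<and> length p = Suc m \<and> length p' = Suc m \<and> p ! k = p' ! k
      \<and> take (Suc k) p = take (Suc k) p' \<and> k < cut p p' \<and> cut p p' \<le> m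
      \<and> ?g p p' \<in> Good (m + cut p p' - 2 * k)"
    if "(p, p') \<in> A" for p p'
  proof -
    have pU: "p \<in> ?U" "p' \<in> ?U" and t: "take (Suc k) p = take (Suc k) p'" and ne: "p ! Suc k \<noteq> p' ! Suc k"
      and m: "\<forall>i<m. L (p' ! m) < L (p ! i)"
      using that by (auto simp: A_def fork_def)
    note P = U[OF pU(1)] and P' = U[OF pU(2)]
    have nth: "p ! j = p' ! j" if "j \<le> k" for j
      using t that by (metis le_imp_less_Suc nth_take)
    define s where "s = cut p p'"
    have s1: "\<forall>i<m. L (p' ! s) < L (p ! i)"
      unfolding s_def cut_def by (rule LeastI[of _ m]) (rule m)
    have s2: "s \<le> m" unfolding s_def cut_def by (rule Least_le) (rule m)
    have s3: "k < s"
    proof (rule ccontr)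
      assume "\<not> k < s"
      then have "p ! s = p' ! s" "s < m" using nth k by auto
      then show False using s1 by force
    qed
    \<comment> \<open>The threshold for gluing: \<open>p\<close> stays at or above \<open>M\<close>
      before its end, \<open>p'\<close> does so before the cut because the cut is minimal, and both
      pieces end strictly below \<open>M\<close>.\<close>
    define M where "M = Min ((\<lambda>i. L (p ! i)) ` {..<m})"
    have Mle: "M \<le> L (p ! i)" if "i < m" for i unfolding M_def using that by (intro Min_le) auto
    have Mlt: "z < M" if "\<forall>i<m. z < L (p ! i)" for z
      unfolding M_def using that k by (subst Min_gr_iff) auto
    have Ms: "M \<le> L (p' ! j)" if "j < s" for j
    proof -
      have "\<not> (\<forall>i<m. L (p' ! j) < L (p ! i))"
        using not_less_Least[of j "\<lambda>j. \<forall>i<m. L (p' ! j) < L (p ! i)"] that by (simp add: s_def cut_def)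
      then show ?thesis using Mle by (meson le_trans not_less)
    qed
    let ?q = "drop k (take (Suc s) p')"
    have q: "nb ?q" "length ?q = Suc (s - k)" "\<And>i. i \<le> s - k \<Longrightarrow> ?q ! i = p' ! (k + i)"
      using P' s2 s3 nb_drop nb_take by auto
    have "glue (drop k p) ?q \<in> Good ((m - k) + (s - k))"
    proof (rule glue_Good[where m = M])
      show "nb (drop k p)" using P k nb_drop by auto
      show "L (drop k p ! (m - k)) < M" "L (?q ! (s - k)) < M"
        using P q k s1 s2 s3 Mlt by auto
      show "M \<le> L (drop k p ! i)" if "i < m - k" for i using that P Mle k by auto
      show "M \<le> L (?q ! i)" if "i < s - k" for i using that q Ms by auto
    qed (use P q k s3 nth[of k] ne in auto)
    moreover have "(m - k) + (s - k) = m + s - 2 * k" using k s3 by simp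
    ultimately show ?thesis using P P' nth[of k] t s2 s3 by (simp add: s_def)
  qed
  have "card A \<le> card ?C"
  proof (rule card_inj_on_le)
    have "finite (SIGMA g:Good (m + s - 2 * k). ?E g s)" if "s \<in> {Suc k..m}" for s
      using finite_Good E[OF that] by blast
    then show "finite ?C" by blast
    show "?f ` A \<subseteq> ?C"
    proof (rule image_subsetI)
      fix z assume z: "z \<in> A"
      obtain p p' where pp: "z = (p, p')" by (cases z)
      note kk = key[OF z[unfolded pp]]
      define s where "s = cut p p'"
      have s: "k < s" "s \<le> m" using kk by (auto simp: s_def)
      let ?q = "drop k (take (Suc s) p')"
      have 1: "rev (take (Suc (Suc k)) p) \<in> exts [glue (drop k p) ?q ! (b - 1), glue (drop k p) ?q ! b] k"
        unfolding b_def by (rule rev_take_exts) (use kk s k in auto)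
      have "drop b (glue (drop k p) ?q) = ?q"
        using kk s k by (simp add: glue_def b_def)
      moreover have "drop k p' \<in> exts ?q (m - s)"
        using kk s nb_drop by (simp add: exts_def take_drop)
      ultimately show "?f z \<in> ?C" using kk pp 1 s by (simp add: s_def)
    qed
    show "inj_on ?f A"
    proof (rule inj_onI)
      fix z z' assume z: "z \<in> A" and z': "z' \<in> A" and e: "?f z = ?f z'"
      obtain p p' q q' where st: "z = (p, p')" "z' = (q, q')" by (cases z; cases z')
      note kk = key[OF z[unfolded st]] key[OF z'[unfolded st]]
      have g: "?g p p' = ?g q q'" and d': "drop k p' = drop k q'"
        and r: "take (Suc (Suc k)) p = take (Suc (Suc k)) q" using e st by auto
      have d: "drop k p = drop k q"
        using glue_inj[OF g] kk k by auto
      have "take k p = take k q" using take_le_eq[OF r] by simp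
      moreover have "take k p = take k p'" "take k q = take k q'"
        using take_le_eq[of "Suc k" p p' k] take_le_eq[of "Suc k" q q' k] kk by auto
      ultimately show "z = z'" using d d' eq_from_take_drop st by metis
    qed
  qed
  also have "card ?C = (\<Sum>s = Suc k..m. card (Good (m + s - 2 * k)) * (D ^ k * D ^ (m - s)))"
  proof -
    have "finite (SIGMA g:Good (m + s - 2 * k). ?E g s)
      \<and> card (SIGMA g:Good (m + s - 2 * k). ?E g s) = card (Good (m + s - 2 * k)) * (D ^ k * D ^ (m - s))"
      if "s \<in> {Suc k..m}" for s
    proof -
      have "card (SIGMA g:Good (m + s - 2 * k). ?E g s) = (\<Sum>g\<in>Good (m + s - 2 * k). card (?E g s))"
        using finite_Good E[OF that] by (intro card_SigmaI) blast+
      also have "\<dots> = (\<Sum>g\<in>Good (m + s - 2 * k). D ^ k * D ^ (m - s))"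
        using E[OF that] by (intro sum.cong) auto
      finally show ?thesis using finite_Good E[OF that] by auto
    qed
    then show ?thesis by simp
  qed
  finally have A: "card A \<le> (\<Sum>s = Suc k..m. card (Good (m + s - 2 * k)) * (D ^ k * D ^ (m - s)))" .
  \<comment> \<open>If \<open>p'\<close> does not end below all earlier vertices of
    \<open>p\<close>, then the end of \<open>p\<close> lies below all earlier vertices of
    \<open>p'\<close>, and the swapped pair qualifies. This costs the factor 2.\<close>
  have sub: "fork ?U k \<subseteq> A \<union> prod.swap ` A"
  proof
    fix z assume z: "z \<in> fork ?U k"
    obtain p p' where pp: "z = (p, p')" by (cases z)
    have pU: "p \<in> ?U" "p' \<in> ?U" using z pp by (auto simp: fork_def)
    note P = U[OF pU(1)] and P' = U[OF pU(2)]
    have sw: "(p', p) \<in> fork ?U k" using z pp by (auto simp: fork_def)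
    show "z \<in> A \<union> prod.swap ` A"
    proof (cases "\<forall>i<m. L (p' ! m) < L (p ! i)")
      case True
      then show ?thesis using z pp by (simp add: A_def)
    next
      case False
      then obtain i where i: "i < m" "L (p ! i) \<le> L (p' ! m)" by (auto simp: not_less)
      have "L (p ! m) < L (p' ! j)" if "j < m" for j
        using P P' i that by (meson le_less_trans less_trans)
      then have "(p', p) \<in> A" using sw by (simp add: A_def)
      then show ?thesis using pp by (force simp: image_iff)
    qed
  qed
  have "card (fork ?U k) \<le> card (A \<union> prod.swap ` A)"
    using sub finA by (intro card_mono) auto
  also have "\<dots> \<le> card A + card (prod.swap ` A)" by (rule card_Un_le)
  also have "\<dots> \<le> card A + card A" using finA by (intro add_left_mono card_image_le)
  finally show ?thesis using A sum_card_fork[of "Rec m" m k] Rec_subset by simp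
qed


section \<open>Densities\<close>

definition avg :: "('a \<Rightarrow> real) \<Rightarrow> real" where
  "avg f = (\<Sum>u\<in>V. f u) / card V"

text \<open>There are \<open>D ^ (a - 1)\<close> walks of length \<open>a\<close> that begin with a
  given edge, so this is the density of falls conditioned on the first edge; \<open>q\<close>
  averages it over the edge and \<open>\<xi>\<close> also over \<open>u\<close>.\<close>

definition phi :: "nat \<Rightarrow> 'a \<Rightarrow> 'a \<Rightarrow> real" where
  "phi a u x = fall1 a u x / D ^ (a - 1)"

definition q :: "nat \<Rightarrow> 'a \<Rightarrow> real" where
  "q a u = (\<Sum>x\<in>nbr u. phi a u x) / Suc D"

definition \<xi> :: "nat \<Rightarrow> real" where "\<xi> n = avg (q n)"

lemma card_V_pos: "0 < card V" using finite_V V_nonempty by (simp add: card_gt_0_iff)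

lemma D_pos: "0 < real D" using D_ge by simp

lemma avg_mono: "(\<And>u. u \<in> V \<Longrightarrow> f u \<le> g u) \<Longrightarrow> avg f \<le> avg g"
  unfolding avg_def by (intro divide_right_mono sum_mono) auto

lemma avg_cong: "(\<And>u. u \<in> V \<Longrightarrow> f u = g u) \<Longrightarrow> avg f = avg g"
  unfolding avg_def by (simp cong: sum.cong)

lemma avg_add: "avg (\<lambda>u. f u + g u) = avg f + avg g"
  by (simp add: avg_def sum.distrib add_divide_distrib)

lemma avg_diff: "avg (\<lambda>u. f u - g u) = avg f - avg g"
  by (simp add: avg_def sum_subtractf diff_divide_distrib)

lemma avg_cmult: "avg (\<lambda>u. c * f u) = c * avg f"
  by (simp add: avg_def sum_distrib_left)

lemma avg_const: "avg (\<lambda>u. c) = c"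
  using card_V_pos by (simp add: avg_def)

lemma avg_sum: "avg (\<lambda>u. \<Sum>i\<in>I. f i u) = (\<Sum>i\<in>I. avg (f i))"
  by (simp add: avg_def sum.swap[of _ V] sum_divide_distrib)

lemma avg_nonneg: "(\<And>u. u \<in> V \<Longrightarrow> 0 \<le> f u) \<Longrightarrow> 0 \<le> avg f"
  unfolding avg_def by (simp add: sum_nonneg)

text \<open>Cauchy-Schwarz, obtained from the weighted arithmetic-geometric inequality with a free
  parameter \<open>t\<close>. The best choice is \<open>sqrt (B / A)\<close>; when a bound vanishes,
  \<open>t\<close> is taken very large or very small instead.\<close>

lemma avg_mult_le:
  assumes "avg (\<lambda>u. (f u)\<^sup>2) \<le> A" "avg (\<lambda>u. (g u)\<^sup>2) \<le> B"
  shows "avg (\<lambda>u. f u * g u) \<le> sqrt (A * B)"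
proof -
  have nn: "0 \<le> avg (\<lambda>u. (h u)\<^sup>2)" for h by (rule avg_nonneg) simp
  have pos: "avg (\<lambda>u. f u * g u) \<le> (t * A + B / t) / 2" if t: "0 < t" for t
  proof -
    have "f u * g u \<le> (t / 2) * (f u)\<^sup>2 + (1 / (2 * t)) * (g u)\<^sup>2" for u
    proof -
      have "0 \<le> (t * f u - g u)\<^sup>2 / (2 * t)" using t by simp
      also have "\<dots> = (t / 2) * (f u)\<^sup>2 + (1 / (2 * t)) * (g u)\<^sup>2 - f u * g u"
        using t by (simp add: power2_eq_square field_simps)
      finally show ?thesis by simp
    qed
    then have "avg (\<lambda>u. f u * g u) \<le> avg (\<lambda>u. (t / 2) * (f u)\<^sup>2 + (1 / (2 * t)) * (g u)\<^sup>2)"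
      by (rule avg_mono)
    also have "\<dots> = (t / 2) * avg (\<lambda>u. (f u)\<^sup>2) + (1 / (2 * t)) * avg (\<lambda>u. (g u)\<^sup>2)"
      unfolding avg_add avg_cmult ..
    also have "\<dots> \<le> (t / 2) * A + (1 / (2 * t)) * B"
      using assms t by (intro add_mono mult_left_mono) auto
    finally show ?thesis using t by (simp add: field_simps)
  qed
  have AB: "0 \<le> A" "0 \<le> B" using assms nn order_trans by blast+
  show ?thesis
  proof (cases "A = 0 \<or> B = 0")
    case False
    then have p: "0 < A" "0 < B" using AB by auto
    have "avg (\<lambda>u. f u * g u) \<le> (sqrt (B / A) * A + B / sqrt (B / A)) / 2"
      using p by (intro pos) simp
    also have "sqrt (B / A) * A = sqrt (A * B)"
      using p real_sqrt_mult_self[of A] by (simp add: real_sqrt_divide real_sqrt_mult field_simps)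
    also have "B / sqrt (B / A) = sqrt (A * B)"
      using p real_sqrt_mult_self[of B] by (simp add: real_sqrt_divide real_sqrt_mult field_simps)
    finally show ?thesis by simp
  next
    case True
    have "avg (\<lambda>u. f u * g u) \<le> e" if e: "0 < e" for e
    proof (cases "A = 0")
      case True
      have "avg (\<lambda>u. f u * g u) \<le> B / ((B + 1) / e) / 2"
        using pos[of "(B + 1) / e"] e AB True by simp
      also have "\<dots> \<le> e" using AB e by (simp add: field_simps add_nonneg_pos)
      finally show ?thesis .
    next
      case False
      then have "avg (\<lambda>u. f u * g u) \<le> e / 2" using pos[of "e / A"] e AB True by simp
      then show ?thesis using e by simp
    qed
    then have "avg (\<lambda>u. f u * g u) \<le> 0" by (rule field_le_epsilon) simp
    then show ?thesis using True by auto
  qed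
qed

lemma phi_nonneg: "0 \<le> phi a u x" by (simp add: phi_def)

lemma q_nonneg: "0 \<le> q a u" by (simp add: q_def phi_nonneg sum_nonneg)

lemma \<xi>_nonneg: "0 \<le> \<xi> n" unfolding \<xi>_def by (rule avg_nonneg) (rule q_nonneg)

lemma sum_phi: "(\<Sum>x\<in>nbr u. phi a u x) = Suc D * q a u"
  by (simp add: q_def del: of_nat_Suc mult_Suc mult_Suc_right)

lemma q_card:
  assumes "u \<in> V" "0 < a"
  shows "q a u * (Suc D * D ^ (a - 1)) = card (Fall a u)"
  using D_pos card_Fall_eq_sum[OF assms]
  by (simp add: q_def phi_def sum_divide_distrib[symmetric] del: of_nat_Suc mult_Suc mult_Suc_right)

lemma \<xi>_card:
  assumes "0 < a"
  shows "\<xi> a * (card V * (Suc D * D ^ (a - 1))) = X a"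
proof -
  have "real (X a) = (\<Sum>u\<in>V. q a u) * (Suc D * D ^ (a - 1))"
    unfolding X_def sum_distrib_right of_nat_sum using q_card[OF _ assms] by (intro sum.cong) auto
  then show ?thesis using card_V_pos by (simp add: \<xi>_def avg_def del: of_nat_Suc mult_Suc mult_Suc_right)
qed

lemma sum_phi_le_1:
  assumes "u \<in> V" "x \<in> nbr u"
  shows "(\<Sum>a = 1..M. phi a u x) \<le> 1"
proof (cases "M = 0")
  case False
  have "(\<Sum>a = 1..M. phi a u x) * D ^ (M - 1) = (\<Sum>a = 1..M. fall1 a u x * D ^ (M - a))"
    unfolding sum_distrib_right of_nat_sum
  proof (rule sum.cong[OF refl])
    fix a assume "a \<in> {1..M}"
    then have "M - 1 = (a - 1) + (M - a)" by auto
    then have "real D ^ (M - 1) = real D ^ (a - 1) * real D ^ (M - a)" by (metis power_add)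
    then show "phi a u x * D ^ (M - 1) = real (fall1 a u x * D ^ (M - a))"
      using D_pos by (simp add: phi_def)
  qed
  also have "\<dots> \<le> real (D ^ (M - 1))" using fall1_le[OF assms, of M] of_nat_le_iff by blast
  finally show ?thesis using D_pos by simp
qed simp

lemma phi_add_le_1:
  assumes "u \<in> V" "x \<in> nbr u" "0 < a" "0 < b" "a \<noteq> b"
  shows "phi a u x + phi b u x \<le> 1"
proof -
  have "phi a u x + phi b u x = (\<Sum>i\<in>{a, b}. phi i u x)" using assms by simp
  also have "\<dots> \<le> (\<Sum>i = 1..max a b. phi i u x)"
    using assms phi_nonneg by (intro sum_mono2) auto
  finally show ?thesis using sum_phi_le_1[OF assms(1,2)] by (meson order_trans)
qed

lemma phi_le_1:
  assumes "u \<in> V" "x \<in> nbr u" "0 < a"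
  shows "phi a u x \<le> 1"
  using phi_add_le_1[OF assms, of "Suc a"] phi_nonneg[of "Suc a" u x] by simp

lemma phi_1: "phi 1 u x = 0 \<or> phi 1 u x \<ge> 1"
  by (auto simp: phi_def)

text \<open>Every walk with one edge is good, and exactly one of its two orientations falls.\<close>

lemma \<xi>_1:
  assumes "1 \<le> len" shows "\<xi> 1 = 1 / 2"
proof -
  have "Good 1 = {w. nb w \<and> length w = Suc 1}" by (auto simp: Good_def)
  then have "2 * X 1 = card V * Suc D"
    using card_Good[of 1] sum_card_walks[of 1] assms by simp
  then have "real (2 * X 1) = real (card V * Suc D)" by (rule arg_cong)
  moreover have "\<xi> 1 * real (card V * Suc D) = X 1"
    using \<xi>_card[of 1] by (simp only: diff_self_eq_0 power_0 mult_1_right zero_less_one)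
  ultimately have "(2 * \<xi> 1) * real (card V * Suc D) = 1 * real (card V * Suc D)" by linarith
  moreover have "real (card V * Suc D) \<noteq> 0" using card_V_pos by (simp del: mult_Suc_right)
  ultimately have "2 * \<xi> 1 = 1" by (metis mult_right_cancel)
  then show ?thesis by simp
qed

lemma \<xi>_ge_splits:
  assumes "2 \<le> n" "n \<le> len"
  shows "avg (\<lambda>u. \<Sum>a = 1..<n. \<Sum>x\<in>nbr u. \<Sum>x'\<in>nbr u - {x}. phi a u x * phi (n - a) u x')
    \<le> Suc D * D * (2 * \<xi> n)"
proof -
  have D: "real D ^ (n - 1) = D * real D ^ (n - 2)"
    using assms by (metis Suc_1 Suc_diff_le diff_Suc_Suc diff_Suc_1 power_Suc le_numeral_extra(4) numeral_2_eq_2)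
  have "(\<Sum>u\<in>V. \<Sum>x\<in>nbr u. \<Sum>x'\<in>nbr u - {x}. \<Sum>a = 1..<n. fall1 a u x * fall1 (n - a) u x') \<le> 2 * X n"
    using Good_ge_splits[OF assms(2)] card_Good[of n] assms by simp
  then have "real (\<Sum>u\<in>V. \<Sum>x\<in>nbr u. \<Sum>x'\<in>nbr u - {x}. \<Sum>a = 1..<n. fall1 a u x * fall1 (n - a) u x') \<le> real (2 * X n)"
    using of_nat_le_iff by blast
  moreover have "real (\<Sum>u\<in>V. \<Sum>x\<in>nbr u. \<Sum>x'\<in>nbr u - {x}. \<Sum>a = 1..<n. fall1 a u x * fall1 (n - a) u x')
      = (\<Sum>u\<in>V. \<Sum>a = 1..<n. \<Sum>x\<in>nbr u. \<Sum>x'\<in>nbr u - {x}. phi a u x * phi (n - a) u x') * D ^ (n - 2)"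
  proof -
    have e: "phi a u x * phi (n - a) u x' * D ^ (n - 2) = real (fall1 a u x * fall1 (n - a) u x')"
      if "a \<in> {1..<n}" for a u x x'
    proof -
      have "n - 2 = (a - 1) + (n - a - 1)" using that by auto
      then have "real D ^ (n - 2) = real D ^ (a - 1) * real D ^ (n - a - 1)" by (metis power_add)
      then show ?thesis using D_pos by (simp add: phi_def)
    qed
    show ?thesis
      unfolding sum.swap[of _ "{1..<n}"] sum_distrib_right of_nat_sum
      by (intro sum.cong refl e[symmetric]) 
  qed
  ultimately have "(\<Sum>u\<in>V. \<Sum>a = 1..<n. \<Sum>x\<in>nbr u. \<Sum>x'\<in>nbr u - {x}. phi a u x * phi (n - a) u x') * D ^ (n - 2)
      \<le> 2 * (\<xi> n * (card V * (Suc D * D ^ (n - 1))))"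
    using \<xi>_card[of n] assms by simp
  also have "\<dots> = (Suc D * D * (2 * \<xi> n) * card V) * D ^ (n - 2)"
    using D by (simp del: of_nat_Suc mult_Suc mult_Suc_right)
  finally have "(\<Sum>u\<in>V. \<Sum>a = 1..<n. \<Sum>x\<in>nbr u. \<Sum>x'\<in>nbr u - {x}. phi a u x * phi (n - a) u x')
      \<le> Suc D * D * (2 * \<xi> n) * card V"
    using D_pos by simp
  then show ?thesis using card_V_pos by (simp add: avg_def pos_divide_le_eq del: of_nat_Suc mult_Suc mult_Suc_right)
qed

text \<open>Pairs branching \<open>k\<close> steps after position \<open>a - m\<close> glue to good
  paths of length \<open>2 * (m - k)\<close> and carry the factor \<open>1 / D ^ k\<close>; pairs
  that agree for \<open>K\<close> steps give the last term. The length \<open>a\<close> occurs only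
  there, so one \<open>m\<close> serves all \<open>a \<ge> m\<close>.\<close>

lemma avg_q_square_le:
  assumes "1 \<le> K" "K \<le> m" "m \<le> a" "2 * m \<le> len"
  shows "avg (\<lambda>u. (q a u)\<^sup>2) \<le> (\<Sum>k<K. 2 * \<xi> (2 * (m - k)) / D ^ k) + \<xi> a / D ^ K"
proof -
  define N where "N = real (card V)"
  define d where "d = real (Suc D)"
  define E where "E = real D"
  have pos: "0 < N" "0 < d" "0 < E" using card_V_pos D_pos by (auto simp: N_def d_def E_def)
  have "real ((\<Sum>u\<in>V. (card (Fall a u))\<^sup>2) * D) \<le>
     real (Suc D * D ^ (a - m) * ((\<Sum>k<K. 2 * X (2 * (m - k)) * D ^ (a - m + k)) + X a * D ^ (m - K)))"
    using sum_card_Fall_square_le[OF assms] of_nat_le_iff by blast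
  then have main: "(\<Sum>u\<in>V. (real (card (Fall a u)))\<^sup>2) * E \<le>
     d * E ^ (a - m) * ((\<Sum>k<K. 2 * real (X (2 * (m - k))) * E ^ (a - m + k)) + real (X a) * E ^ (m - K))"
    by (simp only: of_nat_mult of_nat_add of_nat_sum of_nat_power d_def E_def of_nat_numeral)
  have l: "(\<Sum>u\<in>V. (real (card (Fall a u)))\<^sup>2) = N * avg (\<lambda>u. (q a u)\<^sup>2) * (d * E ^ (a - 1))\<^sup>2"
  proof -
    have "(\<Sum>u\<in>V. (real (card (Fall a u)))\<^sup>2) = (\<Sum>u\<in>V. (q a u)\<^sup>2 * (d * E ^ (a - 1))\<^sup>2)"
    proof (rule sum.cong[OF refl])
      fix u assume "u \<in> V"
      then have "real (card (Fall a u)) = q a u * (d * E ^ (a - 1))"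
        using q_card[of u a] assms by (simp add: d_def E_def del: of_nat_Suc mult_Suc mult_Suc_right)
      then show "(real (card (Fall a u)))\<^sup>2 = (q a u)\<^sup>2 * (d * E ^ (a - 1))\<^sup>2"
        by (simp only: power_mult_distrib)
    qed
    then show ?thesis using pos by (simp add: avg_def N_def sum_distrib_right)
  qed
  have p1: "E ^ (2 * (m - k) - 1) * E ^ (a - m + k) = E ^ (a + m - 1) / E ^ k" if "k < K" for k
  proof -
    have "(2 * (m - k) - 1) + (a - m + k) + k = a + m - 1" using that assms by simp
    then have "E ^ (2 * (m - k) - 1) * E ^ (a - m + k) * E ^ k = E ^ (a + m - 1)" by (metis power_add)
    then show ?thesis using pos by (simp add: field_simps)
  qed
  have p2: "E ^ (a - 1) * E ^ (m - K) = E ^ (a + m - 1) / E ^ K"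
  proof -
    have "(a - 1) + (m - K) + K = a + m - 1" using assms by simp
    then have "E ^ (a - 1) * E ^ (m - K) * E ^ K = E ^ (a + m - 1)" by (metis power_add)
    then show ?thesis using pos by (simp add: field_simps)
  qed
  have X: "real (X n) = \<xi> n * (N * (d * E ^ (n - 1)))" if "0 < n" for n
    using \<xi>_card[OF that] by (simp only: of_nat_mult of_nat_power N_def d_def E_def)
  have s: "(\<Sum>k<K. 2 * real (X (2 * (m - k))) * E ^ (a - m + k)) = N * d * E ^ (a + m - 1) * (\<Sum>k<K. 2 * \<xi> (2 * (m - k)) / E ^ k)"
    unfolding sum_distrib_left
  proof (rule sum.cong[OF refl])
    fix k assume k: "k \<in> {..<K}"
    have "2 * real (X (2 * (m - k))) * E ^ (a - m + k) = N * d * (E ^ (2 * (m - k) - 1) * E ^ (a - m + k)) * (2 * \<xi> (2 * (m - k)))"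
      using X[of "2 * (m - k)"] k assms by simp
    also have "\<dots> = N * d * E ^ (a + m - 1) * (2 * \<xi> (2 * (m - k)) / E ^ k)" using p1[of k] k by simp
    finally show "2 * real (X (2 * (m - k))) * E ^ (a - m + k) = N * d * E ^ (a + m - 1) * (2 * \<xi> (2 * (m - k)) / E ^ k)" .
  qed
  have r: "real (X a) * E ^ (m - K) = N * d * E ^ (a + m - 1) * (\<xi> a / E ^ K)"
  proof -
    have "real (X a) * E ^ (m - K) = N * d * (E ^ (a - 1) * E ^ (m - K)) * \<xi> a" using X[of a] assms by simp
    then show ?thesis unfolding p2 by simp
  qed
  define S where "S = (\<Sum>k<K. 2 * \<xi> (2 * (m - k)) / E ^ k) + \<xi> a / E ^ K"
  have m: "N * avg (\<lambda>u. (q a u)\<^sup>2) * (d * E ^ (a - 1))\<^sup>2 * E \<le> d * E ^ (a - m) * (N * d * E ^ (a + m - 1) * S)"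
    using main unfolding l s r S_def by (simp add: algebra_simps)
  have "(E ^ (a - 1))\<^sup>2 * E = E ^ (a - m) * E ^ (a + m - 1)"
  proof -
    have "(a - 1) + (a - 1) + 1 = (a - m) + (a + m - 1)" using assms by simp
    then show ?thesis unfolding power2_eq_square by (metis power_add power_one_right)
  qed
  then have e: "E ^ (a - m) * E ^ (a + m - 1) = (E ^ (a - 1))\<^sup>2 * E" ..
  have "avg (\<lambda>u. (q a u)\<^sup>2) * (N * d\<^sup>2 * (E ^ (a - m) * E ^ (a + m - 1)))
      = N * avg (\<lambda>u. (q a u)\<^sup>2) * (d * E ^ (a - 1))\<^sup>2 * E"
    unfolding e by (simp add: power_mult_distrib)
  also have "\<dots> \<le> S * (N * d\<^sup>2 * (E ^ (a - m) * E ^ (a + m - 1)))"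
    by (rule order_trans[OF m]) (simp add: power2_eq_square)
  finally have "avg (\<lambda>u. (q a u)\<^sup>2) * (N * d\<^sup>2 * (E ^ (a - m) * E ^ (a + m - 1)))
      \<le> S * (N * d\<^sup>2 * (E ^ (a - m) * E ^ (a + m - 1)))" .
  then show ?thesis using pos by (simp add: S_def E_def)
qed


section \<open>Inequalities between the densities\<close>

text \<open>The square of the degree \<open>D + 1\<close> divided by the number
  \<open>(D + 1) * D\<close> of ordered pairs of distinct first edges.\<close>

definition \<kappa> :: real where "\<kappa> = (real D + 1) / real D"

lemma sum_off_diag:
  assumes "u \<in> V"
  shows "(\<Sum>x\<in>nbr u. \<Sum>x'\<in>nbr u - {x}. f x * g x')
    = (\<Sum>x\<in>nbr u. f x) * (\<Sum>x\<in>nbr u. g x) - (\<Sum>x\<in>nbr u. f x * (g x :: real))"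
proof -
  have "(\<Sum>x\<in>nbr u. \<Sum>x'\<in>nbr u - {x}. f x * g x') = (\<Sum>x\<in>nbr u. f x * (\<Sum>x'\<in>nbr u. g x') - f x * g x)"
    by (rule sum.cong[OF refl])
      (simp add: sum_diff1 finite_nbr[OF assms] sum_distrib_left[symmetric] right_diff_distrib)
  then show ?thesis by (simp add: sum_subtractf sum_distrib_right)
qed

text \<open>The recursion of the falls, with the pairs that share their first edge as error term.\<close>

lemma \<xi>_recursion:
  assumes "2 \<le> n" "n \<le> len"
  shows "\<kappa> * (\<Sum>a = 1..<n. avg (\<lambda>u. q a u * q (n - a) u))
    - avg (\<lambda>u. \<Sum>x\<in>nbr u. \<Sum>a = 1..<n. phi a u x * phi (n - a) u x) / ((real D + 1) * D) \<le> 2 * \<xi> n"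
proof -
  define d where "d = real D + 1"
  have sd: "real (Suc D) = d" by (simp add: d_def)
  have pos: "0 < d" "0 < real D" using D_pos by (auto simp: d_def)
  have "avg (\<lambda>u. \<Sum>a = 1..<n. \<Sum>x\<in>nbr u. \<Sum>x'\<in>nbr u - {x}. phi a u x * phi (n - a) u x')
    = avg (\<lambda>u. (\<Sum>a = 1..<n. d\<^sup>2 * (q a u * q (n - a) u)) - (\<Sum>x\<in>nbr u. \<Sum>a = 1..<n. phi a u x * phi (n - a) u x))"
    by (rule avg_cong)
      (simp add: sum_off_diag sum_phi sum_subtractf sd power2_eq_square mult.assoc mult.left_commute sum.swap[of _ "nbr _" "{_..<_}"] del: of_nat_Suc)
  also have "\<dots> = d\<^sup>2 * (\<Sum>a = 1..<n. avg (\<lambda>u. q a u * q (n - a) u))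
    - avg (\<lambda>u. \<Sum>x\<in>nbr u. \<Sum>a = 1..<n. phi a u x * phi (n - a) u x)"
    unfolding avg_diff avg_sum avg_cmult sum_distrib_left ..
  finally have "d\<^sup>2 * (\<Sum>a = 1..<n. avg (\<lambda>u. q a u * q (n - a) u))
    - avg (\<lambda>u. \<Sum>x\<in>nbr u. \<Sum>a = 1..<n. phi a u x * phi (n - a) u x) \<le> d * D * (2 * \<xi> n)"
    using \<xi>_ge_splits[OF assms] by (simp only: of_nat_mult sd)
  then show ?thesis using pos unfolding \<kappa>_def d_def[symmetric]
    by (simp add: field_simps power2_eq_square)
qed

text \<open>Sum the recursion with weights \<^term>\<open>z ^ n\<close>. For each first edge \<^term>\<open>x\<close> the truncated generating
  function of \<^term>\<open>\<lambda>a. phi a u x\<close> lies between 0 and \<^term>\<open>z ^ c\<close>, which bounds the diagonal terms;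
  completing the square eliminates what remains.\<close>

lemma \<xi>_generating:
  fixes z :: real
  assumes z: "1 \<le> z" and c: "1 \<le> c" "c \<le> M" and M: "2 \<le> M" "M \<le> len"
  shows "z \<le> (2 * D + z ^ c)\<^sup>2 / (4 * (real D * (real D + 1))) + 2 * (\<Sum>n = Suc c..M. z ^ n * \<xi> n)
    + \<kappa> * (\<Sum>a = 1..c. \<Sum>b = 1..c. if M < a + b then z ^ (a + b) * avg (\<lambda>u. q a u * q b u) else 0)"
proof -
  define d where "d = real D + 1"
  have sd: "real (Suc D) = d" by (simp add: d_def)
  have pos: "0 < d" "0 < real D" using D_pos by (auto simp: d_def)
  define Q where "Q u x = (\<Sum>a = 1..c. phi a u x * z ^ a)" for u x
  define S where "S u = (\<Sum>x\<in>nbr u. Q u x)" for u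
  define pr where "pr a b u = (\<Sum>x\<in>nbr u. \<Sum>x'\<in>nbr u - {x}. phi a u x * phi b u x')" for a b u
  have pr_nn: "0 \<le> pr a b u" for a b u by (simp add: pr_def sum_nonneg phi_nonneg)
  have S_eq: "S u = d * (\<Sum>a = 1..c. z ^ a * q a u)" for u
  proof -
    have "S u = (\<Sum>a = 1..c. \<Sum>x\<in>nbr u. phi a u x * z ^ a)"
      unfolding S_def Q_def by (rule sum.swap)
    also have "\<dots> = (\<Sum>a = 1..c. d * (z ^ a * q a u))"
      by (rule sum.cong[OF refl]) (simp add: sum_distrib_right[symmetric] sum_phi sd del: of_nat_Suc)
    finally show ?thesis by (simp add: sum_distrib_left)
  qed
  have Q: "0 \<le> Q u x" "Q u x \<le> z ^ c" if "u \<in> V" "x \<in> nbr u" for u x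
  proof -
    show "0 \<le> Q u x" using z by (simp add: Q_def sum_nonneg phi_nonneg)
    have "Q u x \<le> (\<Sum>a = 1..c. phi a u x * z ^ c)"
      unfolding Q_def using z phi_nonneg by (intro sum_mono mult_left_mono power_increasing) auto
    also have "\<dots> = (\<Sum>a = 1..c. phi a u x) * z ^ c" by (simp add: sum_distrib_right)
    also have "\<dots> \<le> 1 * z ^ c" using z sum_phi_le_1[OF that] by (intro mult_right_mono) auto
    finally show "Q u x \<le> z ^ c" by simp
  qed
  have low: "(S u)\<^sup>2 - z ^ c * S u \<le> (\<Sum>x\<in>nbr u. \<Sum>x'\<in>nbr u - {x}. Q u x * Q u x')" if "u \<in> V" for u
  proof -
    have "(\<Sum>x\<in>nbr u. Q u x * Q u x) \<le> (\<Sum>x\<in>nbr u. z ^ c * Q u x)"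
      using Q[OF that] by (intro sum_mono mult_right_mono) auto
    then show ?thesis unfolding sum_off_diag[OF that] S_def[symmetric]
      by (simp add: power2_eq_square sum_distrib_left[symmetric] S_def[symmetric])
  qed
  have exp: "(\<Sum>x\<in>nbr u. \<Sum>x'\<in>nbr u - {x}. Q u x * Q u x') = (\<Sum>a = 1..c. \<Sum>b = 1..c. z ^ (a + b) * pr a b u)" for u
  proof -
    have "(\<Sum>x\<in>nbr u. \<Sum>x'\<in>nbr u - {x}. Q u x * Q u x')
      = (\<Sum>x\<in>nbr u. \<Sum>x'\<in>nbr u - {x}. \<Sum>a = 1..c. \<Sum>b = 1..c. z ^ (a + b) * (phi a u x * phi b u x'))"
      unfolding Q_def sum_product by (simp add: power_add ac_simps)
    also have "\<dots> = (\<Sum>x\<in>nbr u. \<Sum>a = 1..c. \<Sum>b = 1..c. \<Sum>x'\<in>nbr u - {x}. z ^ (a + b) * (phi a u x * phi b u x'))"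
      by (subst sum.swap, subst (2) sum.swap, rule refl)
    also have "\<dots> = (\<Sum>a = 1..c. \<Sum>b = 1..c. \<Sum>x\<in>nbr u. \<Sum>x'\<in>nbr u - {x}. z ^ (a + b) * (phi a u x * phi b u x'))"
      by (subst sum.swap, subst (2) sum.swap, rule refl)
    finally show ?thesis by (simp add: pr_def sum_distrib_left)
  qed
  have conv: "(\<Sum>a = 1..c. \<Sum>b = 1..c. if a + b \<le> M then z ^ (a + b) * pr a b u else 0)
      \<le> (\<Sum>n = 2..M. \<Sum>a = 1..<n. z ^ n * pr a (n - a) u)" for u
  proof -
    have "(\<Sum>a = 1..c. \<Sum>b = 1..c. if a + b \<le> M then z ^ (a + b) * pr a b u else 0)
      = (\<Sum>(a, b)\<in>{1..c} \<times> {1..c}. if a + b \<le> M then z ^ (a + b) * pr a b u else 0)"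
      by (simp add: sum.cartesian_product)
    also have "\<dots> = (\<Sum>(a, b)\<in>{(a, b). a \<in> {1..c} \<and> b \<in> {1..c} \<and> a + b \<le> M}. z ^ (a + b) * pr a b u)"
      by (rule sum.mono_neutral_cong_right) (auto split: if_splits)
    also have "\<dots> = (\<Sum>(n, a)\<in>(\<lambda>(a, b). (a + b, a)) ` {(a, b). a \<in> {1..c} \<and> b \<in> {1..c} \<and> a + b \<le> M}. z ^ n * pr a (n - a) u)"
      by (subst sum.reindex) (auto simp: inj_on_def case_prod_beta)
    also have "\<dots> \<le> (\<Sum>(n, a)\<in>(SIGMA n:{2..M}. {1..<n}). z ^ n * pr a (n - a) u)"
      using pr_nn z by (intro sum_mono2) auto
    also have "\<dots> = (\<Sum>n = 2..M. \<Sum>a = 1..<n. z ^ n * pr a (n - a) u)"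
      by (simp add: sum.Sigma)
    finally show ?thesis .
  qed
  have prq: "pr a b u \<le> d\<^sup>2 * (q a u * q b u)" if "u \<in> V" for a b u
  proof -
    have "0 \<le> (\<Sum>x\<in>nbr u. phi a u x * phi b u x)" by (simp add: sum_nonneg phi_nonneg)
    then have "pr a b u \<le> (d * q a u) * (d * q b u)"
      unfolding pr_def sum_off_diag[OF that] sum_phi sd by simp
    then show ?thesis by (simp add: power2_eq_square ac_simps)
  qed
  \<comment> \<open>Pairs of total length above \<open>M\<close> are beyond the recursion. They are
    bounded by the full product, diagonal included.\<close>
  let ?T = "\<lambda>u. \<Sum>a = 1..c. \<Sum>b = 1..c. if M < a + b then z ^ (a + b) * (q a u * q b u) else 0"
  have pt: "(S u)\<^sup>2 - z ^ c * S u \<le> (\<Sum>n = 2..M. z ^ n * (\<Sum>a = 1..<n. pr a (n - a) u)) + d\<^sup>2 * ?T u"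
    if "u \<in> V" for u
  proof -
    have "(S u)\<^sup>2 - z ^ c * S u \<le> (\<Sum>a = 1..c. \<Sum>b = 1..c. z ^ (a + b) * pr a b u)"
      using low[OF that] unfolding exp .
    also have "\<dots> \<le> (\<Sum>a = 1..c. \<Sum>b = 1..c. (if a + b \<le> M then z ^ (a + b) * pr a b u else 0)
        + d\<^sup>2 * (if M < a + b then z ^ (a + b) * (q a u * q b u) else 0))"
      using prq[OF that] z by (intro sum_mono) (simp add: mult.left_commute[of "d\<^sup>2"])
    also have "\<dots> = (\<Sum>a = 1..c. \<Sum>b = 1..c. if a + b \<le> M then z ^ (a + b) * pr a b u else 0) + d\<^sup>2 * ?T u"
      by (simp add: sum.distrib sum_distrib_left)
    also have "(\<Sum>a = 1..c. \<Sum>b = 1..c. if a + b \<le> M then z ^ (a + b) * pr a b u else 0)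
      \<le> (\<Sum>n = 2..M. z ^ n * (\<Sum>a = 1..<n. pr a (n - a) u))"
      using conv[of u] by (simp add: sum_distrib_left)
    finally show ?thesis by simp
  qed
  have PI: "avg (\<lambda>u. \<Sum>a = 1..<n. pr a (n - a) u) \<le> d * D * (2 * \<xi> n)" if "n \<in> {2..M}" for n
    using \<xi>_ge_splits[of n] that M unfolding pr_def of_nat_mult sd by simp
  \<comment> \<open>The coefficient \<open>2 * D\<close> makes the terms
    \<open>z ^ n * \<xi> n\<close> with \<open>2 \<le> n \<le> c\<close> on the two sides cancel
    later. What survives is \<open>z\<close>, from \<open>\<xi> 1 = 1 / 2\<close>, and the tail
    beyond \<open>c\<close>.\<close>
  have top: "(2 * D + z ^ c) * S u - (S u)\<^sup>2 \<le> (2 * D + z ^ c)\<^sup>2 / 4" for u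
    using zero_le_power2[of "S u - (2 * D + z ^ c) / 2"]
    by (simp add: power2_eq_square field_simps)
  have "2 * D * avg S - (2 * D + z ^ c)\<^sup>2 / 4 = avg (\<lambda>u. 2 * D * S u - (2 * D + z ^ c)\<^sup>2 / 4)"
    by (simp only: avg_diff avg_cmult avg_const)
  also have "\<dots> \<le> avg (\<lambda>u. (\<Sum>n = 2..M. z ^ n * (\<Sum>a = 1..<n. pr a (n - a) u)) + d\<^sup>2 * ?T u)"
  proof (rule avg_mono)
    fix u assume u: "u \<in> V"
    have "2 * D * S u - (2 * D + z ^ c)\<^sup>2 / 4 \<le> (S u)\<^sup>2 - z ^ c * S u"
      using top[of u] by (simp add: algebra_simps)
    then show "2 * D * S u - (2 * D + z ^ c)\<^sup>2 / 4 \<le> (\<Sum>n = 2..M. z ^ n * (\<Sum>a = 1..<n. pr a (n - a) u)) + d\<^sup>2 * ?T u"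
      using pt[OF u] by linarith
  qed
  also have "\<dots> = (\<Sum>n = 2..M. z ^ n * avg (\<lambda>u. \<Sum>a = 1..<n. pr a (n - a) u)) + d\<^sup>2 * avg ?T"
    by (simp only: avg_add avg_cmult avg_sum)
  also have "\<dots> \<le> (\<Sum>n = 2..M. z ^ n * (d * D * (2 * \<xi> n))) + d\<^sup>2 * avg ?T"
    using PI z by (intro add_right_mono sum_mono mult_left_mono) auto
  also have "(\<Sum>n = 2..M. z ^ n * (d * D * (2 * \<xi> n))) = d * D * (2 * (\<Sum>n = 2..M. z ^ n * \<xi> n))"
    by (simp add: sum_distrib_left ac_simps)
  finally have A: "2 * D * avg S - (2 * D + z ^ c)\<^sup>2 / 4 \<le> d * D * (2 * (\<Sum>n = 2..M. z ^ n * \<xi> n)) + d\<^sup>2 * avg ?T" .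
  have "avg S = d * (\<Sum>a = 1..c. z ^ a * \<xi> a)"
    unfolding S_eq[abs_def] \<xi>_def by (simp only: avg_cmult avg_sum)
  also have "(\<Sum>a = 1..c. z ^ a * \<xi> a) = z / 2 + (\<Sum>a = 2..c. z ^ a * \<xi> a)"
    using c M \<xi>_1 by (simp add: sum.atLeast_Suc_atMost numeral_2_eq_2)
  finally have S: "avg S = d * (z / 2 + (\<Sum>a = 2..c. z ^ a * \<xi> a))" .
  have split: "(\<Sum>n = 2..M. z ^ n * \<xi> n) = (\<Sum>n = 2..c. z ^ n * \<xi> n) + (\<Sum>n = Suc c..M. z ^ n * \<xi> n)"
  proof -
    have "{2..M} = {2..c} \<union> {Suc c..M}" using c M by auto
    then show ?thesis by (simp add: sum.union_disjoint)
  qed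
  have T: "avg ?T = (\<Sum>a = 1..c. \<Sum>b = 1..c. if M < a + b then z ^ (a + b) * avg (\<lambda>u. q a u * q b u) else 0)"
  proof -
    have "avg (\<lambda>u. if M < a + b then z ^ (a + b) * (q a u * q b u) else 0)
      = (if M < a + b then z ^ (a + b) * avg (\<lambda>u. q a u * q b u) else 0)" for a b
      by (simp add: avg_cmult avg_const)
    then show ?thesis by (simp only: avg_sum)
  qed
  have "z * (d * D) \<le> (2 * D + z ^ c)\<^sup>2 / 4 + d * D * (2 * (\<Sum>n = Suc c..M. z ^ n * \<xi> n)) + d\<^sup>2 * avg ?T"
    using A unfolding S split by (simp add: algebra_simps)
  then have "z \<le> ((2 * D + z ^ c)\<^sup>2 / 4 + d * D * (2 * (\<Sum>n = Suc c..M. z ^ n * \<xi> n)) + d\<^sup>2 * avg ?T) / (d * D)"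
    using pos by (simp add: pos_le_divide_eq)
  also have "\<dots> = (2 * D + z ^ c)\<^sup>2 / (4 * (D * d)) + 2 * (\<Sum>n = Suc c..M. z ^ n * \<xi> n) + \<kappa> * avg ?T"
    using pos by (simp add: add_divide_distrib \<kappa>_def d_def[symmetric] power2_eq_square)
  finally show ?thesis unfolding T d_def .
qed

text \<open>Here \<open>t\<close> is the density of the walks of length \<open>m\<close> that end in
  their strict minimum. Its square is at most the mean square over the starts. Pairs branching at
  \<open>k\<close> glue to good paths of length \<open>m + s - 2 * k\<close>, and pairs that agree
  for \<open>K\<close> steps contribute \<open>t / D ^ K\<close>.\<close>

lemma \<xi>_record:
  assumes m: "1 \<le> m" "2 * m \<le> len" and K: "1 \<le> K" "K \<le> m"
  obtains t where "1 / (2 * real m + 1) \<le> t"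
    "\<kappa> * t\<^sup>2 - t / D ^ K \<le> 4 * (\<Sum>k<K. (\<Sum>s = Suc k..m. \<xi> (m + s - 2 * k)) / D ^ k)"
proof -
  define N where "N = real (card V)"
  define d where "d = real D + 1"
  define E where "E = real D"
  have pos: "0 < N" "0 < d" "0 < E" using card_V_pos D_pos by (auto simp: N_def d_def E_def)
  define R where "R = real (\<Sum>y\<in>V. card (Rec m y))"
  define t where "t = R / (N * (d * E ^ (m - 1)))"
  have Rt: "R = t * (N * (d * E ^ (m - 1)))" using pos by (simp add: t_def)
  have "real (card V * (Suc D * D ^ (m - 1))) \<le> real ((2 * m + 1) * (\<Sum>y\<in>V. card (Rec m y)))"
    using card_Rec_ge[OF m] of_nat_le_iff by blast
  also have "real (card V * (Suc D * D ^ (m - 1))) = N * (d * E ^ (m - 1))"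
    by (simp add: N_def d_def E_def algebra_simps)
  also have "real ((2 * m + 1) * (\<Sum>y\<in>V. card (Rec m y))) = (2 * real m + 1) * R"
    by (simp only: R_def of_nat_mult) simp
  finally have "1 * (N * (d * E ^ (m - 1))) \<le> ((2 * real m + 1) * t) * (N * (d * E ^ (m - 1)))"
    unfolding Rt by simp
  then have "1 \<le> (2 * real m + 1) * t" using pos by (simp only: mult_le_cancel_right) simp
  then have t1: "1 / (2 * real m + 1) \<le> t" by (simp add: pos_divide_le_eq mult.commute)
  have sq: "(card (Rec m y))\<^sup>2 \<le> (\<Sum>k<K. card (fork (Rec m y) k)) + card (Rec m y) * D ^ (m - K)" for y
  proof -
    have "(card (Rec m y))\<^sup>2 \<le> 1 * ((\<Sum>k = 0..<K. card (fork (Rec m y) k)) + card (Rec m y) * D ^ (m - K))"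
    proof (rule card_square_le_fork[where a = m])
      show "card {p \<in> Rec m y. take (Suc K) p = c} \<le> D ^ (m - K)" for c
        using card_walks_fibre[OF Rec_subset K] .
      have "take (Suc 0) ` Rec m y \<subseteq> {[y]}"
        by (auto simp: Rec_def walks_def take_Suc nbw_def hd_conv_nth)
      then show "card (take (Suc 0) ` Rec m y) \<le> 1"
        using card_mono[of "{[y]}"] by fastforce
    qed (use K finite_Rec in \<open>auto simp: Rec_def walks_def\<close>)
    then show ?thesis by (simp add: lessThan_atLeast0)
  qed
  have "R\<^sup>2 \<le> N * (\<Sum>y\<in>V. real ((card (Rec m y))\<^sup>2))"
  proof -
    have "(\<Sum>y\<in>V. card (Rec m y))\<^sup>2 \<le> card V * (\<Sum>y\<in>V. (card (Rec m y))\<^sup>2)" by (rule sum_square_le_card)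
    then have "real ((\<Sum>y\<in>V. card (Rec m y))\<^sup>2) \<le> real (card V * (\<Sum>y\<in>V. (card (Rec m y))\<^sup>2))"
      using of_nat_le_iff by blast
    then show ?thesis by (simp add: R_def N_def)
  qed
  also have "(\<Sum>y\<in>V. real ((card (Rec m y))\<^sup>2)) \<le> (\<Sum>k<K. 4 * (\<Sum>s = Suc k..m. X (m + s - 2 * k) * (E ^ k * E ^ (m - s)))) + R * E ^ (m - K)"
  proof -
    have "(\<Sum>y\<in>V. (card (Rec m y))\<^sup>2) \<le> (\<Sum>y\<in>V. (\<Sum>k<K. card (fork (Rec m y) k)) + card (Rec m y) * D ^ (m - K))"
      by (intro sum_mono sq)
    also have "\<dots> = (\<Sum>k<K. \<Sum>y\<in>V. card (fork (Rec m y) k)) + (\<Sum>y\<in>V. card (Rec m y)) * D ^ (m - K)"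
      unfolding sum.distrib sum_distrib_right by (simp add: sum.swap[of _ V])
    also have "(\<Sum>k<K. \<Sum>y\<in>V. card (fork (Rec m y) k)) \<le> (\<Sum>k<K. 2 * (\<Sum>s = Suc k..m. card (Good (m + s - 2 * k)) * (D ^ k * D ^ (m - s))))"
      using K by (intro sum_mono card_fork_Rec) auto
    also have "\<dots> = (\<Sum>k<K. 4 * (\<Sum>s = Suc k..m. X (m + s - 2 * k) * (D ^ k * D ^ (m - s))))"
    proof (rule sum.cong[OF refl])
      fix k assume k: "k \<in> {..<K}"
      have "card (Good (m + s - 2 * k)) * (D ^ k * D ^ (m - s)) = 2 * (X (m + s - 2 * k) * (D ^ k * D ^ (m - s)))"
        if "s \<in> {Suc k..m}" for s
      proof -
        have "0 < m + s - 2 * k" "m + s - 2 * k \<le> len" using that k K m by auto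
        then show ?thesis using card_Good by simp
      qed
      then have "(\<Sum>s = Suc k..m. card (Good (m + s - 2 * k)) * (D ^ k * D ^ (m - s)))
        = (\<Sum>s = Suc k..m. 2 * (X (m + s - 2 * k) * (D ^ k * D ^ (m - s))))"
        by (rule sum.cong[OF refl])
      then show "2 * (\<Sum>s = Suc k..m. card (Good (m + s - 2 * k)) * (D ^ k * D ^ (m - s)))
        = 4 * (\<Sum>s = Suc k..m. X (m + s - 2 * k) * (D ^ k * D ^ (m - s)))"
        by (simp add: sum_distrib_left[symmetric])
    qed
    finally have "(\<Sum>y\<in>V. (card (Rec m y))\<^sup>2) \<le> (\<Sum>k<K. 4 * (\<Sum>s = Suc k..m. X (m + s - 2 * k) * (D ^ k * D ^ (m - s)))) + (\<Sum>y\<in>V. card (Rec m y)) * D ^ (m - K)"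
      by simp
    then have "real (\<Sum>y\<in>V. (card (Rec m y))\<^sup>2) \<le> real ((\<Sum>k<K. 4 * (\<Sum>s = Suc k..m. X (m + s - 2 * k) * (D ^ k * D ^ (m - s)))) + (\<Sum>y\<in>V. card (Rec m y)) * D ^ (m - K))"
      using of_nat_le_iff by blast
    then show ?thesis by (simp add: R_def E_def)
  qed
  also have "(\<Sum>k<K. 4 * (\<Sum>s = Suc k..m. X (m + s - 2 * k) * (E ^ k * E ^ (m - s))))
    = N * d * E ^ (2 * m - 1) * (4 * (\<Sum>k<K. (\<Sum>s = Suc k..m. \<xi> (m + s - 2 * k)) / E ^ k))"
  proof -
    have "real (X (m + s - 2 * k)) * (E ^ k * E ^ (m - s)) = N * d * E ^ (2 * m - 1) * (\<xi> (m + s - 2 * k) / E ^ k)"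
      if "k < K" "s \<in> {Suc k..m}" for k s
    proof -
      have "(m + s - 2 * k - 1) + (k + (m - s)) + k = 2 * m - 1" using that K by auto
      then have "E ^ (m + s - 2 * k - 1) * (E ^ k * E ^ (m - s)) * E ^ k = E ^ (2 * m - 1)"
        by (metis power_add)
      moreover have "real (X (m + s - 2 * k)) = \<xi> (m + s - 2 * k) * (N * (d * E ^ (m + s - 2 * k - 1)))"
        using \<xi>_card[of "m + s - 2 * k"] that K
        by (simp add: N_def d_def E_def add.commute[of 1] del: mult_Suc mult_Suc_right)
      ultimately show ?thesis using pos by (simp add: field_simps)
    qed
    then show ?thesis by (simp add: sum_distrib_left sum_divide_distrib mult.left_commute)
  qed
  finally have "R\<^sup>2 \<le> N * (N * d * E ^ (2 * m - 1) * (4 * (\<Sum>k<K. (\<Sum>s = Suc k..m. \<xi> (m + s - 2 * k)) / E ^ k)) + R * E ^ (m - K))"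
    using pos by simp
  moreover have "R\<^sup>2 = (N\<^sup>2 * d * E ^ (2 * m - 1)) * (\<kappa> * t\<^sup>2)"
  proof -
    have "E ^ (m - 1) * E ^ (m - 1) * E = E ^ (2 * m - 1)"
    proof -
      have "(m - 1) + (m - 1) + 1 = 2 * m - 1" using m by simp
      then show ?thesis by (metis power_add power_one_right)
    qed
    then have e: "E ^ (2 * m - 1) = E ^ (m - 1) * E ^ (m - 1) * E" ..
    have "\<kappa> = d / E" by (simp add: \<kappa>_def d_def E_def)
    then show ?thesis using pos unfolding Rt e
      by (simp add: power2_eq_square)
  qed
  moreover have "N * (R * E ^ (m - K)) = (N\<^sup>2 * d * E ^ (2 * m - 1)) * (t / E ^ K)"
  proof -
    have "(m - 1) + (m - K) + K = 2 * m - 1" using K by simp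
    then have "E ^ (m - 1) * E ^ (m - K) * E ^ K = E ^ (2 * m - 1)" by (metis power_add)
    then show ?thesis using pos unfolding Rt by (simp add: power2_eq_square field_simps)
  qed
  ultimately have "(N\<^sup>2 * d * E ^ (2 * m - 1)) * (\<kappa> * t\<^sup>2) \<le> (N\<^sup>2 * d * E ^ (2 * m - 1)) *
      (4 * (\<Sum>k<K. (\<Sum>s = Suc k..m. \<xi> (m + s - 2 * k)) / E ^ k) + t / E ^ K)"
    by (simp add: distrib_left power2_eq_square)
  then have "\<kappa> * t\<^sup>2 \<le> 4 * (\<Sum>k<K. (\<Sum>s = Suc k..m. \<xi> (m + s - 2 * k)) / E ^ k) + t / E ^ K"
    using pos by (subst (asm) mult_le_cancel_left_pos) auto
  then show ?thesis using that[OF t1] by (simp add: E_def)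
qed

end

text \<open>The multipliers 0.58, 0.42, 0.15, 0.28, 0.22 and the squares below come from a numerical
  optimization. The claim is affine in \<open>e\<close>, so it suffices to treat \<open>e = 0\<close> and \<open>e = 1 / 6\<close>.\<close>

lemma quadratic_lower_bound:
  fixes x y z e :: real
  assumes nn: "0 \<le> x" "0 \<le> y" "0 \<le> z" and e: "0 \<le> e" "e \<le> 1 / 6"
  shows "(1 / 50) - (3 / 40) * e \<le> (29 / 50) * ((1 + e) * y\<^sup>2 - e * y + 2 * (1 + e) * (x * z)) + (21 / 50) * (z\<^sup>2 - e * z) + 2 * e * z
    - (3 / 20) * (2 * y - (1 + e) * x\<^sup>2 + e * x) - (7 / 25) * (z - (1 + e) * (x * y)) - (11 / 50) * (x - 1 / 2)"
proof -
  define P where "P = (3 / 20) * x\<^sup>2 + (29 / 50) * y\<^sup>2 + (21 / 50) * z\<^sup>2 + (7 / 25) * (x * y) + (29 / 25) * (x * z)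
    - (11 / 50) * x - (3 / 10) * y - (7 / 25) * z + ((11 / 100) :: real)"
  define Q where "Q = (7 / 40) * (x * x) + (203 / 300) * (y * y) + (21 / 50) * (z * z) + (49 / 150) * (x * y) + (203 / 150) * (x * z)
    - (49 / 200) * x - (119 / 300) * y - (1 / 60) * z + (11 / 100 :: real)"
  have xy: "0 \<le> x * y" "0 \<le> x * z" "0 \<le> y * z" using nn by auto
  have p1: "0 \<le> (1 / 1) * (x * x) + (8649 / 10000) * (y * y) + (20449 / 10000) * (z * z) + (93 / 50) * (x * y) + (143 / 50) * (x * z) + (13299 / 5000) * (y * z) + (-367 / 250) * (x) + (-34131 / 25000) * (y) + (-52481 / 25000) * (z) + (134689 / 250000)"
    using zero_le_power2[of "(1 / 1) * x + (93 / 100) * y + (143 / 100) * z + (-367 / 500)"] by (simp add: power2_eq_square field_simps)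
  have p2: "0 \<le> (1 / 1) * (y * y) + (12321 / 62500) * (z * z) + (-111 / 125) * (y * z) + (-53 / 250) * (y) + (5883 / 62500) * (z) + (2809 / 250000)"
    using zero_le_power2[of "(1 / 1) * y + (-111 / 250) * z + (-53 / 500)"] by (simp add: power2_eq_square field_simps)
  have p3: "0 \<le> (1 / 1) * (z * z) + (-3 / 10) * (z) + (9 / 400)"
    using zero_le_power2[of "(1 / 1) * z + (-3 / 20)"] by (simp add: power2_eq_square field_simps)
  have q1: "0 \<le> (1 / 1) * (x * x) + (8649 / 10000) * (y * y) + (93 / 50) * (x * y) + (-7 / 5) * (x) + (-651 / 500) * (y) + (49 / 100)"
    using zero_le_power2[of "(1 / 1) * x + (93 / 100) * y + (-7 / 10)"] by (simp add: power2_eq_square field_simps)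
  have q2: "0 \<le> (1 / 1) * (y * y) + (-161 / 500) * (y) + (25921 / 1000000)"
    using zero_le_power2[of "(1 / 1) * y + (-161 / 1000)"] by (simp add: power2_eq_square field_simps)
  have q3: "0 \<le> (1 / 1) * (z * z) + (-1 / 25) * (z) + (1 / 2500)"
    using zero_le_power2[of "(1 / 1) * z + (-1 / 50)"] by (simp add: power2_eq_square field_simps)
  have P: "(1 / 50) \<le> P"
    using p1 p2 p3 xy nn zero_le_square[of y] zero_le_square[of z] unfolding P_def power2_eq_square by linarith
  have Q: "(3 / 400) \<le> Q"
    using q1 q2 q3 xy nn zero_le_square[of y] zero_le_square[of z] unfolding Q_def by linarith
  \<comment> \<open>Affine interpolation between the value \<open>P\<close> at \<open>e = 0\<close>
    and the value \<open>Q\<close> at \<open>e = 1 / 6\<close>.\<close>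
  have "0 \<le> (1 - 6 * e) * (P - (1 / 50)) + 6 * e * (Q - (3 / 400))"
    using P Q e by (intro add_nonneg_nonneg mult_nonneg_nonneg) auto
  also have "\<dots> = (29 / 50) * ((1 + e) * y\<^sup>2 - e * y + 2 * (1 + e) * (x * z)) + (21 / 50) * (z\<^sup>2 - e * z) + 2 * e * z
    - (3 / 20) * (2 * y - (1 + e) * x\<^sup>2 + e * x) - (7 / 25) * (z - (1 + e) * (x * y)) - (11 / 50) * (x - 1 / 2) - ((1 / 50) - (3 / 40) * e)"
    unfolding P_def Q_def by (simp add: field_simps power2_eq_square)
  finally show ?thesis by simp
qed

section \<open>Weighted fall counts; radius 1, 2 and 4\<close>

context nb_graph begin

text \<open>The average number of falls with at most \<open>r\<close> edges, divided by
  \<open>(D + 1) / 2\<close>; this normalisation gives radius 1 the value 1.\<close>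

definition weight :: "nat \<Rightarrow> real" where
  "weight r = (\<Sum>n = 1..r. real D ^ (n - 1) * (2 * \<xi> n))"

lemma weight_1: "1 \<le> len \<Longrightarrow> weight 1 = 1"
  using \<xi>_1 by (simp add: weight_def)

lemma D_ge': "6 \<le> real D" using D_ge by simp

lemma \<kappa>_eq: "\<kappa> = 1 + 1 / real D" using D_pos by (simp add: \<kappa>_def add_divide_distrib)

lemma avg_sum_phi: "avg (\<lambda>u. \<Sum>x\<in>nbr u. phi a u x) = (real D + 1) * \<xi> a"
  unfolding sum_phi \<xi>_def avg_cmult by simp

text \<open>Controls the error term of \<open>\<xi>_recursion\<close>: once the diagonal sum at each
  edge is dominated by a single \<open>phi a u x\<close>, it costs only
  \<open>\<xi> a / D\<close>.\<close>

lemma avg_sum_phi_le: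
  assumes "\<And>u x. u \<in> V \<Longrightarrow> x \<in> nbr u \<Longrightarrow> f u x \<le> phi a u x"
  shows "avg (\<lambda>u. \<Sum>x\<in>nbr u. f u x) / ((real D + 1) * D) \<le> \<xi> a / D"
proof -
  have "avg (\<lambda>u. \<Sum>x\<in>nbr u. f u x) \<le> (real D + 1) * \<xi> a"
    unfolding avg_sum_phi[symmetric] using assms by (intro avg_mono sum_mono) auto
  then have "avg (\<lambda>u. \<Sum>x\<in>nbr u. f u x) / ((real D + 1) * D) \<le> (real D + 1) * \<xi> a / ((real D + 1) * D)"
    by (intro divide_right_mono) auto
  also have "\<dots> = \<xi> a / D" using D_pos by (simp add: add_pos_pos)
  finally show ?thesis .
qed

lemma phi_square_le: "u \<in> V \<Longrightarrow> x \<in> nbr u \<Longrightarrow> 0 < a \<Longrightarrow> phi a u x * phi a u x \<le> phi a u x"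
  using phi_le_1[of u x a] phi_nonneg[of a u x] mult_left_le by blast

text \<open>If the edge to \<open>x\<close> goes down, every fall through \<open>x\<close> ends
  there; otherwise \<open>phi 1 u x\<close> vanishes.\<close>

lemma phi_1_mult:
  assumes "u \<in> V" "x \<in> nbr u" "1 < a"
  shows "phi 1 u x * phi a u x = 0"
proof -
  have "phi 1 u x + phi a u x \<le> 1" using phi_add_le_1[of u x 1 a] assms by simp
  then show ?thesis using phi_1[of u x] phi_nonneg[of a u x] by auto
qed

lemma \<xi>_2_ge:
  assumes "2 \<le> len"
  shows "\<kappa> * avg (\<lambda>u. (q 1 u)\<^sup>2) - \<xi> 1 / D \<le> 2 * \<xi> 2"
proof -
  have "avg (\<lambda>u. \<Sum>x\<in>nbr u. phi 1 u x * phi 1 u x) / ((real D + 1) * D) \<le> \<xi> 1 / D"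
    by (rule avg_sum_phi_le) (rule phi_square_le, auto)
  then show ?thesis using \<xi>_recursion[of 2] assms
    by (simp add: power2_eq_square numeral_2_eq_2)
qed

text \<open>Each diagonal product pairs length 1 with length 2 and vanishes, so no error term
  remains.\<close>

lemma \<xi>_3_ge:
  assumes "3 \<le> len"
  shows "\<kappa> * avg (\<lambda>u. q 1 u * q 2 u) \<le> \<xi> 3"
proof -
  have s: "{1..<3} = {1, 2 :: nat}" by auto
  have c: "avg (\<lambda>u. q (Suc (Suc 0)) u * q (Suc 0) u) = avg (\<lambda>u. q (Suc 0) u * q (Suc (Suc 0)) u)"
    by (simp add: mult.commute)
  have "avg (\<lambda>u. \<Sum>x\<in>nbr u. \<Sum>a = 1..<3. phi a u x * phi (3 - a) u x) = avg (\<lambda>u. 0)"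
    unfolding s by (intro avg_cong sum.neutral) (use phi_1_mult[of _ _ 2] in \<open>fastforce simp: mult.commute\<close>)
  then show ?thesis using \<xi>_recursion[of 3] assms unfolding s
    by (simp add: avg_const c distrib_left numeral_3_eq_3 numeral_2_eq_2)
qed

lemma \<xi>_4_ge:
  assumes "4 \<le> len"
  shows "\<kappa> * (avg (\<lambda>u. (q 2 u)\<^sup>2) + 2 * avg (\<lambda>u. q 1 u * q 3 u)) - \<xi> 2 / D \<le> 2 * \<xi> 4"
proof -
  have s: "{1..<4} = {1, 2, 3 :: nat}" by auto
  have "avg (\<lambda>u. \<Sum>x\<in>nbr u. \<Sum>a = 1..<4. phi a u x * phi (4 - a) u x) / ((real D + 1) * D) \<le> \<xi> 2 / D"
  proof (rule avg_sum_phi_le)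
    fix u x assume ux: "u \<in> V" "x \<in> nbr u"
    show "(\<Sum>a = 1..<4. phi a u x * phi (4 - a) u x) \<le> phi 2 u x"
      using phi_square_le[OF ux, of 2] phi_1_mult[OF ux, of 3] unfolding s
      by (simp del: mult_eq_0_iff add: mult.commute)
  qed
  then show ?thesis using \<xi>_recursion[of 4] assms unfolding s
    by (simp add: mult.commute[of "q 3 _"] power2_eq_square algebra_simps)
qed

lemma avg_q1_square_ge: "1 \<le> len \<Longrightarrow> 1 / 4 \<le> avg (\<lambda>u. (q 1 u)\<^sup>2)"
proof -
  assume len: "1 \<le> len"
  have "avg (\<lambda>u. q 1 u - 1 / 4) \<le> avg (\<lambda>u. (q 1 u)\<^sup>2)"
  proof (rule avg_mono)
    show "q 1 u - 1 / 4 \<le> (q 1 u)\<^sup>2" for u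
      using zero_le_power2[of "q 1 u - 1 / 2"] by (simp add: power2_eq_square algebra_simps)
  qed
  then show ?thesis using \<xi>_1[OF len] by (simp add: avg_diff avg_const \<xi>_def)
qed

text \<open>Origin of the base \<open>(D - 1) / 4\<close>: the squared mean \<open>1 / 4\<close> of
  \<open>q 1\<close>, times \<open>\<kappa>\<close>, minus the diagonal error
  \<open>1 / (2 * D)\<close>, all multiplied by \<open>D\<close>.\<close>

lemma \<xi>_2_lower:
  assumes "2 \<le> len" shows "(real D - 1) / 4 \<le> D * (2 * \<xi> 2)"
proof -
  have one: "1 \<le> len" using assms by simp
  have "\<kappa> * (1 / 4) \<le> \<kappa> * avg (\<lambda>u. (q 1 u)\<^sup>2)"
    using avg_q1_square_ge assms D_pos by (intro mult_left_mono) (auto simp: \<kappa>_eq)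
  then have "\<kappa> * (1 / 4) - 1 / 2 / D \<le> 2 * \<xi> 2"
    using \<xi>_2_ge[OF assms] unfolding \<xi>_1[OF one] by linarith
  then have "D * (\<kappa> * (1 / 4) - 1 / 2 / D) \<le> D * (2 * \<xi> 2)" by (intro mult_left_mono) auto
  moreover have "D * (\<kappa> * (1 / 4) - 1 / 2 / D) = (real D - 1) / 4"
    using D_pos by (simp add: \<kappa>_eq field_simps)
  ultimately show ?thesis by (simp only:)
qed

lemma weight_2:
  assumes "2 \<le> len" shows "((real D - 1) / 4) ^ (2 - 1) \<le> weight 2"
proof -
  have "weight 2 = 2 * \<xi> 1 + D * (2 * \<xi> 2)" by (simp add: weight_def numeral_2_eq_2)
  then show ?thesis using \<xi>_2_lower[OF assms] \<xi>_1 assms by simp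
qed

lemma weight_4:
  assumes "4 \<le> len" shows "((real D - 1) / 4) ^ (4 - 1) \<le> weight 4"
proof -
  define e where "e = 1 / real D"
  have e: "0 < e" "e \<le> 1 / 6" using D_ge' by (auto simp: e_def field_simps)
  have \<kappa>e: "\<kappa> = 1 + e" by (simp add: \<kappa>_eq e_def)
  define A B C P R where "A = avg (\<lambda>u. (q 1 u)\<^sup>2)" and "B = avg (\<lambda>u. (q 2 u)\<^sup>2)" and "C = avg (\<lambda>u. (q 3 u)\<^sup>2)"
    and "P = avg (\<lambda>u. q 1 u * q 2 u)" and "R = avg (\<lambda>u. q 1 u * q 3 u)"
  have 1: "\<xi> 1 = 1 / 2" using \<xi>_1 assms by simp
  have 2: "(1 + e) * A - e * \<xi> 1 \<le> 2 * \<xi> 2"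
    using \<xi>_2_ge assms unfolding \<kappa>e A_def e_def by simp
  have 3: "(1 + e) * P \<le> \<xi> 3" using \<xi>_3_ge assms unfolding \<kappa>e P_def by simp
  have 4: "(1 + e) * (B + 2 * R) - e * \<xi> 2 \<le> 2 * \<xi> 4"
    using \<xi>_4_ge assms unfolding \<kappa>e B_def R_def e_def by simp
  \<comment> \<open>Falls of length 3 that share exactly their first edge glue to good paths of
    length 4.\<close>
  have 5: "C \<le> 2 * \<xi> 4 + e * \<xi> 3"
    using avg_q_square_le[of 1 2 3] assms unfolding C_def e_def by simp
  \<comment> \<open>The pointwise inequality is applied with \<open>q 1 u\<close>,
    \<open>q 2 u\<close>, \<open>q 3 u\<close> for its variables. Its brackets match the facts 2 to
    5 and \<open>\<xi> 1 = 1 / 2\<close>, so averaging combines these with the chosen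
    multipliers.\<close>
  have "avg (\<lambda>u. (1 / 50) - (3 / 40) * e) \<le> avg (\<lambda>u. (29 / 50) * ((1 + e) * (q 2 u)\<^sup>2 - e * q 2 u + 2 * (1 + e) * (q 1 u * q 3 u))
    + (21 / 50) * ((q 3 u)\<^sup>2 - e * q 3 u) + 2 * e * q 3 u
    - (3 / 20) * (2 * q 2 u - (1 + e) * (q 1 u)\<^sup>2 + e * q 1 u) - (7 / 25) * (q 3 u - (1 + e) * (q 1 u * q 2 u)) - (11 / 50) * (q 1 u - 1 / 2))"
    using e q_nonneg by (intro avg_mono quadratic_lower_bound) auto
  then have "(1 / 50) - (3 / 40) * e \<le> (29 / 50) * ((1 + e) * B - e * \<xi> 2 + 2 * (1 + e) * R)
    + (21 / 50) * (C - e * \<xi> 3) + 2 * e * \<xi> 3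
    - (3 / 20) * (2 * \<xi> 2 - (1 + e) * A + e * \<xi> 1) - (7 / 25) * (\<xi> 3 - (1 + e) * P) - (11 / 50) * (\<xi> 1 - 1 / 2)"
    unfolding avg_diff avg_add avg_cmult avg_const \<xi>_def A_def B_def C_def P_def R_def .
  moreover have "0 \<le> (29 / 50) * (2 * \<xi> 4 - ((1 + e) * (B + 2 * R) - e * \<xi> 2)) + (21 / 50) * (2 * \<xi> 4 + e * \<xi> 3 - C)
    + (3 / 20) * (2 * \<xi> 2 - ((1 + e) * A - e * \<xi> 1)) + (7 / 25) * (\<xi> 3 - (1 + e) * P)"
    using 2 3 4 5 by (intro add_nonneg_nonneg mult_nonneg_nonneg) auto
  ultimately have "(1 / 50) - (3 / 40) * e \<le> 2 * \<xi> 4 + 2 * e * \<xi> 3"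
    unfolding 1 by argo
  moreover have "(1 - e) ^ 3 / 64 - e ^ 3 \<le> (1 / 50) - (3 / 40) * e"
  proof -
    \<comment> \<open>The first product bounds \<open>e\<^sup>2\<close> by its chord on the interval
      from 0 to \<open>1 / 6\<close>; the second bounds \<open>e ^ 3\<close> from below by its
      tangent at \<open>1 / 10\<close>.\<close>
    have "0 \<le> e * (1 / 6 - e)" "0 \<le> (e - 1 / 10) ^ 2 * (e + 1 / 5)" using e by auto
    moreover have "e * (1 / 6 - e) = (1 / 6) * e - e * e"
      "(e - 1 / 10) ^ 2 * (e + 1 / 5) = e * e * e - (3 / 100) * e + 1 / 500"
      "(1 - e) ^ 3 / 64 - e ^ 3 = 1 / 64 - (3 / 64) * e + (3 / 64) * (e * e) - (65 / 64) * (e * e * e)"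
      by (simp_all add: power2_eq_square power3_eq_cube field_simps)
    ultimately show ?thesis using e by linarith
  qed
  moreover have "0 \<le> 2 * e ^ 2 * \<xi> 2" using \<xi>_nonneg[of 2] by simp
  ultimately have "(1 - e) ^ 3 / 64 \<le> e ^ 3 + 2 * e ^ 2 * \<xi> 2 + 2 * e * \<xi> 3 + 2 * \<xi> 4" by linarith
  then have "D ^ 3 * ((1 - e) ^ 3 / 64) \<le> D ^ 3 * (e ^ 3 + 2 * e ^ 2 * \<xi> 2 + 2 * e * \<xi> 3 + 2 * \<xi> 4)"
    by (intro mult_left_mono) auto
  also have "D ^ 3 * ((1 - e) ^ 3 / 64) = ((real D - 1) / 4) ^ 3"
  proof -
    have "1 - e = (real D - 1) / D" using D_pos by (simp add: e_def diff_divide_distrib)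
    then show ?thesis using D_pos by (simp add: power_divide)
  qed
  also have "D ^ 3 * (e ^ 3 + 2 * e ^ 2 * \<xi> 2 + 2 * e * \<xi> 3 + 2 * \<xi> 4) = weight 4"
  proof -
    have De: "real D ^ 3 * e ^ 3 = 1" "real D ^ 3 * e ^ 2 = D" "real D ^ 3 * e = real D ^ 2"
      using D_pos by (simp_all add: e_def power_divide power2_eq_square power3_eq_cube)
    have s: "{1..4} = {1, 2, 3, 4 :: nat}" by auto
    have "real D ^ 3 * (e ^ 3 + 2 * e ^ 2 * \<xi> 2 + 2 * e * \<xi> 3 + 2 * \<xi> 4)
      = real D ^ 3 * e ^ 3 + real D ^ 3 * e ^ 2 * (2 * \<xi> 2) + real D ^ 3 * e * (2 * \<xi> 3) + real D ^ 3 * (2 * \<xi> 4)"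
      by (simp only: distrib_left ac_simps)
    also have "\<dots> = weight 4" unfolding De weight_def s using 1 by simp
    finally show ?thesis by simp
  qed
  finally show ?thesis by simp
qed

lemma \<xi>_le_weight:
  assumes "1 \<le> n" "n \<le> r" shows "real D ^ (n - 1) * (2 * \<xi> n) \<le> weight r"
  unfolding weight_def using assms \<xi>_nonneg by (intro member_le_sum) auto

text \<open>As \<open>z \<le> D\<close>, the quotient of \<open>z ^ n\<close> by
  \<open>D ^ (n - 1)\<close> is largest at \<open>n = Suc c\<close>, so the whole tail shares one
  budget at that rate.\<close>

lemma tail_le_weight:
  fixes z :: real
  assumes z: "1 \<le> z" "z \<le> D" and c: "M \<le> r"
  shows "2 * (\<Sum>n = Suc c..M. z ^ n * \<xi> n) \<le> z ^ Suc c / D ^ c * weight r"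
proof -
  have "2 * (\<Sum>n = Suc c..M. z ^ n * \<xi> n) = (\<Sum>n = Suc c..M. z ^ n * (2 * \<xi> n))"
    by (simp add: sum_distrib_left mult.left_commute)
  also have "\<dots> \<le> (\<Sum>n = Suc c..M. z ^ Suc c / D ^ c * (real D ^ (n - 1) * (2 * \<xi> n)))"
  proof (rule sum_mono)
    fix n assume n: "n \<in> {Suc c..M}"
    then obtain j where j: "n = Suc c + j" by (metis atLeastAtMost_iff le_Suc_ex)
    have "z ^ n \<le> z ^ Suc c * real D ^ j"
      unfolding j power_add using z by (intro mult_left_mono power_mono) auto
    also have "\<dots> = z ^ Suc c / D ^ c * real D ^ (n - 1)"
      using D_pos by (simp add: j power_add)
    finally have "z ^ n * (2 * \<xi> n) \<le> z ^ Suc c / D ^ c * real D ^ (n - 1) * (2 * \<xi> n)"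
      using \<xi>_nonneg[of n] by (intro mult_right_mono) auto
    then show "z ^ n * (2 * \<xi> n) \<le> z ^ Suc c / D ^ c * (real D ^ (n - 1) * (2 * \<xi> n))"
      by (simp only: mult.assoc)
  qed
  also have "\<dots> = z ^ Suc c / D ^ c * (\<Sum>n = Suc c..M. real D ^ (n - 1) * (2 * \<xi> n))"
    by (simp only: sum_distrib_left)
  also have "\<dots> \<le> z ^ Suc c / D ^ c * weight r"
    unfolding weight_def using c \<xi>_nonneg z by (intro mult_left_mono sum_mono2) auto
  finally show ?thesis .
qed

end

section \<open>Radius 8 and 16\<close>

text \<open>The hypothesis on \<open>s\<close> places it at or beyond the positive root of the
  quadratic, which turns a bound with \<open>y\<close> on both sides into an explicit one.\<close>

lemma le_of_square_le:
  fixes y s e k :: real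
  assumes "y\<^sup>2 \<le> e + y * k" "e + s * k \<le> s\<^sup>2" "0 < s" "0 \<le> e" "0 \<le> k"
  shows "y \<le> s"
proof (rule ccontr)
  assume "\<not> y \<le> s"
  then have y: "s < y" by simp
  have "s * k \<le> s * s" using assms unfolding power2_eq_square by linarith
  then have "k \<le> s" using assms(3) by simp
  have "y\<^sup>2 - s\<^sup>2 \<le> k * (y - s)" using assms by (simp add: algebra_simps)
  then have "(y + s) * (y - s) \<le> k * (y - s)" by (simp add: power2_eq_square algebra_simps)
  then have "y + s \<le> k" using y by simp
  then show False using \<open>k \<le> s\<close> y assms(3) by simp
qed

context nb_graph begin

lemma q_le_1:
  assumes "u \<in> V" "0 < a" shows "q a u \<le> 1"
proof -
  have "(\<Sum>x\<in>nbr u. phi a u x) \<le> (\<Sum>x\<in>nbr u. 1)" using phi_le_1 assms by (intro sum_mono) auto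
  then show ?thesis using card_nbr[OF assms(1)] by (simp add: q_def)
qed

lemma avg_q_square_le_\<xi>:
  assumes "0 < a" shows "avg (\<lambda>u. (q a u)\<^sup>2) \<le> \<xi> a"
  unfolding \<xi>_def
proof (rule avg_mono)
  fix u assume "u \<in> V"
  then show "(q a u)\<^sup>2 \<le> q a u"
    using q_le_1[of u a] q_nonneg[of a u] assms by (simp add: power2_eq_square mult_left_le)
qed

lemma sum_\<xi>_le_1: "(\<Sum>a = 1..M. \<xi> a) \<le> 1"
proof -
  have "(\<Sum>a = 1..M. \<xi> a) = avg (\<lambda>u. \<Sum>a = 1..M. q a u)" by (simp only: avg_sum \<xi>_def)
  also have "\<dots> \<le> avg (\<lambda>u. 1)"
  proof (rule avg_mono)
    fix u assume u: "u \<in> V"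
    have "(\<Sum>a = 1..M. q a u) = (\<Sum>x\<in>nbr u. \<Sum>a = 1..M. phi a u x) / Suc D"
      by (simp only: q_def sum_divide_distrib[symmetric] sum.swap[of _ "nbr u"])
    also have "\<dots> \<le> (\<Sum>x\<in>nbr u. 1) / Suc D"
      using sum_phi_le_1[OF u] by (intro divide_right_mono sum_mono) auto
    finally show "(\<Sum>a = 1..M. q a u) \<le> 1" using card_nbr[OF u] by simp
  qed
  finally show ?thesis by (simp add: avg_const)
qed

lemma \<xi>_le_half:
  assumes "1 \<le> len" "2 \<le> a" shows "\<xi> a \<le> 1 / 2"
proof -
  have "\<xi> 1 + \<xi> a = (\<Sum>i\<in>{1, a}. \<xi> i)" using assms by simp
  also have "\<dots> \<le> (\<Sum>i = 1..a. \<xi> i)" using assms \<xi>_nonneg by (intro sum_mono2) auto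
  finally show ?thesis using sum_\<xi>_le_1[of a] \<xi>_1[OF assms(1)] by simp
qed

lemma \<xi>_3_le:
  assumes "2 \<le> len" shows "\<xi> 3 \<le> 2 / 5"
proof -
  have s: "{1..3} = {1, 2, 3 :: nat}" by auto
  have "(real D - 1) / 4 \<le> D * (2 * \<xi> 2)" by (rule \<xi>_2_lower[OF assms])
  then have "1 / 10 * D \<le> \<xi> 2 * D" using D_ge' unfolding mult.commute[of "\<xi> 2"] by argo
  then have "1 / 10 \<le> \<xi> 2" using D_pos by simp
  then show ?thesis using sum_\<xi>_le_1[of 3] \<xi>_1 assms unfolding s by simp
qed

lemma avg_mult_le_mean:
  assumes "avg (\<lambda>u. (f u)\<^sup>2) \<le> A" "avg (\<lambda>u. (g u)\<^sup>2) \<le> B"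
  shows "avg (\<lambda>u. f u * g u) \<le> (A + B) / 2"
proof -
  have "avg (\<lambda>u. 2 * (f u * g u)) \<le> avg (\<lambda>u. (f u)\<^sup>2 + (g u)\<^sup>2)"
    by (rule avg_mono) (use sum_squares_bound in \<open>simp add: mult.assoc\<close>)
  then show ?thesis using assms by (simp add: avg_add avg_cmult)
qed

lemma \<xi>_square_le: "(\<xi> a)\<^sup>2 \<le> avg (\<lambda>u. (q a u)\<^sup>2)"
proof -
  have "avg (\<lambda>u. 2 * \<xi> a * q a u - (\<xi> a)\<^sup>2) \<le> avg (\<lambda>u. (q a u)\<^sup>2)"
  proof (rule avg_mono)
    show "2 * \<xi> a * q a u - (\<xi> a)\<^sup>2 \<le> (q a u)\<^sup>2" for u
      using sum_squares_bound[of "\<xi> a" "q a u"] by simp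
  qed
  then show ?thesis by (simp only: avg_diff avg_cmult avg_const) (simp add: \<xi>_def[symmetric] power2_eq_square)
qed

lemma avg_commute: "avg (\<lambda>u. f u * g u) = avg (\<lambda>u. g u * f u)"
  by (simp only: mult.commute)

text \<open>In the following, \<open>z\<close> and the cut-off \<open>c\<close> of \<open>\<xi>_generating\<close> depend on the range of \<^term>\<open>D\<close>;
  they and the other constants are rounded results of a numerical search.\<close>

lemma weight_8_le_10:
  assumes len: "8 \<le> len" and D: "D \<le> 10" shows "((real D - 1) / 4) ^ (8 - 1) \<le> weight 8"
proof (rule ccontr)
  let ?G = "((real D - 1) / 4) ^ 7"
  assume "\<not> ?thesis"
  then have w: "weight 8 \<le> ?G" by simp
  have "2 * (\<Sum>n = Suc 4..8. (11 / 10) ^ n * \<xi> n) \<le> (11 / 10) ^ Suc 4 / D ^ 4 * weight 8"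
    using D_ge' by (intro tail_le_weight) auto
  also have "\<dots> \<le> (11 / 10) ^ Suc 4 / D ^ 4 * ?G" using w by (intro mult_left_mono) auto
  finally have t: "2 * (\<Sum>n = Suc 4..8. (11 / 10) ^ n * \<xi> n) \<le> (11 / 10) ^ Suc 4 / D ^ 4 * ?G" .
  \<comment> \<open>With \<open>c = 4\<close> no pair has total length above 8, so the third term of
    the generating inequality vanishes.\<close>
  have p: "(\<Sum>a = 1..4. \<Sum>b = 1..4. if 8 < a + b then (11 / 10) ^ (a + b) * avg (\<lambda>u. q a u * q b u) else 0) = 0"
    by (intro sum.neutral ballI) auto
  have "11 / 10 \<le> (2 * D + (11 / 10) ^ 4)\<^sup>2 / (4 * (real D * (real D + 1))) + (11 / 10) ^ Suc 4 / D ^ 4 * ?G"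
    using \<xi>_generating[of "11 / 10" 4 8] t len unfolding p by simp
  moreover have "D = 6 \<or> D = 7 \<or> D = 8 \<or> D = 9 \<or> D = 10" using D D_ge by auto
  ultimately show False by (elim disjE) (simp_all add: power_divide)
qed

lemma weight_8_le_28:
  assumes len: "8 \<le> len" and D: "11 \<le> D" "D \<le> 28" shows "((real D - 1) / 4) ^ (8 - 1) \<le> weight 8"
proof (rule ccontr)
  let ?G = "((real D - 1) / 4) ^ 7"
  assume "\<not> ?thesis"
  then have w: "weight 8 \<le> ?G" by simp
  have "2 * (\<Sum>n = Suc 5..8. (6 / 5) ^ n * \<xi> n) \<le> (6 / 5) ^ Suc 5 / D ^ 5 * weight 8"
    using D_ge' by (intro tail_le_weight) auto
  also have "\<dots> \<le> (6 / 5) ^ Suc 5 / D ^ 5 * ?G" using w by (intro mult_left_mono) auto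
  finally have t: "2 * (\<Sum>n = Suc 5..8. (6 / 5) ^ n * \<xi> n) \<le> (6 / 5) ^ Suc 5 / D ^ 5 * ?G" .
  have chain: "avg (\<lambda>u. (q a u)\<^sup>2) \<le> 2 * \<xi> 8 + 2 * \<xi> 6 / D + \<xi> a / D ^ 2" if "4 \<le> a" for a
    using avg_q_square_le[of 2 4 a] that len by (simp add: numeral_2_eq_2)
  have s: "{1..8} = {1, 2, 3, 4, 5, 6, 7, 8 :: nat}" by auto
  \<comment> \<open>The negated claim as a budget, charged at the three lengths that enter the
    second moments of \<open>q 4\<close> and \<open>q 5\<close>.\<close>
  have bud: "real D ^ 4 * (2 * \<xi> 5) + real D ^ 5 * (2 * \<xi> 6) + real D ^ 7 * (2 * \<xi> 8) \<le> ?G"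
  proof -
    have "(\<Sum>n\<in>{5, 6, 8}. real D ^ (n - 1) * (2 * \<xi> n)) \<le> weight 8"
      unfolding weight_def using \<xi>_nonneg by (intro sum_mono2) auto
    then show ?thesis using w by simp
  qed
  have bud8: "2 * \<xi> 8 + 2 * \<xi> 6 / D + \<xi> 5 / D ^ 2 \<le> ?G / D ^ 6"
  proof -
    have "(2 * \<xi> 8 + 2 * \<xi> 6 / D + \<xi> 5 / D ^ 2) * D ^ 6 = real D ^ 6 * (2 * \<xi> 8) + real D ^ 5 * (2 * \<xi> 6) + real D ^ 4 * \<xi> 5"
      using D_pos by (simp add: eval_nat_numeral field_simps)
    also have "\<dots> \<le> real D ^ 7 * (2 * \<xi> 8) + real D ^ 5 * (2 * \<xi> 6) + real D ^ 4 * (2 * \<xi> 5)"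
      using D_ge' \<xi>_nonneg by (intro add_mono mult_mono power_increasing) auto
    finally show ?thesis using bud D_pos by (simp add: pos_le_divide_eq)
  qed
  have B5: "avg (\<lambda>u. (q 5 u)\<^sup>2) \<le> ?G / D ^ 6" using chain[of 5] bud8 by simp
  have B4: "avg (\<lambda>u. (q 4 u)\<^sup>2) \<le> ?G / D ^ 6 + 1 / (2 * D ^ 2)"
  proof -
    have "\<xi> 4 / D ^ 2 \<le> (1 / 2) / D ^ 2" using \<xi>_le_half[of 4] len by (intro divide_right_mono) auto
    moreover have "0 \<le> \<xi> 5 / D ^ 2" using \<xi>_nonneg by simp
    ultimately show ?thesis using chain[of 4] bud8 by simp
  qed
  note P45 = avg_mult_le_mean[OF B4 B5]
  have e: "{1..5} = {1, 2, 3, 4, 5 :: nat}" by auto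
  have "(\<Sum>a = 1..5. \<Sum>b = 1..5. if 8 < a + b then (6 / 5) ^ (a + b) * avg (\<lambda>u. q a u * q b u) else 0)
    = (6 / 5) ^ 9 * (2 * avg (\<lambda>u. q 4 u * q 5 u)) + (6 / 5) ^ 10 * avg (\<lambda>u. (q 5 u)\<^sup>2)"
    unfolding e by (simp add: avg_commute[of "q 5" "q 4"] power2_eq_square)
  also have "\<dots> \<le> (6 / 5) ^ 9 * (?G / D ^ 6 + 1 / (2 * D ^ 2) + ?G / D ^ 6) + (6 / 5) ^ 10 * (?G / D ^ 6)"
    using P45 B5 by (intro add_mono mult_left_mono) auto
  finally have "\<kappa> * (\<Sum>a = 1..5. \<Sum>b = 1..5. if 8 < a + b then (6 / 5) ^ (a + b) * avg (\<lambda>u. q a u * q b u) else 0)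
    \<le> (real D + 1) / D * ((6 / 5) ^ 9 * (?G / D ^ 6 + 1 / (2 * D ^ 2) + ?G / D ^ 6) + (6 / 5) ^ 10 * (?G / D ^ 6))"
    unfolding \<kappa>_def by (intro mult_left_mono) auto
  then have "6 / 5 \<le> (2 * D + (6 / 5) ^ 5)\<^sup>2 / (4 * (real D * (real D + 1))) + (6 / 5) ^ Suc 5 / D ^ 5 * ?G
    + (real D + 1) / D * ((6 / 5) ^ 9 * (?G / D ^ 6 + 1 / (2 * D ^ 2) + ?G / D ^ 6) + (6 / 5) ^ 10 * (?G / D ^ 6))"
    using \<xi>_generating[of "6 / 5" 5 8] t len by simp
  moreover have "D = 11 \<or> D = 12 \<or> D = 13 \<or> D = 14 \<or> D = 15 \<or> D = 16 \<or> D = 17 \<or> D = 18 \<or> D = 19 \<or> D = 20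
    \<or> D = 21 \<or> D = 22 \<or> D = 23 \<or> D = 24 \<or> D = 25 \<or> D = 26 \<or> D = 27 \<or> D = 28" using D by presburger
  ultimately show False by (elim disjE) (simp_all add: power_divide)
qed

text \<open>Written as 1 plus a fraction, the main term is seen to decrease in \<open>D\<close>, so
  a whole range of \<open>D\<close> is handled at its lower end \<open>n\<close>.\<close>

lemma generating_main_term_le:
  fixes w :: real
  assumes "real n \<le> D" "1 \<le> w" and that: "0 < n"
  shows "(2 * D + w)\<^sup>2 / (4 * (real D * (real D + 1))) \<le> 1 + ((w - 1) + w\<^sup>2 / (4 * real n)) / (real n + 1)"
    (is "?l \<le> _")
proof -
  have "?l = 1 + ((w - 1) + w\<^sup>2 / (4 * real D)) / (real D + 1)"
    using D_pos by (simp add: divide_simps add_nonneg_eq_0_iff) (simp add: power2_eq_square algebra_simps)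
  also have "\<dots> \<le> 1 + ((w - 1) + w\<^sup>2 / (4 * real n)) / (real n + 1)"
    using assms that by (intro add_left_mono frac_le add_nonneg_nonneg divide_left_mono add_mono) auto
  finally show ?thesis .
qed

text \<open>The generating inequality with \<open>c = 6\<close> under the negated claim.
  \<open>E\<close> bounds the normalised budget, \<open>s\<close> every \<open>\<xi> a\<close> with
  \<open>a \<ge> 4\<close>, \<open>B6\<close> and \<open>Q3\<close> the second moments of
  \<open>q 6\<close> and \<open>q 3\<close>, \<open>r\<close> the mixed moment of these two, and
  \<open>X7\<close> the value \<open>2 * \<xi> 7\<close>. The alternatives are there because the
  bounds with a power of \<open>D\<close> win only for moderate \<open>D\<close>.\<close>

lemma weight_8_range:
  fixes D1 :: nat and E k s r B6 Q3 X7 :: real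
  assumes len: "8 \<le> len" and w: "weight 8 \<le> ((real D - 1) / 4) ^ 7"
    and D1: "0 < D1" "D1 \<le> D" and k: "k = 1 / D1"
    and E: "((real D - 1) / (4 * real D)) ^ 7 \<le> E" and s: "0 < s" "E + s * k \<le> s\<^sup>2"
    and B6: "B6 = s\<^sup>2 \<or> E * (1 + D / 2) \<le> B6" and Q3: "Q3 = 2 / 5 \<or> E * D ^ 2 + 2 / 5 * k \<le> Q3"
    and r: "0 \<le> r" "Q3 * B6 \<le> r\<^sup>2" and X7: "X7 = 2 * s \<or> E * D \<le> X7"
    and z: "z = 28 / 25"
  shows "z \<le> 1 + (z ^ 6 - 1 + (z ^ 6)\<^sup>2 / (4 * real D1)) / (real D1 + 1) + z ^ 7 * X7 + z ^ 8 * E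
    + (1 + k) * (2 * z ^ 9 * (r + s\<^sup>2) + z ^ 10 * (2 * s\<^sup>2 + B6) + z ^ 11 * (s\<^sup>2 + B6) + z ^ 12 * B6)"
proof -
  have k': "1 / real D \<le> k" "0 < k" using D1 by (auto simp: k divide_left_mono)
  define F where "F = ((real D - 1) / (4 * real D)) ^ 7"
  have FE: "F \<le> E" using E by (simp add: F_def)
  have E0: "0 \<le> E" using FE D_ge' by (auto simp: F_def intro: order_trans[rotated])
  have G: "((real D - 1) / 4) ^ 7 = F * D ^ 7" using D_pos by (simp add: F_def power_divide power_mult_distrib)
  have bud: "2 * \<xi> n * real D ^ (n - 1) \<le> E * D ^ 7" if "1 \<le> n" "n \<le> 8" for n
  proof -
    have "2 * \<xi> n * real D ^ (n - 1) \<le> F * D ^ 7"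
      using \<xi>_le_weight[OF that] w unfolding G by (simp add: mult.commute)
    also have "\<dots> \<le> E * D ^ 7" using FE by (intro mult_right_mono) auto
    finally show ?thesis .
  qed
  have x8: "2 * \<xi> 8 \<le> E" using bud[of 8] D_pos by simp
  have x7: "2 * \<xi> 7 \<le> E * D"
  proof -
    have "(2 * \<xi> 7) * real D ^ 6 \<le> (E * D) * real D ^ 6" using bud[of 7] by (simp add: eval_nat_numeral ac_simps)
    then show ?thesis using D_pos by simp
  qed
  have x6: "2 * \<xi> 6 \<le> E * D ^ 2"
  proof -
    have "(2 * \<xi> 6) * real D ^ 5 \<le> (E * D ^ 2) * real D ^ 5" using bud[of 6] by (simp add: eval_nat_numeral ac_simps)
    then show ?thesis using D_pos by simp
  qed
  have chain: "avg (\<lambda>u. (q a u)\<^sup>2) \<le> 2 * \<xi> 8 + \<xi> a / D" if "4 \<le> a" for a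
    using avg_q_square_le[of 1 4 a] that len by simp
  have ak: "\<xi> a / D \<le> \<xi> a * k" for a
    using mult_left_mono[OF k'(1) \<xi>_nonneg[of a]] by simp
  \<comment> \<open>\<open>\<xi> a\<close> occurs on both sides: its square is at most the second
    moment, which is at most \<open>E + \<xi> a * k\<close>.\<close>
  have xs: "\<xi> a \<le> s" if "4 \<le> a" for a
    by (rule le_of_square_le[of _ E k]) (use chain[OF that] \<xi>_square_le[of a] x8 ak[of a] s E0 k' in auto)
  have B: "avg (\<lambda>u. (q a u)\<^sup>2) \<le> s\<^sup>2" if "4 \<le> a" for a
    using chain[OF that] x8 ak[of a] mult_right_mono[OF xs[OF that], of k] s(2) k'(2) by linarith
  have b6: "avg (\<lambda>u. (q 6 u)\<^sup>2) \<le> B6"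
  proof -
    have "\<xi> 6 / D \<le> (E * D ^ 2 / 2) / D" using x6 by (intro divide_right_mono) auto
    also have "\<dots> = E * (D / 2)" using D_pos by (simp add: power2_eq_square)
    finally have "avg (\<lambda>u. (q 6 u)\<^sup>2) \<le> E * (1 + D / 2)" using chain[of 6] x8 by (simp add: algebra_simps)
    then show ?thesis using B6 B[of 6] by auto
  qed
  have q3: "avg (\<lambda>u. (q 3 u)\<^sup>2) \<le> Q3"
  proof -
    have "\<xi> 3 / D \<le> 2 / 5 * k" using ak[of 3] mult_right_mono[OF \<xi>_3_le, of k] k' len by linarith
    moreover have "avg (\<lambda>u. (q 3 u)\<^sup>2) \<le> 2 * \<xi> 6 + \<xi> 3 / D"
      using avg_q_square_le[of 1 3 3] len by simp
    ultimately have "avg (\<lambda>u. (q 3 u)\<^sup>2) \<le> E * D ^ 2 + 2 / 5 * k" using x6 by linarith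
    moreover have "avg (\<lambda>u. (q 3 u)\<^sup>2) \<le> 2 / 5" using avg_q_square_le_\<xi>[of 3] \<xi>_3_le len by simp
    ultimately show ?thesis using Q3 by auto
  qed
  have x7': "2 * \<xi> 7 \<le> X7" using X7 x7 xs[of 7] by auto
  have P36: "avg (\<lambda>u. q 3 u * q 6 u) \<le> r"
    using avg_mult_le[OF q3 b6] real_le_lsqrt[of r "Q3 * B6"] r real_sqrt_le_mono[OF r(2)] by simp
  have P45: "avg (\<lambda>u. q 4 u * q 5 u) \<le> s\<^sup>2" using avg_mult_le_mean[OF B[of 4] B[of 5]] by simp
  have P46: "2 * avg (\<lambda>u. q 4 u * q 6 u) \<le> s\<^sup>2 + B6" using avg_mult_le_mean[OF B[of 4] b6] by simp
  have P56: "2 * avg (\<lambda>u. q 5 u * q 6 u) \<le> s\<^sup>2 + B6" using avg_mult_le_mean[OF B[of 5] b6] by simp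
  have e: "{1..6} = {1, 2, 3, 4, 5, 6 :: nat}" by auto
  have z0: "0 \<le> z" by (simp add: z)
  have "(\<Sum>a = 1..6. \<Sum>b = 1..6. if 8 < a + b then z ^ (a + b) * avg (\<lambda>u. q a u * q b u) else 0)
    = z ^ 9 * (2 * avg (\<lambda>u. q 3 u * q 6 u)) + z ^ 9 * (2 * avg (\<lambda>u. q 4 u * q 5 u))
      + z ^ 10 * (2 * avg (\<lambda>u. q 4 u * q 6 u)) + z ^ 10 * avg (\<lambda>u. (q 5 u)\<^sup>2)
      + z ^ 11 * (2 * avg (\<lambda>u. q 5 u * q 6 u)) + z ^ 12 * avg (\<lambda>u. (q 6 u)\<^sup>2)"
    unfolding e by (simp add: avg_commute[of "q 6" "q 3"] avg_commute[of "q 6" "q 4"] avg_commute[of "q 6" "q 5"]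
        avg_commute[of "q 5" "q 4"] power2_eq_square)
  also have "\<dots> \<le> z ^ 9 * (2 * r) + z ^ 9 * (2 * s\<^sup>2)
      + z ^ 10 * (s\<^sup>2 + B6) + z ^ 10 * s\<^sup>2 + z ^ 11 * (s\<^sup>2 + B6) + z ^ 12 * B6"
    using P36 P45 P46 P56 B[of 5] b6 z0 by (intro add_mono mult_left_mono) auto
  also have "\<dots> = 2 * z ^ 9 * (r + s\<^sup>2) + z ^ 10 * (2 * s\<^sup>2 + B6) + z ^ 11 * (s\<^sup>2 + B6) + z ^ 12 * B6"
    by (simp add: algebra_simps)
  finally have pairs: "(\<Sum>a = 1..6. \<Sum>b = 1..6. if 8 < a + b then z ^ (a + b) * avg (\<lambda>u. q a u * q b u) else 0)
    \<le> 2 * z ^ 9 * (r + s\<^sup>2) + z ^ 10 * (2 * s\<^sup>2 + B6) + z ^ 11 * (s\<^sup>2 + B6) + z ^ 12 * B6" .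
  have "0 \<le> B6" using b6 avg_nonneg[of "\<lambda>u. (q 6 u)\<^sup>2"] by (meson order_trans zero_le_power2)
  then have "\<kappa> * (\<Sum>a = 1..6. \<Sum>b = 1..6. if 8 < a + b then z ^ (a + b) * avg (\<lambda>u. q a u * q b u) else 0)
    \<le> (1 + k) * (2 * z ^ 9 * (r + s\<^sup>2) + z ^ 10 * (2 * s\<^sup>2 + B6) + z ^ 11 * (s\<^sup>2 + B6) + z ^ 12 * B6)"
    using pairs k' r(1) z0 D_pos unfolding \<kappa>_eq
    by (intro mult_mono') (auto intro!: sum_nonneg avg_nonneg mult_nonneg_nonneg q_nonneg add_nonneg_nonneg)
  moreover have "2 * (\<Sum>n = Suc 6..8. z ^ n * \<xi> n) \<le> z ^ 7 * X7 + z ^ 8 * E"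
  proof -
    have "{Suc 6..8} = {7, 8 :: nat}" by auto
    then have "2 * (\<Sum>n = Suc 6..8. z ^ n * \<xi> n) = z ^ 7 * (2 * \<xi> 7) + z ^ 8 * (2 * \<xi> 8)" by simp
    also have "\<dots> \<le> z ^ 7 * X7 + z ^ 8 * E" using x7' x8 z0 by (intro add_mono mult_left_mono) auto
    finally show ?thesis .
  qed
  moreover have "(2 * D + z ^ 6)\<^sup>2 / (4 * (real D * (real D + 1))) \<le> 1 + (z ^ 6 - 1 + (z ^ 6)\<^sup>2 / (4 * real D1)) / (real D1 + 1)"
    using D1 by (intro generating_main_term_le) (auto simp: z)
  ultimately show ?thesis using \<xi>_generating[of z 6 8] len z by linarith
qed

lemma ratio_le: "D \<le> D2 \<Longrightarrow> ((real D - 1) / (4 * real D)) ^ j \<le> ((real D2 - 1) / (4 * real D2)) ^ j"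
  using D_ge' by (intro power_mono) (auto simp: divide_simps algebra_simps)

lemma ratio_le_quarter: "((real D - 1) / (4 * real D)) ^ j \<le> (1 / 4) ^ j"
  using D_ge' by (intro power_mono) (auto simp: divide_simps)

lemma weight_8:
  assumes len: "8 \<le> len" shows "((real D - 1) / 4) ^ (8 - 1) \<le> weight 8"
proof (rule ccontr)
  assume n: "\<not> ?thesis"
  then have w: "weight 8 \<le> ((real D - 1) / 4) ^ 7" by simp
  have "\<not> D \<le> 10" "\<not> (11 \<le> D \<and> D \<le> 28)" using n weight_8_le_10[OF len] weight_8_le_28[OF len] by blast+
  then consider "29 \<le> D" "D \<le> 35" | "36 \<le> D" "D \<le> 48" | "49 \<le> D" "D \<le> 72" | "73 \<le> D" "D \<le> 200" | "201 \<le> D"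
    by linarith
  then show False
  proof cases
    case 1
    \<comment> \<open>In each bounded range \<open>k\<close> and the main term are taken at the
      lower end, while \<open>E\<close> and the powers of \<open>D\<close> are taken at the upper
      end; \<open>s\<close> and \<open>r\<close> are roots rounded up.\<close>
    have E: "((real D - 1) / (4 * real D)) ^ 7 \<le> 4983 / 100000000"
      using ratio_le[OF 1(2), of 7] by (rule order_trans) (simp add: power_divide)
    have "real D \<le> 35" using 1 by simp
    moreover from this have "(real D)\<^sup>2 \<le> 35\<^sup>2" by (intro power_mono) simp_all
    ultimately show False
      using weight_8_range[OF len w, of 29 "1 / 29" "4983 / 100000000" "897 / 25000"
          "4983 / 100000000 * (1 + 35 / 2)" "4983 / 100000000 * 35 ^ 2 + 2 / 5 * (1 / 29)" "4153 / 500000" "4983 / 100000000 * 35" "28 / 25"] 1 E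
      by (simp add: power_divide)
  next
    case 2
    have E: "((real D - 1) / (4 * real D)) ^ 7 \<le> 1317 / 25000000"
      using ratio_le[OF 2(2), of 7] by (rule order_trans) (simp add: power_divide)
    have "real D \<le> 48" using 2 by simp
    moreover from this have "(real D)\<^sup>2 \<le> 48\<^sup>2" by (intro power_mono) simp_all
    ultimately show False
      using weight_8_range[OF len w, of 36 "1 / 36" "1317 / 25000000" "2957 / 100000"
          "(2957 / 100000)\<^sup>2" "1317 / 25000000 * 48 ^ 2 + 2 / 5 * (1 / 36)" "1077 / 100000" "1317 / 25000000 * 48" "28 / 25"] 2 E
      by (simp add: power_divide)
  next
    case 3
    have E: "((real D - 1) / (4 * real D)) ^ 7 \<le> 1107 / 20000000"
      using ratio_le[OF 3(2), of 7] by (rule order_trans) (simp add: power_divide)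
    have "real D \<le> 72" using 3 by simp
    moreover from this have "(real D)\<^sup>2 \<le> 72\<^sup>2" by (intro power_mono) simp_all
    ultimately show False
      using weight_8_range[OF len w, of 49 "1 / 49" "1107 / 20000000" "571 / 25000"
          "(571 / 25000)\<^sup>2" "1107 / 20000000 * 72 ^ 2 + 2 / 5 * (1 / 49)" "1241 / 100000" "1107 / 20000000 * 72" "28 / 25"] 3 E
      by (simp add: power_divide)
  next
    case 4
    have E: "((real D - 1) / (4 * real D)) ^ 7 \<le> 2947 / 50000000"
      using ratio_le[OF 4(2), of 7] by (rule order_trans) (simp add: power_divide)
    have "real D \<le> 200" using 4 by auto
    then show False
      using weight_8_range[OF len w, of 73 "1 / 73" "2947 / 50000000" "857 / 50000"
          "(857 / 50000)\<^sup>2" "2 / 5" "217 / 20000" "2947 / 50000000 * 200" "28 / 25"] 4 E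
      by (simp add: power_divide)
  next
    case 5
    have E: "((real D - 1) / (4 * real D)) ^ 7 \<le> 1 / 16384"
      using ratio_le_quarter[of 7] by (rule order_trans) (simp add: power_divide)
    show False
      using weight_8_range[OF len w, of 201 "1 / 201" "1 / 16384" "1069 / 100000"
          "(1069 / 100000)\<^sup>2" "2 / 5" "3381 / 500000" "2 * (1069 / 100000)" "28 / 25"] 5 E
      by (simp add: power_divide)
  qed
qed


section \<open>Radius 16\<close>

text \<open>All branching terms are absorbed into one weight; the worst of them,
  \<open>k = K - 1\<close>, costs \<open>D ^ (K - 1)\<close>. Increasing \<open>K\<close> thus
  trades a larger first term for a smaller second one.\<close>

lemma avg_q_square_le_weight:
  assumes "1 \<le> K" "K \<le> m" "m \<le> a" "2 * m \<le> len"
  shows "avg (\<lambda>u. (q a u)\<^sup>2) \<le> real D ^ (K - 1) / real D ^ (2 * m - 1) * weight (2 * m) + \<xi> a / D ^ K"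
proof -
  have "(\<Sum>k<K. 2 * \<xi> (2 * (m - k)) / D ^ k)
    \<le> (\<Sum>k<K. real D ^ (K - 1) / real D ^ (2 * m - 1) * (real D ^ (2 * (m - k) - 1) * (2 * \<xi> (2 * (m - k)))))"
  proof (rule sum_mono)
    fix k assume k: "k \<in> {..<K}"
    have "real D ^ (2 * m - 1) \<le> real D ^ ((K - 1) + (2 * (m - k) - 1) + k)"
      using k assms D_ge' by (intro power_increasing) auto
    then have "1 / real D ^ k \<le> real D ^ (K - 1) / real D ^ (2 * m - 1) * real D ^ (2 * (m - k) - 1)"
      using D_pos by (simp add: power_add field_simps)
    then have "1 / real D ^ k * (2 * \<xi> (2 * (m - k)))
      \<le> real D ^ (K - 1) / real D ^ (2 * m - 1) * real D ^ (2 * (m - k) - 1) * (2 * \<xi> (2 * (m - k)))"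
      using \<xi>_nonneg by (intro mult_right_mono) auto
    then show "2 * \<xi> (2 * (m - k)) / D ^ k
      \<le> real D ^ (K - 1) / real D ^ (2 * m - 1) * (real D ^ (2 * (m - k) - 1) * (2 * \<xi> (2 * (m - k))))"
      by (simp only: mult.assoc) simp
  qed
  also have "\<dots> = real D ^ (K - 1) / real D ^ (2 * m - 1) * (\<Sum>k<K. real D ^ (2 * (m - k) - 1) * (2 * \<xi> (2 * (m - k))))"
    by (simp only: sum_distrib_left)
  also have "\<dots> \<le> real D ^ (K - 1) / real D ^ (2 * m - 1) * weight (2 * m)"
  proof (rule mult_left_mono)
    have inj: "inj_on (\<lambda>k. 2 * (m - k)) {..<K}" using assms(2) by (auto simp: inj_on_def)
    have "(\<Sum>k<K. real D ^ (2 * (m - k) - 1) * (2 * \<xi> (2 * (m - k))))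
      = (\<Sum>n\<in>(\<lambda>k. 2 * (m - k)) ` {..<K}. real D ^ (n - 1) * (2 * \<xi> n))"
      by (simp add: sum.reindex[OF inj])
    also have "\<dots> \<le> weight (2 * m)"
      unfolding weight_def using assms \<xi>_nonneg by (intro sum_mono2) auto
    finally show "(\<Sum>k<K. real D ^ (2 * (m - k) - 1) * (2 * \<xi> (2 * (m - k)))) \<le> weight (2 * m)" .
  qed simp
  finally show ?thesis using avg_q_square_le[OF assms] by linarith
qed

text \<open>Walks of length 8 that end in their minimum have density at least \<open>1 / 17\<close>.
  The negated claim bounds the good paths glued from their pairs by \<open>4 * ?G / D ^ 8\<close>,
  which is too little for these \<open>D\<close>.\<close>

lemma weight_16_le_9:
  assumes len: "16 \<le> len" and D: "D \<le> 9" shows "((real D - 1) / 4) ^ (16 - 1) \<le> weight 16"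
proof (rule ccontr)
  let ?G = "((real D - 1) / 4) ^ 15"
  assume "\<not> ?thesis"
  then have w: "weight 16 \<le> ?G" by simp
  obtain t where t: "1 / (2 * real 8 + 1) \<le> t"
    and rec: "\<kappa> * t\<^sup>2 - t / D ^ 2 \<le> 4 * (\<Sum>k<2. (\<Sum>s = Suc k..8. \<xi> (8 + s - 2 * k)) / D ^ k)"
    by (rule \<xi>_record[of 8 2]) (use len in auto)
  have sh: "(\<Sum>s = Suc k..8. \<xi> (8 + s - 2 * k)) / D ^ k \<le> ?G / (2 * real D ^ 8)" if "k \<le> 1" for k
  proof -
    \<comment> \<open>The glued lengths run from \<open>9 - k\<close> to \<open>16 - 2 * k\<close>,
      so they form a tail beyond \<open>8 - k\<close>.\<close>
    have "(\<Sum>s = Suc k..8. \<xi> (8 + s - 2 * k)) = (\<Sum>n = Suc (8 - k)..16 - 2 * k. \<xi> n)"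
      by (rule sum.reindex_bij_witness[of _ "\<lambda>n. n + 2 * k - 8" "\<lambda>s. 8 + s - 2 * k"]) (use that in auto)
    also have "2 * \<dots> \<le> 1 / D ^ (8 - k) * weight 16"
      using tail_le_weight[of 1 "16 - 2 * k" 16 "8 - k"] D_ge' that by simp
    also have "\<dots> \<le> 1 / D ^ (8 - k) * ?G" using w by (intro mult_left_mono) auto
    finally have "2 * (\<Sum>s = Suc k..8. \<xi> (8 + s - 2 * k)) / D ^ k \<le> 1 / D ^ (8 - k) * ?G / D ^ k"
      by (intro divide_right_mono) auto
    also have "\<dots> = ?G / real D ^ 8"
      using that D_pos by (simp add: power_add[symmetric])
    finally show ?thesis by simp
  qed
  have "(1 / 17) * (\<kappa> * (1 / 17) - 1 / D ^ 2) \<le> t * (\<kappa> * t - 1 / D ^ 2)"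
  proof (rule mult_mono)
    have "1 / real D ^ 2 \<le> 1 / 6 ^ 2" using D_ge' by (intro divide_left_mono power_mono) auto
    moreover have "1 * (1 / 17) \<le> \<kappa> * (1 / 17)" using D_pos by (intro mult_right_mono) (auto simp: \<kappa>_eq)
    ultimately show "0 \<le> \<kappa> * (1 / 17) - 1 / D ^ 2" by simp
    show "\<kappa> * (1 / 17) - 1 / D ^ 2 \<le> \<kappa> * t - 1 / D ^ 2"
      using t D_pos by (intro diff_right_mono mult_left_mono) (auto simp: \<kappa>_eq)
  qed (use t in auto)
  also have "t * (\<kappa> * t - 1 / D ^ 2) = \<kappa> * t\<^sup>2 - t / D ^ 2" by (simp add: power2_eq_square algebra_simps)
  also note rec
  also have "4 * (\<Sum>k<2. (\<Sum>s = Suc k..8. \<xi> (8 + s - 2 * k)) / D ^ k) \<le> 4 * (\<Sum>k<(2::nat). ?G / (2 * real D ^ 8))"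
    by (intro mult_left_mono sum_mono sh) auto
  also have "\<dots> = 4 * ?G / D ^ 8" by simp
  finally have "(1 / 17) * ((real D + 1) / D * (1 / 17) - 1 / D ^ 2) \<le> 4 * ?G / D ^ 8"
    unfolding \<kappa>_def .
  moreover have "D = 6 \<or> D = 7 \<or> D = 8 \<or> D = 9" using D D_ge by auto
  ultimately show False by (elim disjE) (simp_all add: power_divide)
qed

text \<open>The second moment bound with \<open>m = 8\<close> applies to every length from 8 on, so
  the budget yields one bound \<open>y\<close> for all these densities.\<close>

lemma \<xi>_le_of_weight_16:
  fixes e k y :: real
  assumes len: "16 \<le> len" and w: "weight 16 \<le> ((real D - 1) / 4) ^ 15" and K: "1 \<le> K" "K \<le> 8"
    and e: "((real D - 1) / (4 * real D)) ^ 15 * real D ^ (K - 1) \<le> e" and k: "1 / real D ^ K \<le> k"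
    and y: "0 < y" "e + y * k \<le> y\<^sup>2" and a: "8 \<le> a"
  shows "\<xi> a \<le> y"
proof (rule le_of_square_le[OF _ y(2,1)])
  have "real D ^ (K - 1) / real D ^ 15 * weight 16 \<le> real D ^ (K - 1) / real D ^ 15 * ((real D - 1) / 4) ^ 15"
    using w by (intro mult_left_mono) auto
  also have "\<dots> = ((real D - 1) / (4 * real D)) ^ 15 * real D ^ (K - 1)"
    by (simp add: power_divide power_mult_distrib mult.commute)
  finally have "real D ^ (K - 1) / real D ^ 15 * weight 16 \<le> e" using e by linarith
  moreover have "\<xi> a / real D ^ K \<le> \<xi> a * k" using mult_left_mono[OF k \<xi>_nonneg[of a]] by simp
  moreover have "(\<xi> a)\<^sup>2 \<le> real D ^ (K - 1) / real D ^ 15 * weight 16 + \<xi> a / real D ^ K"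
    using order_trans[OF \<xi>_square_le avg_q_square_le_weight[of K 8 a]] K a len by simp
  ultimately show "(\<xi> a)\<^sup>2 \<le> e + \<xi> a * k" by linarith
  have "0 \<le> ((real D - 1) / (4 * real D)) ^ 15 * real D ^ (K - 1)" using D_ge' by simp
  then show "0 \<le> e" using e by linarith
  have "0 \<le> 1 / real D ^ K" by simp
  then show "0 \<le> k" using k by linarith
qed

text \<open>The range \<open>M = 14\<close> is twice the cut-off \<open>c = 7\<close>, so no pair
  lies beyond the recursion.\<close>

lemma generating_14:
  fixes z :: real
  assumes "14 \<le> len" "1 \<le> z"
  shows "z \<le> (2 * D + z ^ 7)\<^sup>2 / (4 * (real D * (real D + 1))) + 2 * (\<Sum>n = Suc 7..14. z ^ n * \<xi> n)"
proof -
  have "(\<Sum>a = 1..7. \<Sum>b = 1..7. if 14 < a + b then z ^ (a + b) * avg (\<lambda>u. q a u * q b u) else 0) = 0"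
    by (intro sum.neutral ballI) auto
  then show ?thesis using \<xi>_generating[of z 7 14] assms by simp
qed

text \<open>Lengths 8 and 9 are charged to the uniform bound \<open>y\<close>, while lengths 10 to
  14 share the single budget.\<close>

lemma weight_16_le_13:
  fixes z y :: real
  assumes len: "16 \<le> len" and w: "weight 16 \<le> ((real D - 1) / 4) ^ 15"
    and y: "0 < y" "((real D - 1) / (4 * real D)) ^ 15 * real D ^ 2 + y * (1 / real D ^ 3) \<le> y\<^sup>2"
    and z: "1 \<le> z" "z \<le> D"
  shows "z \<le> (2 * D + z ^ 7)\<^sup>2 / (4 * (real D * (real D + 1))) + 2 * (z ^ 8 + z ^ 9) * y
    + z ^ 10 / D ^ 9 * ((real D - 1) / 4) ^ 15"
proof -
  have x: "\<xi> n \<le> y" if "8 \<le> n" for n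
    by (rule \<xi>_le_of_weight_16[OF len w, of 3, OF _ _ _ _ y(1)]) (use y that in auto)
  have "{Suc 7..14} = {8, 9} \<union> {Suc 9..14 :: nat}" by auto
  then have "(\<Sum>n = Suc 7..14. z ^ n * \<xi> n) = z ^ 8 * \<xi> 8 + z ^ 9 * \<xi> 9 + (\<Sum>n = Suc 9..14. z ^ n * \<xi> n)"
    by (simp add: sum.union_disjoint)
  also have "\<dots> \<le> z ^ 8 * y + z ^ 9 * y + (\<Sum>n = Suc 9..14. z ^ n * \<xi> n)"
    using x z by (intro add_mono mult_left_mono) auto
  finally have "2 * (\<Sum>n = Suc 7..14. z ^ n * \<xi> n) \<le> 2 * (z ^ 8 + z ^ 9) * y + 2 * (\<Sum>n = Suc 9..14. z ^ n * \<xi> n)"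
    by (simp add: algebra_simps)
  also have "2 * (\<Sum>n = Suc 9..14. z ^ n * \<xi> n) \<le> z ^ Suc 9 / D ^ 9 * weight 16"
    using z by (intro tail_le_weight) auto
  also have "\<dots> \<le> z ^ Suc 9 / D ^ 9 * ((real D - 1) / 4) ^ 15" using w z by (intro mult_left_mono) auto
  finally show ?thesis using generating_14[of z] z len by simp
qed

text \<open>All lengths from 8 to 14 are charged to \<open>y\<close>. Smaller \<open>K\<close> is
  chosen for larger \<open>D\<close>, where a few shared steps already make \<open>1 / D ^ K\<close>
  tiny.\<close>

lemma weight_16_range:
  fixes e y z :: real and D1 K :: nat
  assumes len: "16 \<le> len" and w: "weight 16 \<le> ((real D - 1) / 4) ^ 15" and K: "1 \<le> K" "K \<le> 8"
    and D1: "0 < D1" "D1 \<le> D" and e: "((real D - 1) / (4 * real D)) ^ 15 * real D ^ (K - 1) \<le> e"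
    and y: "0 < y" "e + y * (1 / real D1 ^ K) \<le> y\<^sup>2" and z: "z = 28 / 25"
  shows "z \<le> 1 + (z ^ 7 - 1 + (z ^ 7)\<^sup>2 / (4 * real D1)) / (real D1 + 1)
    + 2 * (z ^ 8 + z ^ 9 + z ^ 10 + z ^ 11 + z ^ 12 + z ^ 13 + z ^ 14) * y"
proof -
  have x: "\<xi> n \<le> y" if "8 \<le> n" for n
    by (rule \<xi>_le_of_weight_16[OF len w K e _ y]) (use D1 that in \<open>auto intro!: divide_left_mono power_mono\<close>)
  have "(\<Sum>n = Suc 7..14. z ^ n * \<xi> n) \<le> (\<Sum>n = Suc 7..14. z ^ n * y)"
    using x z by (intro sum_mono mult_left_mono) auto
  also have "\<dots> = (\<Sum>n = Suc 7..14. z ^ n) * y" by (simp only: sum_distrib_right)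
  also have "(\<Sum>n = Suc 7..14. z ^ n) = z ^ 8 + z ^ 9 + z ^ 10 + z ^ 11 + z ^ 12 + z ^ 13 + z ^ 14"
  proof -
    have "{Suc 7..14} = {8, 9, 10, 11, 12, 13, 14 :: nat}" by auto
    then show ?thesis by simp
  qed
  finally have "2 * (\<Sum>n = Suc 7..14. z ^ n * \<xi> n) \<le> 2 * (z ^ 8 + z ^ 9 + z ^ 10 + z ^ 11 + z ^ 12 + z ^ 13 + z ^ 14) * y"
    by argo
  moreover have "(2 * D + z ^ 7)\<^sup>2 / (4 * (real D * (real D + 1))) \<le> 1 + (z ^ 7 - 1 + (z ^ 7)\<^sup>2 / (4 * real D1)) / (real D1 + 1)"
    using D1 by (intro generating_main_term_le) (auto simp: z)
  ultimately show ?thesis using generating_14[of z] len z by linarith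
qed

lemma weight_16:
  assumes len: "16 \<le> len" shows "((real D - 1) / 4) ^ (16 - 1) \<le> weight 16"
proof (rule ccontr)
  assume n: "\<not> ?thesis"
  then have w: "weight 16 \<le> ((real D - 1) / 4) ^ 15" by simp
  have "\<not> D \<le> 9" using n weight_16_le_9[OF len] by blast
  then consider "D = 10" | "D = 11" | "D = 12" | "D = 13" | "14 \<le> D" "D \<le> 18" | "19 \<le> D" "D \<le> 28"
    | "29 \<le> D" "D \<le> 40" | "41 \<le> D" "D \<le> 1000" | "1001 \<le> D"
    by linarith
  then show False
  proof cases
    case 1
    show False using weight_16_le_13[OF len w, of "51 / 50000" "53 / 50"] 1 by (simp add: power_divide)
  next
    case 2
    show False using weight_16_le_13[OF len w, of "393 / 500000" "27 / 25"] 2 by (simp add: power_divide)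
  next
    case 3
    show False using weight_16_le_13[OF len w, of "159 / 250000" "28 / 25"] 3 by (simp add: power_divide)
  next
    case 4
    show False using weight_16_le_13[OF len w, of "543 / 1000000" "28 / 25"] 4 by (simp add: power_divide)
  next
    case 5
    have "((real D - 1) / (4 * real D)) ^ 15 * real D ^ 2 \<le> ((real 18 - 1) / (4 * real 18)) ^ 15 * 18 ^ 2"
      by (rule mult_mono[OF ratio_le[OF 5(2)] power_mono]) (use 5 in auto)
    also have "\<dots> \<le> 129 / 1000000000" by (simp add: power_divide)
    finally show False
      using weight_16_range[OF len w, of 3 14 "129 / 1000000000" "293 / 500000" "28 / 25"] 5
      by (simp add: power_divide)
  next
    case 6
    have "((real D - 1) / (4 * real D)) ^ 15 * real D ^ 2 \<le> ((real 28 - 1) / (4 * real 28)) ^ 15 * 28 ^ 2"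
      by (rule mult_mono[OF ratio_le[OF 6(2)] power_mono]) (use 6 in auto)
    also have "\<dots> \<le> 53 / 125000000" by (simp add: power_divide)
    finally show False
      using weight_16_range[OF len w, of 3 19 "53 / 125000000" "729 / 1000000" "28 / 25"] 6
      by (simp add: power_divide)
  next
    case 7
    have "((real D - 1) / (4 * real D)) ^ 15 * real D ^ 2 \<le> ((real 40 - 1) / (4 * real 40)) ^ 15 * 40 ^ 2"
      by (rule mult_mono[OF ratio_le[OF 7(2)] power_mono]) (use 7 in auto)
    also have "\<dots> \<le> 51 / 50000000" by (simp add: power_divide)
    finally show False
      using weight_16_range[OF len w, of 3 29 "51 / 50000000" "13 / 12500" "28 / 25"] 7
      by (simp add: power_divide)
  next
    case 8
    have "((real D - 1) / (4 * real D)) ^ 15 * real D ^ 1 \<le> ((real 1000 - 1) / (4 * real 1000)) ^ 15 * 1000 ^ 1"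
      by (rule mult_mono[OF ratio_le[OF 8(2)] power_mono]) (use 8 in auto)
    also have "\<dots> \<le> 459 / 500000000" by (simp add: power_divide)
    finally show False
      using weight_16_range[OF len w, of 2 41 "459 / 500000000" "131 / 100000" "28 / 25"] 8
      by (simp add: power_divide)
  next
    case 9
    have "((real D - 1) / (4 * real D)) ^ 15 \<le> (1 / 4) ^ 15" by (rule ratio_le_quarter)
    also have "\<dots> \<le> 233 / 250000000000" by (simp add: power_divide)
    finally show False
      using weight_16_range[OF len w, of 1 1001 "233 / 250000000000" "101 / 100000" "28 / 25"] 9
      by (simp add: power_divide)
  qed
qed

end

section \<open>Radius at least 32\<close>

text \<open>The left side is twice \<open>10 * K + 1\<close>, the reciprocal of the guaranteed
  density \<open>t\<close> of walks of length \<open>5 * K\<close> ending in their minimum. So the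
  error \<open>t / D ^ K\<close> is at most half of \<open>t\<^sup>2\<close>.\<close>

lemma record_length_le_power:
  assumes "4 \<le> K" shows "20 * K + 2 \<le> (6 :: nat) ^ K"
  using assms by (induction K rule: dec_induct) auto

lemma record_density_le_power:
  assumes "4 \<le> K" shows "48 * K * (10 * K + 1) ^ 2 \<le> (4 :: nat) ^ (2 * K + 2)"
  using assms
proof (induction K rule: dec_induct)
  case (step n)
  \<comment> \<open>Bounding the linear factors by their doubles loses a factor 8, against the
    factor 16 gained on the right.\<close>
  have "48 * Suc n * (10 * Suc n + 1) ^ 2 \<le> 48 * (2 * n) * (2 * (10 * n + 1)) ^ 2"
    using step.hyps by (intro mult_le_mono power_mono) auto
  also have "\<dots> = 8 * (48 * n * (10 * n + 1) ^ 2)" by (simp add: power2_eq_square)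
  also have "\<dots> \<le> 16 * 4 ^ (2 * n + 2)" using step.IH by simp
  finally show ?case by simp
qed simp

context nb_graph begin

text \<open>With \<open>m = 5 * K\<close> and branching positions \<open>k < K\<close>, every glued
  length is at least \<open>m + 1 - k\<close>, hence above \<open>4 * K\<close>. If all densities
  there were smaller, \<open>t\<^sup>2 / 2\<close> would be below
  \<open>4 * (5 * K) * (6 / 5)\<close> times the bound, where \<open>6 / 5\<close> comes from a
  geometric series; doubling explains 48.\<close>

lemma exists_large_\<xi>:
  assumes K: "4 \<le> K" and len: "10 * K \<le> len"
  obtains n where "4 * K < n" "1 / (48 * real K * (10 * real K + 1)\<^sup>2) \<le> \<xi> n"
proof (rule ccontr)
  assume no: "\<not> thesis"
  define m where "m = 5 * K"
  define x where "x = 1 / (48 * real K * (10 * real K + 1)\<^sup>2)"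
  note hyp = that
  have small: "\<xi> n < x" if "4 * K < n" for n using no hyp[OF that] unfolding x_def by linarith
  obtain t where t: "1 / (2 * real m + 1) \<le> t"
    and rec: "\<kappa> * t\<^sup>2 - t / D ^ K \<le> 4 * (\<Sum>k<K. (\<Sum>s = Suc k..m. \<xi> (m + s - 2 * k)) / D ^ k)"
    by (rule \<xi>_record[of m K]) (use K len in \<open>auto simp: m_def\<close>)
  have t0: "0 < t" using t by (meson divide_pos_pos less_le_trans of_nat_0_le_iff add_nonneg_pos mult_nonneg_nonneg zero_le_numeral zero_less_one)
  have "(\<Sum>k<K. (\<Sum>s = Suc k..m. \<xi> (m + s - 2 * k)) / D ^ k) < (\<Sum>k<K. m * x / 6 ^ k)"
  proof (rule sum_strict_mono)
    fix k assume k: "k \<in> {..<K}"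
    have "(\<Sum>s = Suc k..m. \<xi> (m + s - 2 * k)) < (\<Sum>s = Suc k..m. x)"
      using k by (intro sum_strict_mono small) (auto simp: m_def)
    also have "\<dots> \<le> m * x" by (auto simp: x_def intro!: divide_right_mono)
    finally have "(\<Sum>s = Suc k..m. \<xi> (m + s - 2 * k)) / D ^ k < m * x / D ^ k"
      using D_pos by (intro divide_strict_right_mono) auto
    also have "\<dots> \<le> m * x / 6 ^ k"
      using power_mono[OF D_ge', of k] D_pos by (intro divide_left_mono) (auto simp: x_def)
    finally show "(\<Sum>s = Suc k..m. \<xi> (m + s - 2 * k)) / D ^ k < m * x / 6 ^ k" .
  qed (use K in \<open>auto simp: lessThan_empty_iff\<close>)
  also have "(\<Sum>k<K. m * x / 6 ^ k) = m * x * (\<Sum>k<K. (1 / 6) ^ k)"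
    by (simp add: sum_distrib_left power_divide)
  also have "\<dots> \<le> m * x * (6 / 5)"
  proof (rule mult_left_mono)
    have "(\<Sum>k<K. (1 / 6 :: real) ^ k) = (1 - (1 / 6) ^ K) / (1 - 1 / 6)" by (subst sum_gp_strict) auto
    then show "(\<Sum>k<K. (1 / 6 :: real) ^ k) \<le> 6 / 5" by simp
  qed (simp add: x_def)
  finally have up: "\<kappa> * t\<^sup>2 - t / D ^ K < 4 * (m * x * (6 / 5))" using rec by linarith
  have mK: "2 * real m + 1 = 10 * real K + 1" by (simp add: m_def)
  have "t / D ^ K \<le> t * (t / 2)"
  proof -
    have "real (20 * K + 2) \<le> real (6 ^ K)" using record_length_le_power[OF K] of_nat_le_iff by blast
    also have "\<dots> \<le> real D ^ K" using D_ge' by (simp add: power_mono)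
    finally have "1 / real D ^ K \<le> 1 / (20 * real K + 2)" using D_pos by (intro divide_left_mono) auto
    also have "\<dots> = (1 / (2 * real m + 1)) / 2" unfolding mK by (simp add: field_simps)
    also have "\<dots> \<le> t / 2" by (rule divide_right_mono[OF t]) simp
    finally have "t * (1 / real D ^ K) \<le> t * (t / 2)" using t0 by (intro mult_left_mono) auto
    then show ?thesis by simp
  qed
  moreover have "1 * t\<^sup>2 \<le> \<kappa> * t\<^sup>2" using D_pos by (intro mult_right_mono) (auto simp: \<kappa>_eq)
  ultimately have "t\<^sup>2 / 2 < 4 * (m * x * (6 / 5))" using up by (simp add: power2_eq_square)
  moreover have "(1 / (10 * real K + 1))\<^sup>2 \<le> t\<^sup>2"
    using t unfolding mK by (intro power_mono) auto
  ultimately have "(1 / (10 * real K + 1))\<^sup>2 < 48 * K * x" unfolding m_def by (simp add: mult_ac)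
  also have "48 * K * x = (1 / (10 * real K + 1))\<^sup>2" using K by (simp add: x_def power_divide)
  finally show False by simp
qed

text \<open>The second moment bound with \<open>m = 4 * K\<close> is used at the least number
  \<open>J\<close> of shared steps for which its last term is at most half of
  \<open>x\<^sup>2\<close>. Minimality keeps \<open>D ^ (J - 1)\<close> at most
  \<open>2 / x\<close>, so only a factor of order \<open>x ^ 3\<close> is lost.\<close>

lemma weight_multiple_8:
  assumes K: "4 \<le> K" and len: "10 * K \<le> len"
  shows "((real D - 1) / 4) ^ (8 * K - 1) \<le> weight (8 * K)"
proof -
  obtain n where n: "4 * K < n" and xn: "1 / (48 * real K * (10 * real K + 1)\<^sup>2) \<le> \<xi> n"
    by (rule exists_large_\<xi>[OF assms])
  define x where "x = \<xi> n"
  have "real (48 * K * (10 * K + 1) ^ 2) \<le> real (4 ^ (2 * K + 2))"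
    using record_density_le_power[OF K] of_nat_le_iff by blast
  then have le: "48 * real K * (10 * real K + 1)\<^sup>2 \<le> 4 ^ (2 * K + 2)" by (simp add: add.commute)
  have "1 / 4 ^ (2 * K + 2) \<le> 1 / (48 * real K * (10 * real K + 1)\<^sup>2)"
    using K le by (intro divide_left_mono mult_pos_pos zero_less_power) auto
  then have x: "1 / 4 ^ (2 * K + 2) \<le> x" using xn by (simp add: x_def)
  have "0 < 1 / (4 :: real) ^ (2 * K + 2)" by simp
  then have x0: "0 < x" using x by linarith
  have x1: "x \<le> 1 / 2" unfolding x_def using \<xi>_le_half n K len by simp
  have big: "2 / x \<le> real D ^ (4 * K)"
  proof -
    have "2 / x \<le> 2 / (1 / 4 ^ (2 * K + 2))" using x x0 by (intro divide_left_mono) auto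
    also have "\<dots> = 32 * 16 ^ K" by (simp add: power_add power_mult)
    also have "\<dots> \<le> 6 ^ K * (6 ^ 2) ^ K"
    proof (rule mult_mono)
      have "real (20 * K + 2) \<le> real (6 ^ K)" using record_length_le_power[OF K] of_nat_le_iff by blast
      then show "32 \<le> (6 :: real) ^ K" using K by simp
      show "(16 :: real) ^ K \<le> (6 ^ 2) ^ K" by (intro power_mono) auto
    qed auto
    also have "\<dots> = 6 ^ (3 * K)" proof -
      have "3 * K = K + 2 * K" by simp
      then show ?thesis by (simp only: power_add power_mult)
    qed
    also have "\<dots> \<le> 6 ^ (4 * K)" by (intro power_increasing) auto
    also have "\<dots> \<le> real D ^ (4 * K)" using D_ge' by (intro power_mono) auto
    finally show ?thesis .
  qed
  define J where "J = (LEAST j. 2 / x \<le> real D ^ j)"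
  have J1: "2 / x \<le> real D ^ J" unfolding J_def by (rule LeastI[of _ "4 * K"]) (rule big)
  have J2: "J \<le> 4 * K" unfolding J_def by (rule Least_le) (rule big)
  have J0: "J \<noteq> 0"
  proof
    assume "J = 0"
    then have "2 \<le> x" using J1 x0 by (simp add: pos_divide_le_eq)
    then show False using x1 by simp
  qed
  have J3: "real D ^ (J - 1) \<le> 2 / x"
    using not_less_Least[of "J - 1" "\<lambda>j. 2 / x \<le> real D ^ j"] J0 by (simp add: J_def)
  have "x\<^sup>2 \<le> real D ^ (J - 1) / real D ^ (8 * K - 1) * weight (8 * K) + x / D ^ J"
    using order_trans[OF \<xi>_square_le avg_q_square_le_weight[of J "4 * K" n]] J0 J2 n len K
    by (simp add: x_def)
  moreover have "x / D ^ J \<le> x\<^sup>2 / 2"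
  proof -
    have "x / D ^ J \<le> x / (2 / x)" using J1 x0 D_pos by (intro divide_left_mono) auto
    then show ?thesis by (simp add: power2_eq_square)
  qed
  ultimately have "x\<^sup>2 / 2 \<le> real D ^ (J - 1) / real D ^ (8 * K - 1) * weight (8 * K)" by linarith
  also have "\<dots> \<le> (2 / x) / real D ^ (8 * K - 1) * weight (8 * K)"
    using J3 \<xi>_nonneg unfolding weight_def by (intro mult_right_mono divide_right_mono sum_nonneg) auto
  finally have "x\<^sup>2 / 2 * (x * real D ^ (8 * K - 1)) \<le> (2 / x) / real D ^ (8 * K - 1) * weight (8 * K) * (x * real D ^ (8 * K - 1))"
    using x0 by (intro mult_right_mono) auto
  then have "x ^ 3 / 4 * real D ^ (8 * K - 1) \<le> weight (8 * K)"
    using x0 D_pos by (simp add: power2_eq_square power3_eq_cube)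
  moreover have "1 / 4 ^ (8 * K - 1) \<le> x ^ 3 / 4"
  proof -
    \<comment> \<open>The exponent on the right is \<open>6 * K + 7\<close>, which is at most
      \<open>8 * K - 1\<close> exactly when \<open>K \<ge> 4\<close>. This is why the method starts
      at radius 32.\<close>
    have "1 / (4 :: real) ^ (8 * K - 1) \<le> 1 / 4 ^ (3 * (2 * K + 2) + 1)"
      using K by (intro divide_left_mono power_increasing) auto
    also have "\<dots> = (1 / 4 ^ (2 * K + 2)) ^ 3 / 4"
    proof -
      have "3 * (2 * K + 2) + 1 = (2 * K + 2) * 3 + 1" by simp
      then have "(4 :: real) ^ (3 * (2 * K + 2) + 1) = (4 ^ (2 * K + 2)) ^ 3 * 4"
        by (simp only: power_add[of _ "(2 * K + 2) * 3"] power_mult[of _ "2 * K + 2" 3] power_one_right)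
      then show ?thesis by (simp only: power_divide power_one divide_divide_eq_left)
    qed
    also have "\<dots> \<le> x ^ 3 / 4" using x by (intro divide_right_mono power_mono) auto
    finally show ?thesis .
  qed
  ultimately have "1 / 4 ^ (8 * K - 1) * real D ^ (8 * K - 1) \<le> weight (8 * K)"
    by (meson mult_right_mono order_trans zero_le_power of_nat_0_le_iff)
  moreover have "((real D - 1) / 4) ^ (8 * K - 1) \<le> (real D / 4) ^ (8 * K - 1)"
    using D_ge' by (intro power_mono) auto
  ultimately show ?thesis by (simp add: power_divide)
qed

theorem weight_power_2:
  assumes "4 * 2 ^ s \<le> len"
  shows "((real D - 1) / 4) ^ (2 ^ s - 1) \<le> weight (2 ^ s)"
proof -
  consider "s = 0" | "s = 1" | "s = 2" | "s = 3" | "s = 4" | "5 \<le> s" by linarith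
  then show ?thesis
  proof cases
    case 6
    define i where "i = s - 5"
    have "s = i + 5" using 6 by (simp add: i_def)
    then have "2 ^ s = 8 * (4 * 2 ^ i :: nat)" by (simp add: power_add)
    then show ?thesis using weight_multiple_8[of "4 * 2 ^ i"] assms by simp
  qed (use assms weight_1 weight_2 weight_4 weight_8 weight_16 in auto)
qed


section \<open>Strong reachability\<close>

text \<open>Two falls that branch and end at the same vertex would glue to a non-backtracking walk
  of at most \<open>len\<close> edges with equal ends. If they do not branch, one is a prefix of the
  other, and a proper prefix would repeat the common end.\<close>

lemma last_inj_Fall:
  assumes p: "p \<in> Fall a u" and p': "p' \<in> Fall b u" and ab: "0 < a" "0 < b" "a + b \<le> len"
    and l: "last p = last p'"
  shows "p = p'"
proof -
  note P = Fall_props[OF p] and Q = Fall_props[OF p']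
  have l': "p ! a = p' ! b" using l P Q by (metis diff_Suc_1 last_conv_nth nb_nonempty)
  have dp: "distinct p" "distinct p'" using nbw_distinct P Q ab by auto
  show ?thesis
  proof (cases "\<exists>j \<le> min a b. p ! j \<noteq> p' ! j")
    case True
    define j where "j = (LEAST j. j \<le> min a b \<and> p ! j \<noteq> p' ! j)"
    have j: "j \<le> min a b" "p ! j \<noteq> p' ! j" using LeastI_ex[of "\<lambda>j. j \<le> min a b \<and> p ! j \<noteq> p' ! j"] True
      by (auto simp: j_def)
    have j0: "j \<noteq> 0" using j P Q by (metis)
    define i where "i = j - 1"
    have i: "j = Suc i" using j0 by (simp add: i_def)
    have "i < j" using i by simp
    from not_less_Least[OF this[unfolded j_def]] have "p ! i = p' ! i" using i j(1) by auto
    then have "nb (glue (drop i p) (drop i p'))"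
      using j i P Q by (intro nb_glue nb_drop) auto
    moreover have lg: "length (glue (drop i p) (drop i p')) = Suc ((a - i) + (b - i))"
      using P Q i j by auto
    ultimately have d: "distinct (glue (drop i p) (drop i p'))"
      using nbw_distinct ab by simp
    have "glue (drop i p) (drop i p') ! 0 = p ! a"
      using glue_nth_left[of 0 "drop i p" "drop i p'"] P Q i j \<open>p ! i = p' ! i\<close> by simp
    moreover have "glue (drop i p) (drop i p') ! ((a - i) + (b - i)) = p' ! b"
      using glue_nth_right[of "drop i p" "drop i p'" "b - i"] P Q i j by simp
    moreover have "0 < (a - i) + (b - i)" using i j by simp
    ultimately show ?thesis using d lg l' by (metis lessI nth_eq_iff_index_eq zero_less_Suc less_irrefl)
  next
    case False
    then have eq: "p ! j = p' ! j" if "j \<le> a" "j \<le> b" for j using that by auto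
    consider "a = b" | "a < b" | "b < a" by linarith
    then show ?thesis
    proof cases
      case 1
      then show ?thesis using P Q eq by (intro nth_equalityI) auto
    next
      case 2
      then have "p' ! a = p' ! b" using eq[of a] l' by simp
      then show ?thesis using dp(2) Q(2) 2 by (simp add: nth_eq_iff_index_eq)
    next
      case 3
      then have "p ! b = p ! a" using eq[of b] l' by simp
      then show ?thesis using dp(1) P(2) 3 by (simp add: nth_eq_iff_index_eq)
    qed
  qed
qed

lemma card_last_Fall:
  assumes "2 * r \<le> len"
  shows "card (last ` (\<Union>n\<in>{1..r}. Fall n u)) = (\<Sum>n = 1..r. card (Fall n u))"
proof -
  have "inj_on last (\<Union>n\<in>{1..r}. Fall n u)"
  proof (rule inj_onI)
    fix p p' assume pq: "p \<in> (\<Union>n\<in>{1..r}. Fall n u)" "p' \<in> (\<Union>n\<in>{1..r}. Fall n u)" "last p = last p'"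
    then obtain a b where "a \<in> {1..r}" "p \<in> Fall a u" "b \<in> {1..r}" "p' \<in> Fall b u" by blast
    then show "p = p'" using last_inj_Fall[of p a u p' b] pq(3) assms by auto
  qed
  then have "card (last ` (\<Union>n\<in>{1..r}. Fall n u)) = card (\<Union>n\<in>{1..r}. Fall n u)" by (rule card_image)
  also have "\<dots> = (\<Sum>n = 1..r. card (Fall n u))"
    using finite_Fall by (intro card_UN_disjoint) (auto simp: Fall_def walks_def)
  finally show ?thesis .
qed

text \<open>The right hand side has exactly the left hand side as its average over \<open>u\<close>.
  The summand 1 stands for \<open>u\<close> itself, which is strongly reachable from itself.\<close>

lemma exists_many_falls:
  "\<exists>u\<in>V. 1 + (real D + 1) / 2 * weight r \<le> real (1 + (\<Sum>n = 1..r. card (Fall n u)))"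
proof (rule ccontr)
  assume "\<not> ?thesis"
  then have lt: "real (1 + (\<Sum>n = 1..r. card (Fall n u))) < 1 + (real D + 1) / 2 * weight r" if "u \<in> V" for u
    using that by (auto simp: not_le)
  have "(\<Sum>u\<in>V. real (1 + (\<Sum>n = 1..r. card (Fall n u)))) < (\<Sum>u\<in>V. 1 + (real D + 1) / 2 * weight r)"
    using lt finite_V V_nonempty by (intro sum_strict_mono) auto
  moreover have "(\<Sum>u\<in>V. real (1 + (\<Sum>n = 1..r. card (Fall n u)))) = card V + (\<Sum>n = 1..r. real (X n))"
    by (simp add: sum.distrib X_def sum.swap[of _ V])
  moreover have "(\<Sum>n = 1..r. real (X n)) = card V * ((real D + 1) / 2 * weight r)"
    unfolding weight_def sum_distrib_left
  proof (rule sum.cong[OF refl])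
    fix n assume "n \<in> {1..r}"
    then have "real (X n) = \<xi> n * real (card V * (Suc D * D ^ (n - 1)))" using \<xi>_card[of n] by simp
    then show "real (X n) = card V * ((real D + 1) / 2 * (real D ^ (n - 1) * (2 * \<xi> n)))"
      by (simp only: of_nat_mult of_nat_Suc of_nat_power) simp
  qed
  ultimately show False by (simp add: distrib_left)
qed

end

section \<open>From digraphs to the walk model\<close>

lemma vwalk_arcs_nth:
  "e \<in> set (vwalk_arcs p) \<Longrightarrow> \<exists>i. Suc i < length p \<and> e = (p ! i, p ! Suc i)"
proof (induction p rule: vwalk_arcs.induct)
  case (3 x y xs)
  show ?case
  proof (cases "e = (x, y)")
    case True then show ?thesis by (intro exI[of _ 0]) simp
  next
    case False
    then obtain i where "Suc i < length (y # xs)" "e = ((y # xs) ! i, (y # xs) ! Suc i)" using 3 by auto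
    then show ?thesis by (intro exI[of _ "Suc i"]) simp
  qed
qed auto

definition neighbours :: "('a, 'b) pre_digraph \<Rightarrow> 'a \<Rightarrow> 'a set" where
  "neighbours G x = {y. (x, y) \<in> arcs_ends G}"

lemma nbw_imp_vwalk:
  assumes "nbw (verts G) (neighbours G) p" shows "vwalk p G"
  using assms vwalk_arcs_nth[of _ p] unfolding nbw_def vwalk_def neighbours_def by blast

lemma (in wf_digraph) vwalk_imp_awalk:
  assumes "vwalk p G" shows "\<exists>es. awalk (hd p) es (last p) \<and> awalk_verts (hd p) es = p"
  using assms
proof (induction p rule: vwalk_induct)
  case (Base u)
  then show ?case by (intro exI[of _ "[]"]) (simp add: awalk_def)
next
  case (Cons u v es)
  then obtain as e where as: "awalk v as (last (v # es))" "awalk_verts v as = v # es"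
    and e: "e \<in> arcs G" "tail G e = u" "head G e = v"
    by (auto simp: arcs_ends_def arc_to_ends_def)
  then show ?case by (intro exI[of _ "e # as"]) (auto simp: awalk_def)
qed

lemma (in graph) card_neighbours:
  assumes "v \<in> verts G" shows "card (neighbours G v) = out_degree G v"
proof -
  have "neighbours G v = head G ` out_arcs G v"
    by (auto simp: neighbours_def arcs_ends_def arc_to_ends_def out_arcs_def image_iff)
  moreover have "inj_on (head G) (out_arcs G v)"
    using no_multi_arcs by (auto simp: inj_on_def out_arcs_def arc_to_ends_def)
  ultimately show ?thesis by (simp add: out_degree_def card_image)
qed

text \<open>A repetition at minimal distance in a non-backtracking walk closes a cycle.\<close>

lemma (in graph) nbw_distinct_of_girth:
  assumes p: "nbw (verts G) (neighbours G) p" and l: "length p \<le> Suc m" and girth: "enat (Suc m) \<le> girth G"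
  shows "distinct p"
proof (rule ccontr)
  let ?R = "\<lambda>k. 0 < k \<and> (\<exists>i. i + k < length p \<and> p ! i = p ! (i + k))"
  assume "\<not> distinct p"
  then obtain a b where ab: "a < length p" "b < length p" "a < b" "p ! a = p ! b"
    by (metis distinct_conv_nth linorder_neqE_nat)
  then have ex: "?R (b - a)" by (auto intro!: exI[of _ a])
  define k where "k = (LEAST k. ?R k)"
  have "?R k" unfolding k_def by (rule LeastI[of ?R, OF ex])
  then obtain i where k: "0 < k" and i: "i + k < length p" "p ! i = p ! (i + k)" by auto
  have min: "p ! x \<noteq> p ! y" if "x < y" "y < length p" "y - x < k" for x y
  proof
    assume "p ! x = p ! y"
    then have "?R (y - x)" using that by (auto intro!: exI[of _ x])
    with not_less_Least[OF that(3)[unfolded k_def]] show False by blast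
  qed
  define c where "c = take (Suc k) (drop i p)"
  have lc: "length c = Suc k" using i by (simp add: c_def)
  have cn: "c ! j = p ! (i + j)" if "j \<le> k" for j using that i by (simp add: c_def)
  have step: "(p ! j, p ! Suc j) \<in> arcs_ends G" if "Suc j < length p" for j
    using p that by (simp add: nbw_def neighbours_def)
  have k3: "3 \<le> k"
  proof (rule ccontr)
    assume "\<not> 3 \<le> k"
    then consider "k = 1" | "k = 2" using k by linarith
    then show False
    proof cases
      case 1
      then have "(p ! i, p ! i) \<in> arcs_ends G" using step[of i] i by simp
      then show False by (auto simp: arcs_ends_def arc_to_ends_def dest: no_loops)
    next
      case 2
      then have "Suc (Suc i) < length p" "p ! Suc (Suc i) = p ! i" using i by auto
      then show False using p unfolding nbw_def by blast
    qed
  qed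
  have "nbw (verts G) (neighbours G) c"
    using p i unfolding nbw_def c_def by (auto dest!: in_set_takeD in_set_dropD)
  then obtain es where es: "awalk (hd c) es (last c)" "awalk_verts (hd c) es = c"
    using vwalk_imp_awalk[OF nbw_imp_vwalk] by blast
  have les: "length es = k" using length_awalk_verts[of "hd c" es] es(2) lc by simp
  have "hd c = last c"
  proof -
    have "c \<noteq> []" using lc by auto
    then show ?thesis using cn[of 0] cn[of k] lc i by (simp add: hd_conv_nth last_conv_nth)
  qed
  moreover have "distinct (tl c)"
    unfolding distinct_conv_nth
  proof (intro allI impI)
    have ne: "tl c ! x \<noteq> tl c ! y" if "x < y" "y < k" for x y
      using min[of "i + Suc x" "i + Suc y"] cn[of "Suc x"] cn[of "Suc y"] that i lc
      by (simp add: nth_tl)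
    fix x y assume "x < length (tl c)" "y < length (tl c)" "x \<noteq> y"
    then show "tl c ! x \<noteq> tl c ! y" using ne[of x y] ne[of y x] lc by (cases "x < y") auto
  qed
  ultimately have "cycle es" using es les k by (auto simp: cycle_def)
  then have "girth G \<le> enat k"
    unfolding girth_def using k3 les by (auto intro!: INF_lower2[of es])
  then have "enat (Suc m) \<le> enat k" using girth by (rule order_trans[rotated])
  then show False using i l by simp
qed

lemma two_power_floor_log_le:
  assumes "1 \<le> (r :: nat)" shows "2 ^ nat \<lfloor>log 2 (real r)\<rfloor> \<le> r"
proof -
  have "0 \<le> log 2 (real r)" using assms by simp
  then have "real (2 ^ nat \<lfloor>log 2 (real r)\<rfloor>) = 2 powr of_int \<lfloor>log 2 (real r)\<rfloor>"
    by (simp add: powr_realpow[symmetric])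
  also have "\<dots> \<le> 2 powr log 2 (real r)" by (intro powr_mono) auto
  also have "\<dots> = real r" using assms by simp
  finally show ?thesis using of_nat_le_iff by blast
qed

theorem theorem4:
  fixes G :: "('a, 'b) pre_digraph" and d g r :: nat
  assumes "graph G" and "verts G \<noteq> {}"
    and "d \<ge> 7" and "g \<ge> 1"
    and "regular_graph G d"
    and "girth G \<ge> enat (4 * g + 1)"
    and "1 \<le> r" and "r \<le> g"
  shows "real (col r G) \<ge> real d / 2 * ((real d - 2) / 4) ^ (2 ^ nat \<lfloor>log 2 (real r)\<rfloor> - 1)"
proof -
  interpret G: graph G by fact
  obtain L where L: "L \<in> linear_orders G" "col r G = max_SReach r G L"
    by (rule col_attained[of G r]) simp
  interpret nb_graph "verts G" "neighbours G" "d - 1" L "4 * g"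
  proof
    show "neighbours G x \<subseteq> verts G" if "x \<in> verts G" for x
      by (auto simp: neighbours_def arcs_ends_def arc_to_ends_def)
    show "x \<in> neighbours G y" if "x \<in> verts G" "y \<in> neighbours G x" for x y
      using that G.sym_arcs by (auto simp: neighbours_def symmetric_def elim: symD)
    show "card (neighbours G x) = Suc (d - 1)" if "x \<in> verts G" for x
      using G.card_neighbours[OF that] assms(3,5) that by (simp add: regular_graph_def)
    show "inj_on L (verts G)" using L(1) by (simp add: linear_orders_def)
    show "distinct p" if "nbw (verts G) (neighbours G) p" "length p \<le> Suc (4 * g)" for p
      using G.nbw_distinct_of_girth[OF that] assms(6) by simp
  qed (use assms in auto)
  define s where "s = nat \<lfloor>log 2 (real r)\<rfloor>"
  \<comment> \<open>Only falls up to the largest power of two not exceeding \<open>r\<close> are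
    counted; their ends are reachable within radius \<open>r\<close> as well.\<close>
  have sr: "2 ^ s \<le> r" unfolding s_def by (rule two_power_floor_log_le[OF assms(7)])
  obtain u where u: "u \<in> verts G"
    and many: "1 + (real (d - 1) + 1) / 2 * weight (2 ^ s) \<le> real (1 + (\<Sum>n = 1..2 ^ s. card (Fall n u)))"
    using exists_many_falls by blast
  let ?S = "last ` (\<Union>n\<in>{1..2 ^ s}. Fall n u)"
  have "insert u ?S \<subseteq> SReach r G L u"
  proof -
    have "vpath [u] G" using u by (auto simp: vpath_def vwalk_def)
    then have "u \<in> SReach r G L u" unfolding SReach_def by (auto intro!: exI[of _ "[u]"])
    moreover have "last p \<in> SReach r G L u" if n: "n \<in> {1..2 ^ s}" and p: "p \<in> Fall n u" for n p
    proof -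
      note P = Fall_props[OF p]
      have ne: "p \<noteq> []" using P(2) by auto
      have l: "last p = p ! n" using ne P(2) by (simp add: last_conv_nth)
      have "distinct p" using nbw_distinct[OF P(1)] P(2) n sr assms(8) by simp
      then have "vpath p G" using nbw_imp_vwalk[OF P(1)] by (simp add: vpath_def)
      moreover have "hd p = u" using ne P(3) by (simp add: hd_conv_nth)
      moreover have "vwalk_length p \<le> r" using P(2) n sr by simp
      moreover have "L (last p) \<le> L w \<and> (w \<notin> {u, last p} \<longrightarrow> L u < L w)" if "w \<in> set p" for w
      proof -
        from that obtain i where "i < length p" and w: "w = p ! i" by (auto simp: in_set_conv_nth)
        then have i: "i \<le> n" using P(2) by simp
        then consider "i = 0" | "i = n" | "0 < i" "i < n" by linarith
        then show ?thesis using P(3,4) P(6)[of i] w l by cases auto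
      qed
      ultimately show ?thesis unfolding SReach_def by blast
    qed
    ultimately show ?thesis by blast
  qed
  then have "card (insert u ?S) \<le> card (SReach r G L u)"
    by (rule card_mono[OF finite_subset[OF SReach_subset G.finite_verts]])
  moreover have "card (insert u ?S) = 1 + (\<Sum>n = 1..2 ^ s. card (Fall n u))"
  proof -
    have "u \<notin> ?S"
    proof
      assume "u \<in> ?S"
      then obtain n p where p: "p \<in> Fall n u" "u = last p" by auto
      then have "last p = p ! n" using Fall_props(1,2)[OF p(1)] nb_nonempty by (simp add: last_conv_nth)
      then have "L (last p) < L u" using Fall_props(4)[OF p(1)] by simp
      then show False using p(2) by simp
    qed
    moreover have "finite ?S" using finite_Fall by auto
    ultimately show ?thesis using card_last_Fall[of "2 ^ s" u] sr assms(8) by simp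
  qed
  moreover have "card (SReach r G L u) \<le> max_SReach r G L"
    unfolding max_SReach_def using u by (intro Max_ge) auto
  ultimately have "1 + (\<Sum>n = 1..2 ^ s. card (Fall n u)) \<le> col r G" unfolding L(2) by linarith
  then have "real (1 + (\<Sum>n = 1..2 ^ s. card (Fall n u))) \<le> real (col r G)" by (rule of_nat_mono)
  with many have "1 + (real (d - 1) + 1) / 2 * weight (2 ^ s) \<le> real (col r G)" by (rule order_trans)
  moreover have "((real (d - 1) - 1) / 4) ^ (2 ^ s - 1) \<le> weight (2 ^ s)"
    using weight_power_2[of s] sr assms(8) by simp
  moreover have "real (d - 1) = real d - 1" using assms(3) by simp
  ultimately have "real d / 2 * weight (2 ^ s) \<le> real (col r G)"
    and "((real d - 2) / 4) ^ (2 ^ s - 1) \<le> weight (2 ^ s)" by simp_all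
  moreover from this(2) have "real d / 2 * ((real d - 2) / 4) ^ (2 ^ s - 1) \<le> real d / 2 * weight (2 ^ s)"
    by (intro mult_left_mono) auto
  ultimately show ?thesis unfolding s_def by linarith
qed

end
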